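(* Let $n\ge 2$, let $\omega(k)=\sum_{j=2}^n\omega_jk^j$ be a polynomial with real coefficients and $\omega_n\neq0$, let $q_o\in L^2(\mathbb R)\cap L^1(\mathbb R,(1+|x|)^\ell\,dx)$ for some $\ell\in\mathbb R$, and let $$q(x,t)=\frac1{2\pi}\int_{-\infty}^\infty e^{ikx-i\omega(k)t}\,\hat q_o(k)\,dk .$$ (i) Let $m\ge 0$ be an integer. If $\ell\ge\frac{2m-n+2}{2(n-1)}$, then $q(x,t)$ is differentiable $m$ times with respect to $x$ for $t>0$, and $\partial_x^mq(x,t)$ is continuous as a function of $(x,t)\in\mathbb R\times(0,\infty)$. (ii) Let $j\ge0$ be an integer. If $\ell\ge\frac{2jn-n+2}{2(n-1)}$, then $q(x,t)$ is differentiable $j$ times with respect to $t$ for $t>0$, and $\partial_t^jq(x,t)$ is continuous as a function of $(x,t)\in\mathbb R\times(0,\infty)$.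
   Context: The Fourier transform is $\hat q_o(k)=\int_{\mathbb R}e^{-ikx}q_o(x)\,dx$. For $q_o\in L^2(\mathbb R)$ the formula for $q(\cdot,t)$ is understood as the inverse Fourier transform in $L^2(\mathbb R)$, so that $q$ is the $L^2$ solution of $iq_t-\omega(-i\partial_x)q=0$, $q(x,0)=q_o(x)$. Regularity statements refer to $q$ after modification, for each $t$, on a null set of $x$. *)

theory Defs
  imports "HOL-Analysis.Analysis"
begin

definition square_integrable :: "(real \<Rightarrow> complex) \<Rightarrow> bool" where
  "square_integrable f \<longleftrightarrow>
     f \<in> borel_measurable lebesgue \<and> integrable lebesgue (\<lambda>x. (norm (f x))\<^sup>2)"

definition weighted_integrable :: "real \<Rightarrow> (real \<Rightarrow> complex) \<Rightarrow> bool" where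
  "weighted_integrable l f \<longleftrightarrow>
     f \<in> borel_measurable lebesgue \<and>
     integrable lebesgue (\<lambda>x. (1 + \<bar>x\<bar>) powr l * norm (f x))"

text \<open>Functions stand for their classes modulo null sets. A square integrable function need
  not be integrable, so its transform is the limit in the mean of the truncated Fourier integrals.
  The nonnegative integral is used for the squared distance, since the Bochner integral of a
  non-integrable function is 0 by convention.\<close>

definition L2_tendsto :: "(real \<Rightarrow> real \<Rightarrow> complex) \<Rightarrow> (real \<Rightarrow> complex) \<Rightarrow> bool" where
  "L2_tendsto F g \<longleftrightarrow>
     ((\<lambda>R. \<integral>\<^sup>+ x. ennreal ((norm (F R x - g x))\<^sup>2) \<partial>lebesgue) \<longlongrightarrow> 0) at_top"

definition is_L2_fourier :: "(real \<Rightarrow> complex) \<Rightarrow> (real \<Rightarrow> complex) \<Rightarrow> bool" where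
  "is_L2_fourier f g \<longleftrightarrow> square_integrable g \<and>
     L2_tendsto (\<lambda>R k. LINT x:{-R..R}|lebesgue.
                   exp (- \<i> * complex_of_real k * complex_of_real x) * f x) g"

definition is_L2_inverse_fourier :: "(real \<Rightarrow> complex) \<Rightarrow> (real \<Rightarrow> complex) \<Rightarrow> bool" where
  "is_L2_inverse_fourier g f \<longleftrightarrow> square_integrable f \<and>
     L2_tendsto (\<lambda>R x. 1 / (2 * complex_of_real pi) *
                   (LINT k:{-R..R}|lebesgue.
                      exp (\<i> * complex_of_real k * complex_of_real x) * g k)) f"

text \<open>For square integrable arguments the following transforms exist and are unique up to null
  sets (Plancherel); the choice operator merely selects a representative.\<close>

definition L2_fourier :: "(real \<Rightarrow> complex) \<Rightarrow> real \<Rightarrow> complex" where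
  "L2_fourier f = (SOME g. is_L2_fourier f g)"

definition L2_inverse_fourier :: "(real \<Rightarrow> complex) \<Rightarrow> real \<Rightarrow> complex" where
  "L2_inverse_fourier g = (SOME f. is_L2_inverse_fourier g f)"

definition dispersion :: "nat \<Rightarrow> (nat \<Rightarrow> real) \<Rightarrow> real \<Rightarrow> real" where
  "dispersion n w k = (\<Sum>j=2..n. w j * k ^ j)"

definition dispersive_solution ::
    "(real \<Rightarrow> real) \<Rightarrow> (real \<Rightarrow> complex) \<Rightarrow> real \<Rightarrow> real \<Rightarrow> complex" where
  "dispersive_solution \<omega> q0 x t =
     L2_inverse_fourier
       (\<lambda>k. exp (- \<i> * complex_of_real (\<omega> k) * complex_of_real t) * L2_fourier q0 k) x"

definition nth_vderiv :: "nat \<Rightarrow> (real \<Rightarrow> complex) \<Rightarrow> real \<Rightarrow> complex" where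
  "nth_vderiv m f = ((\<lambda>g x. vector_derivative g (at x)) ^^ m) f"

text \<open>Intended for open \<open>S\<close>, as the derivatives are two-sided.\<close>

definition times_differentiable_on :: "nat \<Rightarrow> (real \<Rightarrow> complex) \<Rightarrow> real set \<Rightarrow> bool" where
  "times_differentiable_on m f S \<longleftrightarrow>
     (\<forall>i<m. \<forall>x\<in>S. nth_vderiv i f differentiable (at x))"

end

theory Submission
  imports Defs "HOL-Probability.Probability"
begin

text \<open>For \<open>t > 0\<close> the solution is the convolution of \<open>q\<^sub>o\<close> with the fundamental solution \<open>K\<close>, the
  oscillatory integral of \<open>e\<^bsup>ikx - i\<omega>(k)t\<^esup>\<close>. Van der Corput estimates give
  \<open>\<partial>\<^sub>x\<^sup>m K = O((1 + \<bar>x\<bar>)\<^sup>p)\<close> with \<open>p = (2m - n + 2) / (2(n - 1))\<close> for \<open>m \<le> n - 2\<close>, locally uniformly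
  in \<open>t\<close>. Integration by parts shows that \<open>t \<omega>'(-i\<partial>\<^sub>x) K = x K\<close>, which extends the estimates to all \<open>m\<close>, and
  each time derivative costs \<open>n\<close> space derivatives by the equation \<open>i K\<^sub>t = \<omega>(-i\<partial>\<^sub>x) K\<close>. The weight
  on \<open>q\<^sub>o\<close> is what differentiation under the convolution integral requires. To identify the
  convolution with the mean-square limit defining the solution, Bessel's inequality for the
  Fourier integral suffices: the truncated inverse integrals converge pointwise to the
  convolution, so Fatou's lemma gives equality almost everywhere.\<close>

section \<open>Van der Corput estimates\<close>

text \<open>No moment of the oscillatory integrand converges absolutely. For
  \<open>m <= n - 2\<close> the amplitude \<open>k ^ m\<close> is beaten by the phase derivative, of
  order \<open>k ^ (n - 1)\<close>, so symmetric truncations converge conditionally; from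
  \<open>m = n - 1\<close> on the boundary terms no longer decay. Hence a factor
  \<open>exp (- e * k^2)\<close> is inserted, all tail estimates are made uniform in
  \<open>e >= 0\<close>, and \<open>kern\<close> is the limit as \<open>e\<close> tends to 0. These
  limits are locally uniform for every order, so derivatives in \<open>x\<close> and
  \<open>t\<close> pass to the limit, while for low orders they agree with the truncated integrals,
  which carry the growth bounds. The exponent fits the recursion: passing from order
  \<open>m\<close> to \<open>m + n - 1\<close> costs one factor \<open>x\<close> and raises
  \<open>growth_exponent\<close> by exactly 1. The weight exponent may be negative, so the data may
  fail to be integrable and both transforms are mean-square limits. The cut-off
  \<open>|k| <= R\<close> is therefore kept until the end: on it the pairing with the transform is
  continuous in L2, Fubini applies to truncated data, and the bounds on truncated kernels, uniform
  in \<open>R\<close>, allow \<open>R\<close> to tend to infinity.\<close>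

text \<open>This is integration by parts with boundary term and error kept apart: \<open>H\<close>
  is an explicit approximate antiderivative, and the defect \<open>f - H'\<close> is dominated by a
  function with a known primitive \<open>B\<close>.\<close>

lemma norm_integral_le_approx_antiderivative:
  fixes f H :: "real \<Rightarrow> 'a::euclidean_space" and B :: "real \<Rightarrow> real"
  assumes "a \<le> b" and f: "f integrable_on {a..b}"
    and H: "\<And>k. k \<in> {a..b} \<Longrightarrow> (H has_vector_derivative H' k) (at k within {a..b})"
    and B: "\<And>k. k \<in> {a..b} \<Longrightarrow> (B has_real_derivative B' k) (at k within {a..b})"
    and le: "\<And>k. k \<in> {a..b} \<Longrightarrow> norm (f k - H' k) \<le> B' k"
  shows "norm (integral {a..b} f) \<le> norm (H b - H a) + (B b - B a)"
proof -
  have 1: "(H' has_integral H b - H a) {a..b}"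
    by (rule fundamental_theorem_of_calculus[OF \<open>a \<le> b\<close> H])
  have 2: "(B' has_integral B b - B a) {a..b}"
    by (rule fundamental_theorem_of_calculus[OF \<open>a \<le> b\<close>])
      (use B in \<open>auto simp: has_real_derivative_iff_has_vector_derivative\<close>)
  have 3: "(\<lambda>k. f k - H' k) integrable_on {a..b}"
    using f 1 by (intro integrable_diff) (auto simp: integrable_on_def)
  have "norm (integral {a..b} (\<lambda>k. f k - H' k)) \<le> integral {a..b} B'"
    by (rule integral_norm_bound_integral[OF 3 _ le]) (use 2 in \<open>auto simp: integrable_on_def\<close>)
  also have "\<dots> = B b - B a"
    using 2 by (rule integral_unique)
  finally have 4: "norm (integral {a..b} (\<lambda>k. f k - H' k)) \<le> B b - B a" .
  have "integral {a..b} f = (H b - H a) + integral {a..b} (\<lambda>k. f k - H' k)"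
    using 1 f integral_diff[of f "{a..b}" H'] by (auto simp: integral_unique integrable_on_def)
  then show ?thesis
    using 4 norm_triangle_mono[OF order_refl 4] by simp
qed

lemma has_vector_derivative_cis:
  assumes "(f has_real_derivative f') (at x within A)"
  shows "((\<lambda>x. cis (f x)) has_vector_derivative of_real f' * (\<i> * cis (f x))) (at x within A)"
  using has_derivative_cis[OF assms[unfolded has_field_derivative_def]]
  by (simp add: has_vector_derivative_def scaleR_conv_of_real mult_ac)

text \<open>Integrating \<open>e\<^sup>i\<^sup>\<phi> \<phi>' / (\<phi>'\<^sup>2 + \<mu>)\<close> by parts avoids separating
  the points where \<open>\<phi>'\<close> is small from the rest.\<close>

lemma van_der_Corput_second:
  fixes \<psi> \<phi> \<phi>' \<phi>'' :: "real \<Rightarrow> real"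
  assumes "a \<le> b" "\<mu> > 0"
    and phi: "\<And>k. k \<in> {a..b} \<Longrightarrow> (\<phi> has_real_derivative \<phi>' k) (at k within {a..b})"
    and phi': "\<And>k. k \<in> {a..b} \<Longrightarrow> (\<phi>' has_real_derivative \<phi>'' k) (at k within {a..b})"
    and mu: "\<And>k. k \<in> {a..b} \<Longrightarrow> \<mu> \<le> \<phi>'' k"
    and psi: "\<And>k. k \<in> {a..b} \<Longrightarrow> (\<psi> has_real_derivative \<psi>' k) (at k within {a..b})"
    and psi': "\<And>k. k \<in> {a..b} \<Longrightarrow> 0 \<le> \<psi>' k"
    and psi0: "0 \<le> \<psi> a"
  shows "norm (integral {a..b} (\<lambda>k. complex_of_real (\<psi> k) * cis (\<phi> k))) \<le> 8 * \<psi> b / sqrt \<mu>"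
proof -
  define d where "d = sqrt \<mu>"
  have d: "d > 0" "d\<^sup>2 = \<mu>" using assms by (auto simp: d_def)
  have mono: "\<psi> x \<le> \<psi> y" if "a \<le> x" "x \<le> y" "y \<le> b" for x y
  proof (rule DERIV_nonneg_imp_increasing_open[OF \<open>x \<le> y\<close>])
    show "continuous_on {x..y} \<psi>"
      by (rule DERIV_continuous_on[of _ _ \<psi>'])
        (use that in \<open>auto intro!: DERIV_subset[OF psi]\<close>)
    show "\<exists>z'. (\<psi> has_real_derivative z') (at z) \<and> 0 \<le> z'" if "x < z" "z < y" for z
    proof -
      have "z \<in> interior {a..b}" using that \<open>a \<le> x\<close> \<open>y \<le> b\<close> by auto
      then have "at z within {a..b} = at z" by (rule at_within_interior)
      then show ?thesis using psi[of z] psi'[of z] that \<open>a \<le> x\<close> \<open>y \<le> b\<close> by auto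
    qed
  qed
  \<comment> \<open>The quotient \<open>\<phi>' / (\<phi>'^2 + d^2)\<close> stands in for
    \<open>1 / \<phi>'\<close>: it is close to it where \<open>\<phi>'\<close> is large compared
    with \<open>d = sqrt \<mu>\<close>, and it never exceeds \<open>1 / (2 * d)\<close>, so a zero
    of \<open>\<phi>'\<close> does no harm.\<close>
  define H where "H k = (- \<i> * of_real (\<psi> k * (\<phi>' k / ((\<phi>' k)\<^sup>2 + d\<^sup>2)))) * cis (\<phi> k)" for k
  define G where "G k = \<psi>' k * (\<phi>' k / ((\<phi>' k)\<^sup>2 + d\<^sup>2)) +
     \<psi> k * (\<phi>'' k * (d\<^sup>2 - (\<phi>' k)\<^sup>2) / ((\<phi>' k)\<^sup>2 + d\<^sup>2)\<^sup>2)" for k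
  define H' where "H' k = (- \<i> * of_real (G k)) * cis (\<phi> k) +
     of_real (\<psi> k * ((\<phi>' k)\<^sup>2 / ((\<phi>' k)\<^sup>2 + d\<^sup>2))) * cis (\<phi> k)" for k
  have pos: "s\<^sup>2 + d\<^sup>2 > 0" for s :: real using d(1) by (simp add: add_nonneg_pos)
  have g_le: "\<bar>s / (s\<^sup>2 + d\<^sup>2)\<bar> \<le> 1 / (2 * d)" for s :: real
  proof -
    have "0 \<le> (\<bar>s\<bar> - d)\<^sup>2" by simp
    then have "2 * d * \<bar>s\<bar> \<le> s\<^sup>2 + d\<^sup>2" by (simp add: power2_eq_square algebra_simps abs_mult_self_eq)
    then show ?thesis using pos[of s] d by (simp add: abs_div field_simps)
  qed
  \<comment> \<open>The first summand absorbs the variation of \<open>\<psi>\<close>. The second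
    absorbs two errors of size \<open>\<psi> b * \<phi>'' / (\<phi>'^2 + d^2)\<close>, one from the
    derivative of the quotient and one from the part of the integrand missed by \<open>H'\<close>.
    Its primitive is an arctangent, so the total is bounded however long the interval is.\<close>
  define B where "B k = \<psi> k / (2 * d) + 2 * \<psi> b * arctan (\<phi>' k / d) / d" for k
  define B' where "B' k = \<psi>' k / (2 * d) + 2 * \<psi> b * (\<phi>'' k / ((\<phi>' k)\<^sup>2 + d\<^sup>2))" for k
  note phic = DERIV_continuous_on[OF phi] DERIV_continuous_on[OF psi]
  have "norm (integral {a..b} (\<lambda>k. complex_of_real (\<psi> k) * cis (\<phi> k)))
       \<le> norm (H b - H a) + (B b - B a)"
  proof (rule norm_integral_le_approx_antiderivative[OF \<open>a \<le> b\<close>, where H' = H' and B' = B'])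
    show "(\<lambda>k. complex_of_real (\<psi> k) * cis (\<phi> k)) integrable_on {a..b}"
      by (intro integrable_continuous_interval continuous_intros phic)
    fix k assume k: "k \<in> {a..b}"
    have "((\<lambda>k. (\<phi>' k)\<^sup>2 + d\<^sup>2) has_real_derivative 2 * \<phi>' k * \<phi>'' k) (at k within {a..b})"
      by (auto intro!: derivative_eq_intros phi'[OF k])
    from DERIV_divide[OF phi'[OF k] this]
    have "((\<lambda>k. \<phi>' k / ((\<phi>' k)\<^sup>2 + d\<^sup>2)) has_real_derivative
        \<phi>'' k * (d\<^sup>2 - (\<phi>' k)\<^sup>2) / ((\<phi>' k)\<^sup>2 + d\<^sup>2)\<^sup>2) (at k within {a..b})"
      using pos[of "\<phi>' k"] d(1) by (simp add: power2_eq_square algebra_simps)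
    from DERIV_mult[OF psi[OF k] this]
    have 1: "((\<lambda>k. \<psi> k * (\<phi>' k / ((\<phi>' k)\<^sup>2 + d\<^sup>2))) has_real_derivative G k) (at k within {a..b})"
      by (simp add: G_def algebra_simps)
    have "((\<lambda>k. - \<i> * (of_real (\<psi> k * (\<phi>' k / ((\<phi>' k)\<^sup>2 + d\<^sup>2))) * cis (\<phi> k)))
        has_vector_derivative - \<i> * (of_real (\<psi> k * (\<phi>' k / ((\<phi>' k)\<^sup>2 + d\<^sup>2))) * (of_real (\<phi>' k) * (\<i> * cis (\<phi> k))) + of_real (G k) * cis (\<phi> k))) (at k within {a..b})"
      by (intro has_vector_derivative_mult_right has_vector_derivative_mult has_vector_derivative_of_real
          has_vector_derivative_cis 1 phi k)
    then show "(H has_vector_derivative H' k) (at k within {a..b})"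
      unfolding H_def H'_def by (simp add: algebra_simps power2_eq_square)
    have "1 + (\<phi>' k / d)\<^sup>2 = ((\<phi>' k)\<^sup>2 + d\<^sup>2) / d\<^sup>2"
      using d(1) by (simp add: field_simps)
    then have "inverse (1 + (\<phi>' k / d)\<^sup>2) * (\<phi>'' k / d) = d * (\<phi>'' k / ((\<phi>' k)\<^sup>2 + d\<^sup>2))"
      using d(1) by (simp add: power2_eq_square)
    then have "((\<lambda>k. arctan (\<phi>' k / d)) has_real_derivative d * (\<phi>'' k / ((\<phi>' k)\<^sup>2 + d\<^sup>2))) (at k within {a..b})"
      using DERIV_chain2[OF DERIV_arctan DERIV_cdivide[OF phi'[OF k], of d]] by simp
    from DERIV_add[OF DERIV_cdivide[OF psi[OF k], of "2*d"] DERIV_cmult[OF this, of "2 * \<psi> b / d"]]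
    show "(B has_real_derivative B' k) (at k within {a..b})"
      unfolding B_def B'_def using d(1) by (simp add: mult.assoc)
    have psik: "0 \<le> \<psi> k" "\<psi> k \<le> \<psi> b" using mono[of a k] mono[of k b] k psi0 by auto
    have "complex_of_real (\<psi> k) * cis (\<phi> k) - H' k =
        (\<i> * of_real (G k) + of_real (\<psi> k * (d\<^sup>2 / ((\<phi>' k)\<^sup>2 + d\<^sup>2)))) * cis (\<phi> k)"
    proof -
      have "\<psi> k = \<psi> k * ((\<phi>' k)\<^sup>2 / ((\<phi>' k)\<^sup>2 + d\<^sup>2)) + \<psi> k * (d\<^sup>2 / ((\<phi>' k)\<^sup>2 + d\<^sup>2))"
        using pos[of "\<phi>' k"] d(1) by (simp add: add_divide_distrib[symmetric] distrib_left[symmetric])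
      then have "complex_of_real (\<psi> k) = of_real (\<psi> k * ((\<phi>' k)\<^sup>2 / ((\<phi>' k)\<^sup>2 + d\<^sup>2))) + of_real (\<psi> k * (d\<^sup>2 / ((\<phi>' k)\<^sup>2 + d\<^sup>2)))"
        by (metis of_real_add)
      then show ?thesis unfolding H'_def by (simp add: algebra_simps del: of_real_mult of_real_divide of_real_power)
    qed
    then have "norm (complex_of_real (\<psi> k) * cis (\<phi> k) - H' k) \<le>
        \<bar>G k\<bar> + \<bar>\<psi> k * (d\<^sup>2 / ((\<phi>' k)\<^sup>2 + d\<^sup>2))\<bar>"
      using norm_triangle_ineq[of "\<i> * complex_of_real (G k)" "complex_of_real (\<psi> k * (d\<^sup>2 / ((\<phi>' k)\<^sup>2 + d\<^sup>2)))"]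
      by (simp add: norm_mult del: of_real_mult of_real_divide of_real_power)
    \<comment> \<open>The lower bound on \<open>\<phi>''\<close> enters through
      \<open>d^2 = \<mu> <= \<phi>''\<close>.\<close>
    also have "\<bar>\<psi> k * (d\<^sup>2 / ((\<phi>' k)\<^sup>2 + d\<^sup>2))\<bar> \<le> \<psi> b * (\<phi>'' k / ((\<phi>' k)\<^sup>2 + d\<^sup>2))"
      using psik pos[of "\<phi>' k"] mu[OF k] d by (auto simp: abs_mult intro!: mult_mono divide_right_mono)
    also have "\<bar>G k\<bar> \<le> \<psi>' k * (1 / (2 * d)) + \<psi> b * (\<phi>'' k / ((\<phi>' k)\<^sup>2 + d\<^sup>2))"
    proof -
      have A: "\<bar>\<psi>' k * (\<phi>' k / ((\<phi>' k)\<^sup>2 + d\<^sup>2))\<bar> \<le> \<psi>' k * (1 / (2 * d))"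
        unfolding abs_mult abs_of_nonneg[OF psi'[OF k]] by (intro mult_left_mono g_le psi' k)
      have "\<bar>d\<^sup>2 - (\<phi>' k)\<^sup>2\<bar> \<le> (\<phi>' k)\<^sup>2 + d\<^sup>2" by (simp add: abs_le_iff)
      then have "\<bar>\<phi>'' k * (d\<^sup>2 - (\<phi>' k)\<^sup>2) / ((\<phi>' k)\<^sup>2 + d\<^sup>2)\<^sup>2\<bar> \<le> \<phi>'' k / ((\<phi>' k)\<^sup>2 + d\<^sup>2)"
        using pos[of "\<phi>' k"] mu[OF k] \<open>\<mu> > 0\<close>
        by (simp add: abs_mult power2_eq_square[of "(\<phi>' k)\<^sup>2 + d\<^sup>2"] divide_le_eq pos_le_divide_eq mult_left_mono)
      then have "\<bar>\<psi> k * (\<phi>'' k * (d\<^sup>2 - (\<phi>' k)\<^sup>2) / ((\<phi>' k)\<^sup>2 + d\<^sup>2)\<^sup>2)\<bar> \<le> \<psi> b * (\<phi>'' k / ((\<phi>' k)\<^sup>2 + d\<^sup>2))"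
        using psik pos[of "\<phi>' k"] mu[OF k] \<open>\<mu> > 0\<close> unfolding abs_mult[of "\<psi> k"]
        by (intro mult_mono) auto
      with A show ?thesis unfolding G_def by linarith
    qed
    finally show "norm (complex_of_real (\<psi> k) * cis (\<phi> k) - H' k) \<le> B' k"
      unfolding B'_def by (simp add: field_simps)
  qed
  also have "norm (H b - H a) \<le> \<psi> b / d"
  proof -
    have nH: "norm (H k) \<le> \<psi> b * (1 / (2 * d))" if "k \<in> {a..b}" for k
    proof -
      have psik: "0 \<le> \<psi> k" "\<psi> k \<le> \<psi> b" using mono[of a k] mono[of k b] that psi0 by auto
      have "norm (H k) = \<bar>\<psi> k * (\<phi>' k / ((\<phi>' k)\<^sup>2 + d\<^sup>2))\<bar>"
        unfolding H_def by (simp add: norm_mult del: of_real_mult of_real_divide of_real_power)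
      also have "\<dots> = \<psi> k * \<bar>\<phi>' k / ((\<phi>' k)\<^sup>2 + d\<^sup>2)\<bar>" using psik by (simp add: abs_mult)
      also have "\<dots> \<le> \<psi> b * (1 / (2 * d))" using psik g_le by (intro mult_mono) auto
      finally show ?thesis .
    qed
    have "norm (H b - H a) \<le> norm (H b) + norm (H a)" by (rule norm_triangle_ineq4)
    also have "\<dots> \<le> \<psi> b / d" using nH[of a] nH[of b] \<open>a \<le> b\<close> by simp
    finally show ?thesis .
  qed
  also have "B b - B a \<le> \<psi> b / (2*d) + 2 * \<psi> b * pi / d"
  proof -
    have psib: "0 \<le> \<psi> b" using mono[of a b] psi0 \<open>a \<le> b\<close> by auto
    have "arctan (\<phi>' b / d) - arctan (\<phi>' a / d) \<le> pi"
      using arctan_ubound[of "\<phi>' b / d"] arctan_lbound[of "\<phi>' a / d"] by linarith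
    then have "2 * \<psi> b * (arctan (\<phi>' b / d) - arctan (\<phi>' a / d)) / d \<le> 2 * \<psi> b * pi / d"
      using psib d by (intro divide_right_mono mult_left_mono) auto
    moreover have "B b - B a = (\<psi> b - \<psi> a) / (2*d) + 2 * \<psi> b * (arctan (\<phi>' b / d) - arctan (\<phi>' a / d)) / d"
      unfolding B_def by (simp add: diff_divide_distrib right_diff_distrib)
    moreover have "(\<psi> b - \<psi> a) / (2*d) \<le> \<psi> b / (2*d)" using psi0 d by (intro divide_right_mono) auto
    ultimately show ?thesis by linarith
  qed
  \<comment> \<open>The boundary values give 1, the variation of \<open>\<psi>\<close> gives 1/2 and
    the arctangent \<open>2 * pi\<close>; the sum is below 8.\<close>
  also have "\<psi> b / d + (\<psi> b / (2*d) + 2 * \<psi> b * pi / d) = (3/2 + 2 * pi) * \<psi> b / d"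
    using d(1) by (simp add: field_simps)
  also have "\<dots> \<le> 8 * \<psi> b / d"
  proof -
    have "0 \<le> \<psi> b" using mono[of a b] psi0 \<open>a \<le> b\<close> by auto
    moreover have "3/2 + 2 * pi \<le> (8::real)" using pi_less_4 pi_approx by simp
    ultimately show ?thesis using d by (intro divide_right_mono mult_right_mono) auto
  qed
  finally show ?thesis by (simp add: d_def)
qed


text \<open>Integration by parts with amplitude \<open>\<psi> / \<phi>'\<close>. The remainder is
  controlled by a primitive \<open>B\<close> chosen for each application, which takes the place of
  the usual monotonicity of \<open>\<phi>'\<close>.\<close>

lemma van_der_Corput_first:
  fixes \<psi> \<phi> \<phi>' \<phi>'' :: "real \<Rightarrow> real"
  assumes "a \<le> b"
    and phi: "\<And>k. k \<in> {a..b} \<Longrightarrow> (\<phi> has_real_derivative \<phi>' k) (at k within {a..b})"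
    and phi': "\<And>k. k \<in> {a..b} \<Longrightarrow> (\<phi>' has_real_derivative \<phi>'' k) (at k within {a..b})"
    and nz: "\<And>k. k \<in> {a..b} \<Longrightarrow> \<phi>' k \<noteq> 0"
    and psi: "\<And>k. k \<in> {a..b} \<Longrightarrow> (\<psi> has_real_derivative \<psi>' k) (at k within {a..b})"
    and B: "\<And>k. k \<in> {a..b} \<Longrightarrow> (B has_real_derivative B' k) (at k within {a..b})"
    and le: "\<And>k. k \<in> {a..b} \<Longrightarrow> \<bar>\<psi>' k\<bar> / \<bar>\<phi>' k\<bar> + \<bar>\<psi> k\<bar> * \<bar>\<phi>'' k\<bar> / (\<phi>' k)\<^sup>2 \<le> B' k"
  shows "norm (integral {a..b} (\<lambda>k. complex_of_real (\<psi> k) * cis (\<phi> k)))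
     \<le> \<bar>\<psi> b\<bar> / \<bar>\<phi>' b\<bar> + \<bar>\<psi> a\<bar> / \<bar>\<phi>' a\<bar> + (B b - B a)"
proof -
  note phic = DERIV_continuous_on[OF phi] DERIV_continuous_on[OF psi]
  define H where "H k = - \<i> * (of_real (\<psi> k / \<phi>' k) * cis (\<phi> k))" for k
  define q where "q k = (\<psi>' k * \<phi>' k - \<psi> k * \<phi>'' k) / (\<phi>' k * \<phi>' k)" for k
  have "norm (integral {a..b} (\<lambda>k. complex_of_real (\<psi> k) * cis (\<phi> k)))
       \<le> norm (H b - H a) + (B b - B a)"
  proof (rule norm_integral_le_approx_antiderivative[OF \<open>a \<le> b\<close> _ _ B])
    show "(\<lambda>k. complex_of_real (\<psi> k) * cis (\<phi> k)) integrable_on {a..b}"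
      by (intro integrable_continuous_interval continuous_intros phic)
    fix k assume k: "k \<in> {a..b}"
    have q: "((\<lambda>k. \<psi> k / \<phi>' k) has_real_derivative q k) (at k within {a..b})"
      unfolding q_def by (rule DERIV_divide[OF psi[OF k] phi'[OF k] nz[OF k]])
    show "(H has_vector_derivative - \<i> * (of_real (\<psi> k / \<phi>' k) * (of_real (\<phi>' k) * (\<i> * cis (\<phi> k)))
        + of_real (q k) * cis (\<phi> k))) (at k within {a..b})"
      unfolding H_def
      by (intro has_vector_derivative_mult_right has_vector_derivative_mult has_vector_derivative_of_real
          has_vector_derivative_cis q phi k)
    have "complex_of_real (\<psi> k) * cis (\<phi> k) - - \<i> * (of_real (\<psi> k / \<phi>' k) * (of_real (\<phi>' k) * (\<i> * cis (\<phi> k)))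
        + of_real (q k) * cis (\<phi> k)) = \<i> * of_real (q k) * cis (\<phi> k)"
      using nz[OF k] by (simp add: algebra_simps)
    then have "norm (complex_of_real (\<psi> k) * cis (\<phi> k) - - \<i> * (of_real (\<psi> k / \<phi>' k) * (of_real (\<phi>' k) * (\<i> * cis (\<phi> k)))
        + of_real (q k) * cis (\<phi> k))) = \<bar>q k\<bar>"
      by (simp add: norm_mult)
    also have "\<bar>q k\<bar> = \<bar>\<psi>' k / \<phi>' k - \<psi> k * \<phi>'' k / (\<phi>' k)\<^sup>2\<bar>"
      using nz[OF k] by (simp add: q_def diff_divide_distrib power2_eq_square)
    also have "\<dots> \<le> \<bar>\<psi>' k\<bar> / \<bar>\<phi>' k\<bar> + \<bar>\<psi> k\<bar> * \<bar>\<phi>'' k\<bar> / (\<phi>' k)\<^sup>2"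
      using abs_triangle_ineq4[of "\<psi>' k / \<phi>' k" "\<psi> k * \<phi>'' k / (\<phi>' k)\<^sup>2"] by (simp add: abs_mult abs_div)
    also have "\<dots> \<le> B' k" by (rule le[OF k])
    finally show "norm (complex_of_real (\<psi> k) * cis (\<phi> k) - - \<i> * (of_real (\<psi> k / \<phi>' k) * (of_real (\<phi>' k) * (\<i> * cis (\<phi> k)))
        + of_real (q k) * cis (\<phi> k))) \<le> B' k" .
  qed
  also have "norm (H b - H a) \<le> norm (H b) + norm (H a)" by (rule norm_triangle_ineq4)
  also have "norm (H b) + norm (H a) = \<bar>\<psi> b\<bar> / \<bar>\<phi>' b\<bar> + \<bar>\<psi> a\<bar> / \<bar>\<phi>' a\<bar>"
    by (simp add: H_def norm_mult norm_divide)
  finally show ?thesis by simp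
qed

section \<open>Bounds for the truncated oscillatory integrals\<close>

definition disp_deriv :: "nat \<Rightarrow> (nat \<Rightarrow> real) \<Rightarrow> real \<Rightarrow> real" where
  "disp_deriv n w k = (\<Sum>j=2..n. w j * (real j * k ^ (j - 1)))"

definition disp_deriv2 :: "nat \<Rightarrow> (nat \<Rightarrow> real) \<Rightarrow> real \<Rightarrow> real" where
  "disp_deriv2 n w k = (\<Sum>j=2..n. w j * (real j * (real (j - 1) * k ^ (j - 2))))"

text \<open>The factor \<open>j^2\<close> dominates both \<open>j\<close> and
  \<open>j * (j - 1)\<close>, so one constant controls the coefficients of \<open>\<omega>'\<close>
  and \<open>\<omega>''\<close>. It also sets the scale \<open>k >= disp_weight n w / w n\<close>
  beyond which the leading term wins.\<close>

definition disp_weight :: "nat \<Rightarrow> (nat \<Rightarrow> real) \<Rightarrow> real" where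
  "disp_weight n w = (\<Sum>j=2..n. (real j)\<^sup>2 * \<bar>w j\<bar>)"

lemma has_real_derivative_dispersion:
  "(dispersion n w has_real_derivative disp_deriv n w k) (at k within A)"
  unfolding dispersion_def[abs_def] disp_deriv_def
  by (intro DERIV_sum) (auto intro!: derivative_eq_intros)

lemma has_real_derivative_disp_deriv:
  "(disp_deriv n w has_real_derivative disp_deriv2 n w k) (at k within A)"
  unfolding disp_deriv_def[abs_def] disp_deriv2_def
  by (intro DERIV_sum) (auto intro!: derivative_eq_intros simp: numeral_2_eq_2)

lemma disp_weight_nonneg: "0 \<le> disp_weight n w"
  unfolding disp_weight_def by (intro sum_nonneg) auto

lemma abs_disp_deriv_le:
  assumes "\<bar>k\<bar> \<le> s" "1 \<le> s"
  shows "\<bar>disp_deriv n w k\<bar> \<le> disp_weight n w * s ^ (n - 1)"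
  unfolding disp_deriv_def disp_weight_def sum_distrib_right
proof (rule sum_abs[THEN order_trans], rule sum_mono)
  fix j assume j: "j \<in> {2..n}"
  have "\<bar>k\<bar> ^ (j - 1) \<le> s ^ (j - 1)" using assms by (intro power_mono) auto
  also have "\<dots> \<le> s ^ (n - 1)" using assms j by (intro power_increasing) auto
  finally have "\<bar>w j\<bar> * real j * (1 * \<bar>k\<bar> ^ (j - 1)) \<le> \<bar>w j\<bar> * real j * (real j * s ^ (n - 1))"
    using j by (intro mult_left_mono mult_mono) auto
  then show "\<bar>w j * (real j * k ^ (j - 1))\<bar> \<le> (real j)\<^sup>2 * \<bar>w j\<bar> * s ^ (n - 1)"
    by (simp add: abs_mult power_abs power2_eq_square mult_ac)
qed

lemma abs_disp_deriv2_le: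
  assumes "\<bar>k\<bar> \<le> s" "1 \<le> s"
  shows "\<bar>disp_deriv2 n w k\<bar> \<le> disp_weight n w * s ^ (n - 2)"
  unfolding disp_deriv2_def disp_weight_def sum_distrib_right
proof (rule sum_abs[THEN order_trans], rule sum_mono)
  fix j assume j: "j \<in> {2..n}"
  have "\<bar>k\<bar> ^ (j - 2) \<le> s ^ (j - 2)" using assms by (intro power_mono) auto
  also have "\<dots> \<le> s ^ (n - 2)" using assms j by (intro power_increasing) auto
  finally have "\<bar>w j\<bar> * real j * (real (j - 1) * \<bar>k\<bar> ^ (j - 2)) \<le> \<bar>w j\<bar> * real j * (real j * s ^ (n - 2))"
    using j by (intro mult_left_mono mult_mono) auto
  then show "\<bar>w j * (real j * (real (j - 1) * k ^ (j - 2)))\<bar> \<le> (real j)\<^sup>2 * \<bar>w j\<bar> * s ^ (n - 2)"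
    by (simp add: abs_mult power_abs power2_eq_square mult_ac)
qed

text \<open>The parameter \<open>c\<close> is the number of derivatives taken, 1 or 2. Every
  exponent below \<open>n\<close> loses at least one factor \<open>k\<close>, and
  \<open>w n * k >= disp_weight n w\<close> makes this loss pay for all lower coefficients
  together.\<close>

lemma power_sum_lower_order_le:
  fixes k :: real
  assumes "1 \<le> k" "disp_weight n w \<le> w n * k" "c \<le> 2"
    and v: "\<And>j. j \<in> {2..<n} \<Longrightarrow> \<bar>v j\<bar> \<le> (real j)\<^sup>2 * \<bar>w j\<bar>"
    and "0 < c"
  shows "\<bar>\<Sum>j=2..<n. v j * k ^ (j - c)\<bar> \<le> w n * k ^ (n - c)"
proof -
  have "\<bar>\<Sum>j=2..<n. v j * k ^ (j - c)\<bar> \<le> (\<Sum>j=2..<n. (real j)\<^sup>2 * \<bar>w j\<bar> * (k ^ (n - c) / k))"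
  proof (rule sum_abs[THEN order_trans], rule sum_mono)
    fix j assume j: "j \<in> {2..<n}"
    \<comment> \<open>The subtraction of naturals is exact because
      \<open>c <= 2 <= j\<close>.\<close>
    have "k * k ^ (j - c) = k ^ (Suc (j - c))" by simp
    also have "\<dots> \<le> k ^ (n - c)" using assms j by (intro power_increasing) auto
    finally have "k ^ (j - c) \<le> k ^ (n - c) / k" using \<open>1 \<le> k\<close> by (simp add: field_simps)
    then show "\<bar>v j * k ^ (j - c)\<bar> \<le> (real j)\<^sup>2 * \<bar>w j\<bar> * (k ^ (n - c) / k)"
      using v[OF j] \<open>1 \<le> k\<close> unfolding abs_mult by (intro mult_mono) auto
  qed
  also have "\<dots> = (\<Sum>j=2..<n. (real j)\<^sup>2 * \<bar>w j\<bar>) * (k ^ (n - c) / k)"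
    by (rule sum_distrib_right[symmetric])
  also have "\<dots> \<le> disp_weight n w * (k ^ (n - c) / k)"
    unfolding disp_weight_def using \<open>1 \<le> k\<close> by (intro mult_right_mono sum_mono2) auto
  also have "\<dots> \<le> (w n * k) * (k ^ (n - c) / k)"
    using assms by (intro mult_right_mono) auto
  also have "\<dots> = w n * k ^ (n - c)" using \<open>1 \<le> k\<close> by simp
  finally show ?thesis .
qed

text \<open>The leading term carries the factor \<open>n >= 2\<close>: one copy of
  \<open>w n * k ^ (n - 1)\<close> pays for the lower orders, one is left.\<close>

lemma disp_deriv_ge:
  assumes "2 \<le> n" "0 < w n" "1 \<le> k" "disp_weight n w \<le> w n * k"
  shows "w n * k ^ (n - 1) \<le> disp_deriv n w k"
proof -
  have "\<bar>\<Sum>j=2..<n. (w j * real j) * k ^ (j - 1)\<bar> \<le> w n * k ^ (n - 1)"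
  proof (rule power_sum_lower_order_le)
    fix j assume "j \<in> {2..<n}"
    then have "\<bar>w j\<bar> * real j * 1 \<le> \<bar>w j\<bar> * real j * real j" by (intro mult_left_mono) auto
    then show "\<bar>w j * real j\<bar> \<le> (real j)\<^sup>2 * \<bar>w j\<bar>" by (simp add: abs_mult power2_eq_square mult_ac)
  qed (use assms in auto)
  moreover have "disp_deriv n w k = w n * (real n * k ^ (n - 1)) + (\<Sum>j=2..<n. (w j * real j) * k ^ (j - 1))"
    unfolding disp_deriv_def using assms by (simp add: sum.last_plus mult_ac)
  moreover have "w n * k ^ (n - 1) * 2 \<le> w n * k ^ (n - 1) * real n"
    using assms by (intro mult_left_mono) auto
  ultimately show ?thesis by (simp add: abs_le_iff algebra_simps)
qed

lemma disp_deriv2_ge: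
  assumes "2 \<le> n" "0 < w n" "1 \<le> k" "disp_weight n w \<le> w n * k"
  shows "w n * k ^ (n - 2) \<le> disp_deriv2 n w k"
proof -
  have "\<bar>\<Sum>j=2..<n. (w j * real j * real (j - 1)) * k ^ (j - 2)\<bar> \<le> w n * k ^ (n - 2)"
  proof (rule power_sum_lower_order_le)
    fix j assume "j \<in> {2..<n}"
    then have "\<bar>w j\<bar> * real j * real (j - 1) \<le> \<bar>w j\<bar> * real j * real j" by (intro mult_left_mono) auto
    then show "\<bar>w j * real j * real (j - 1)\<bar> \<le> (real j)\<^sup>2 * \<bar>w j\<bar>" by (simp add: abs_mult power2_eq_square mult_ac)
  qed (use assms in auto)
  moreover have "disp_deriv2 n w k = w n * (real n * (real (n - 1) * k ^ (n - 2))) + (\<Sum>j=2..<n. (w j * real j * real (j - 1)) * k ^ (j - 2))"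
    unfolding disp_deriv2_def using assms by (simp add: sum.last_plus mult_ac)
  moreover have "w n * k ^ (n - 2) * 2 \<le> w n * k ^ (n - 2) * (real n * real (n - 1))"
  proof (rule mult_left_mono)
    have "2 * 1 \<le> real n * real (n - 1)" using assms(1) by (intro mult_mono) auto
    then show "2 \<le> real n * real (n - 1)" by (simp only: mult_1_right)
  qed (use assms in auto)
  ultimately show ?thesis by (simp add: abs_le_iff algebra_simps)
qed

section \<open>Oscillatory integrals over a half-line, for positive leading coefficient\<close>

text \<open>The number \<open>d = n - 1 - m\<close> is the decay left when the amplitude
  \<open>k ^ m\<close> is divided by a phase derivative of order \<open>k ^ (n - 1)\<close>. The
  constants depend neither on \<open>e\<close> nor on \<open>R'\<close>, which later allows
  \<open>e\<close> to tend to 0 and \<open>R'\<close> to infinity.\<close>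

lemma halfline_tail_bound:
  assumes n: "2 \<le> n" and wn: "0 < w n" and ab: "0 < a" "a \<le> b" and d: "m + d + 1 = n" "1 \<le> d"
  obtains C \<beta> where "0 \<le> C" "1 \<le> \<beta>" and "\<And>x t R R' e r. 0 \<le> r \<Longrightarrow> \<bar>x\<bar> \<le> r ^ (n - 1) \<Longrightarrow> a \<le> t \<Longrightarrow> t \<le> b \<Longrightarrow> 0 \<le> e \<Longrightarrow>
     1 \<le> R \<Longrightarrow> disp_weight n w \<le> w n * R \<Longrightarrow> \<beta> * r \<le> R \<Longrightarrow> R \<le> R' \<Longrightarrow>
     norm (integral {R..R'} (\<lambda>k. complex_of_real (k ^ m * exp (- e * k\<^sup>2)) *
       cis (dispersion n w k * t + k * x))) \<le> C / R ^ d"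
proof -
  define W where "W = disp_weight n w"
  \<comment> \<open>With \<open>c = a * w n / 2\<close>, the dispersive part of the phase derivative
    is at least \<open>2 * c * k ^ (n - 1)\<close>. The choice \<open>\<beta> >= 1 / c\<close> makes
    \<open>|x|\<close> at most half of that for \<open>k >= \<beta> * r\<close>.\<close>
  define \<beta> where "\<beta> = max 1 (2 / (a * w n))"
  define c where "c = a * w n / 2"
  have c: "c > 0" using ab wn by (simp add: c_def)
  have W: "0 \<le> W" by (simp add: W_def disp_weight_nonneg)
  \<comment> \<open>The summands bound the two error terms of the first van der Corput estimate, in
    units of \<open>1 / k ^ (d + 1)\<close>. In \<open>m + 2\<close> the \<open>m\<close> comes from
    differentiating \<open>k ^ m\<close> and the 2 from the Gaussian, since
    \<open>s * exp (- s) <= 1\<close> for \<open>s = e * k^2\<close>.\<close>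
  define C1 where "C1 = (real m + 2) / c + b * W / c\<^sup>2"
  have C1: "C1 \<ge> 0" unfolding C1_def using c W ab by auto
  have beta: "\<beta> \<ge> 1" by (simp add: \<beta>_def)
  have "norm (integral {R..R'} (\<lambda>k. complex_of_real (k ^ m * exp (- e * k\<^sup>2)) *
       cis (dispersion n w k * t + k * x))) \<le> (2 / c + C1) / R ^ d"
    if r: "0 \<le> r" "\<bar>x\<bar> \<le> r ^ (n - 1)" and t: "a \<le> t" "t \<le> b" and e: "0 \<le> e"
      and R: "1 \<le> R" "disp_weight n w \<le> w n * R" "\<beta> * r \<le> R" "R \<le> R'" for x t R R' e r
  proof -
    have t0: "0 < t" using t ab by simp
    define \<phi>' where "\<phi>' k = disp_deriv n w k * t + x" for k
    define \<phi>'' where "\<phi>'' k = disp_deriv2 n w k * t" for k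
    define \<psi> where "\<psi> k = k ^ m * exp (- e * k\<^sup>2)" for k
    define \<psi>' where "\<psi>' k = real m * k ^ (m - 1) * exp (- e * k\<^sup>2) + k ^ m * (exp (- e * k\<^sup>2) * (- e * (2 * k)))" for k
    have phi'_ge: "c * k ^ (n - 1) \<le> \<phi>' k" if "R \<le> k" for k
    proof -
      have k: "1 \<le> k" "W \<le> w n * k" using R that wn order_trans[of W "w n * R" "w n * k"] by (auto simp: W_def)
      have "a * (w n * k ^ (n - 1)) \<le> t * disp_deriv n w k"
        using disp_deriv_ge[of n w k] n wn k t ab by (intro mult_mono) (auto simp: W_def)
      moreover have "\<bar>x\<bar> \<le> c * k ^ (n - 1)"
      proof -
        have "\<beta> * r \<le> k" using R that by simp
        then have "\<beta> ^ (n - 1) * r ^ (n - 1) \<le> k ^ (n - 1)"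
          using beta r(1) by (simp add: power_mult_distrib[symmetric] power_mono)
        moreover have "\<beta> * r ^ (n - 1) \<le> \<beta> ^ (n - 1) * r ^ (n - 1)"
          using beta n r(1) power_increasing[of 1 "n - 1" \<beta>] by (intro mult_right_mono) auto
        ultimately have 1: "\<beta> * r ^ (n - 1) \<le> k ^ (n - 1)" by linarith
        have "1 \<le> c * \<beta>"
        proof -
          have "c * (2 / (a * w n)) \<le> c * \<beta>" using c by (intro mult_left_mono) (auto simp: \<beta>_def)
          then show ?thesis using ab wn by (simp add: c_def)
        qed
        then have "r ^ (n - 1) \<le> c * \<beta> * r ^ (n - 1)" using r(1) mult_right_mono[of 1 "c * \<beta>" "r ^ (n - 1)"] by simp
        also have "\<dots> \<le> c * k ^ (n - 1)" using 1 c by (simp add: mult.assoc mult_left_mono)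
        finally show ?thesis using r by linarith
      qed
      ultimately show ?thesis unfolding \<phi>'_def c_def by (simp add: algebra_simps abs_le_iff)
    qed
    have kn: "k ^ (n - 1) = k ^ m * k ^ d" "k ^ (n - 2) * k = k ^ (n - 1)" "k ^ (n - 1) * k = k ^ n" for k :: real
    proof -
      have "n - 1 = m + d" "Suc (n - 2) = n - 1" "Suc (n - 1) = n" using d n by auto
      then show "k ^ (n - 1) = k ^ m * k ^ d" "k ^ (n - 2) * k = k ^ (n - 1)" "k ^ (n - 1) * k = k ^ n"
        by (metis power_add, metis power_Suc2, metis power_Suc2)
    qed
    have psi_div: "\<bar>\<psi> k\<bar> / \<bar>\<phi>' k\<bar> \<le> 1 / (c * R ^ d)" if "R \<le> k" for k
    proof -
      have k: "1 \<le> k" using R that by simp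
      have "\<bar>\<psi> k\<bar> / \<bar>\<phi>' k\<bar> \<le> k ^ m / (c * k ^ (n - 1))"
      proof (rule frac_le)
        have "k ^ m * exp (- e * k\<^sup>2) \<le> k ^ m * 1" using k e by (intro mult_left_mono) auto
        then show "\<bar>\<psi> k\<bar> \<le> k ^ m" using k by (simp add: \<psi>_def abs_mult)
      qed (use phi'_ge[OF that] c k in auto)
      also have "\<dots> = 1 / (c * k ^ d)" unfolding kn(1) using k by simp
      also have "\<dots> \<le> 1 / (c * R ^ d)" using c R that by (intro divide_left_mono mult_left_mono power_mono) auto
      finally show ?thesis .
    qed
    \<comment> \<open>A nonpositive primitive of \<open>C1 / k ^ (d + 1)\<close>, so that
      \<open>B R' - B R\<close> is at most \<open>- B R\<close>, independently of
      \<open>R'\<close>.\<close>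
    define B where "B k = - (C1 / real d) * inverse k ^ d" for k :: real
    define B' where "B' k = C1 * inverse k ^ (d + 1)" for k :: real
    have "norm (integral {R..R'} (\<lambda>k. complex_of_real (\<psi> k) * cis (dispersion n w k * t + k * x)))
       \<le> \<bar>\<psi> R'\<bar> / \<bar>\<phi>' R'\<bar> + \<bar>\<psi> R\<bar> / \<bar>\<phi>' R\<bar> + (B R' - B R)"
    proof (rule van_der_Corput_first[where \<phi>'' = \<phi>'' and \<psi>' = \<psi>' and B' = B'])
      fix k assume "k \<in> {R..R'}"
      then have Rk: "R \<le> k" and k: "1 \<le> k" using R by auto
      show "((\<lambda>k. dispersion n w k * t + k * x) has_real_derivative \<phi>' k) (at k within {R..R'})"
        unfolding \<phi>'_def by (auto intro!: derivative_eq_intros has_real_derivative_dispersion)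
      show "(\<phi>' has_real_derivative \<phi>'' k) (at k within {R..R'})"
        unfolding \<phi>'_def[abs_def] \<phi>''_def by (auto intro!: derivative_eq_intros has_real_derivative_disp_deriv)
      have "0 < c * k ^ (n - 1)" using c k by simp
      then show "\<phi>' k \<noteq> 0" using phi'_ge[OF Rk] by linarith
      show "(\<psi> has_real_derivative \<psi>' k) (at k within {R..R'})"
        unfolding \<psi>_def[abs_def] \<psi>'_def by (auto intro!: derivative_eq_intros)
      show "(B has_real_derivative B' k) (at k within {R..R'})"
      proof -
        have "((\<lambda>k. inverse k ^ d) has_real_derivative real d * inverse k ^ (d - 1) * (- (inverse k ^ 2))) (at k within {R..R'})"
          using k by (auto intro!: derivative_eq_intros simp: power2_eq_square)
        from DERIV_cmult[OF this, of "- (C1 / real d)"]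
        have "(B has_real_derivative - (C1 / real d) * (real d * inverse k ^ (d - 1) * (- (inverse k ^ 2)))) (at k within {R..R'})"
          unfolding B_def[abs_def] .
        moreover have "- (C1 / real d) * (real d * inverse k ^ (d - 1) * (- (inverse k ^ 2))) = C1 * (inverse k ^ (d - 1) * inverse k ^ 2)"
          using d by simp
        moreover have "inverse k ^ (d - 1) * inverse k ^ 2 = inverse k ^ (d + 1)"
          using d by (simp only: power_add[symmetric]) (simp add: numeral_2_eq_2)
        ultimately show ?thesis unfolding B'_def by simp
      qed
      show "\<bar>\<psi>' k\<bar> / \<bar>\<phi>' k\<bar> + \<bar>\<psi> k\<bar> * \<bar>\<phi>'' k\<bar> / (\<phi>' k)\<^sup>2 \<le> B' k"
      proof -
        have E: "exp (- e * k\<^sup>2) \<le> 1" "(e * k\<^sup>2) * exp (- e * k\<^sup>2) \<le> 1"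
        proof -
          show "exp (- e * k\<^sup>2) \<le> 1" using e by simp
          have "e * k\<^sup>2 \<le> exp (e * k\<^sup>2)" using exp_ge_add_one_self[of "e * k\<^sup>2"] by linarith
          then show "(e * k\<^sup>2) * exp (- e * k\<^sup>2) \<le> 1" by (simp add: exp_minus field_simps)
        qed
        have psi': "\<bar>\<psi>' k\<bar> \<le> (real m + 2) * (k ^ m / k)"
        proof -
          have "\<bar>real m * k ^ (m - 1) * exp (- e * k\<^sup>2)\<bar> \<le> real m * (k ^ m / k) * 1"
          proof (cases "m = 0")
            case False
            then have "k ^ (m - 1) = k ^ m / k" using k by (simp add: power_eq_if)
            then show ?thesis using k E mult_left_mono[of "exp (- e * k\<^sup>2)" 1 "real m * (k ^ m / k)"]
              by (simp add: abs_mult)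
          qed simp
          moreover have "\<bar>k ^ m * (exp (- e * k\<^sup>2) * (- e * (2 * k)))\<bar> = 2 * (k ^ m / k) * ((e * k\<^sup>2) * exp (- e * k\<^sup>2))"
            using k e by (simp add: abs_mult power2_eq_square field_simps)
          moreover have "2 * (k ^ m / k) * ((e * k\<^sup>2) * exp (- e * k\<^sup>2)) \<le> 2 * (k ^ m / k) * 1"
            using k E by (intro mult_left_mono) auto
          moreover have "\<bar>\<psi>' k\<bar> \<le> \<bar>real m * k ^ (m - 1) * exp (- e * k\<^sup>2)\<bar> + \<bar>k ^ m * (exp (- e * k\<^sup>2) * (- e * (2 * k)))\<bar>"
            unfolding \<psi>'_def by (rule abs_triangle_ineq)
          moreover have "(real m + 2) * (k ^ m / k) = real m * (k ^ m / k) * 1 + 2 * (k ^ m / k) * 1"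
            by (simp only: distrib_right mult_1_right)
          ultimately show ?thesis by linarith
        qed
        have psi: "\<bar>\<psi> k\<bar> \<le> k ^ m" using k E mult_left_mono[of "exp (- e * k\<^sup>2)" 1 "k ^ m"] by (simp add: \<psi>_def abs_mult)
        have phi': "c * k ^ (n - 1) \<le> \<bar>\<phi>' k\<bar>" "0 < c * k ^ (n - 1)" using phi'_ge[OF Rk] c k by auto
        have phi'': "\<bar>\<phi>'' k\<bar> \<le> b * W * k ^ (n - 2)"
        proof -
          have "\<bar>disp_deriv2 n w k\<bar> * \<bar>t\<bar> \<le> (W * k ^ (n - 2)) * b"
            using abs_disp_deriv2_le[of k k n w] k t t0 W by (intro mult_mono) (auto simp: W_def)
          then show ?thesis by (simp add: \<phi>''_def abs_mult mult_ac)
        qed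
        have I: "k ^ m / (k * k ^ (n - 1)) = inverse k ^ (d + 1)"
          unfolding kn(1) using k by (simp add: power_inverse field_simps)
        have "\<bar>\<psi>' k\<bar> / \<bar>\<phi>' k\<bar> \<le> ((real m + 2) * (k ^ m / k)) / (c * k ^ (n - 1))"
          using psi' phi' by (intro frac_le) auto
        also have "\<dots> = (real m + 2) / c * (k ^ m / (k * k ^ (n - 1)))" by simp
        also have "\<dots> = (real m + 2) / c * inverse k ^ (d + 1)" unfolding I ..
        finally have 1: "\<bar>\<psi>' k\<bar> / \<bar>\<phi>' k\<bar> \<le> (real m + 2) / c * inverse k ^ (d + 1)" .
        have "\<bar>\<psi> k\<bar> * \<bar>\<phi>'' k\<bar> / (\<phi>' k)\<^sup>2 \<le> (k ^ m * (b * W * k ^ (n - 2))) / (c * k ^ (n - 1))\<^sup>2"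
          using psi phi'' phi' k power_mono[of "c * k ^ (n - 1)" "\<bar>\<phi>' k\<bar>" 2]
          by (intro frac_le mult_mono) auto
        also have "(k ^ m * (b * W * k ^ (n - 2))) / (c * k ^ (n - 1))\<^sup>2
            = (k ^ m * (b * W * (k ^ (n - 2) * k))) / (c\<^sup>2 * (k ^ (n - 1) * k ^ (n - 1)) * k)"
          using k by (simp add: power2_eq_square mult_ac)
        also have "\<dots> = b * W / c\<^sup>2 * (k ^ m / (k * k ^ (n - 1)))"
          unfolding kn(2) using k by (simp add: field_simps)
        also have "\<dots> = b * W / c\<^sup>2 * inverse k ^ (d + 1)" unfolding I ..
        finally show ?thesis using 1 unfolding B'_def C1_def by (simp add: algebra_simps)
      qed
    qed (use R in auto)
    also have "\<bar>\<psi> R'\<bar> / \<bar>\<phi>' R'\<bar> + \<bar>\<psi> R\<bar> / \<bar>\<phi>' R\<bar> \<le> 1 / (c * R ^ d) + 1 / (c * R ^ d)"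
      using psi_div[of R] psi_div[of R'] R by linarith
    also have "B R' - B R \<le> C1 / R ^ d"
    proof -
      have "B R' \<le> 0" unfolding B_def using C1 R by simp
      moreover have "- B R \<le> C1 * inverse R ^ d"
      proof -
        have "C1 / real d \<le> C1" using C1 d by (simp add: divide_le_eq mult_le_cancel_left1)
        then have "C1 / real d * inverse R ^ d \<le> C1 * inverse R ^ d"
          using R by (intro mult_right_mono) auto
        then show ?thesis unfolding B_def by simp
      qed
      ultimately show ?thesis by (simp add: power_inverse divide_inverse)
    qed
    also have "1 / (c * R ^ d) + 1 / (c * R ^ d) + C1 / R ^ d = (2 / c + C1) / R ^ d"
      using c R by (simp add: field_simps)
    finally show ?thesis unfolding \<psi>_def by simp
  qed
  moreover have "0 \<le> 2 / c + C1" using c C1 by simp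
  ultimately show ?thesis using beta by (blast intro: that[of "2 / c + C1" \<beta>])
qed


lemma norm_integral_cis_le:
  fixes \<phi> :: "real \<Rightarrow> real"
  assumes "continuous_on UNIV \<phi>" "0 \<le> R" "R \<le> s"
  shows "norm (integral {0..R} (\<lambda>k. complex_of_real (k ^ m) * cis (\<phi> k))) \<le> s * s ^ m"
proof -
  have "norm (integral {0..R} (\<lambda>k. complex_of_real (k ^ m) * cis (\<phi> k))) \<le> s ^ m * (R - 0)"
  proof (rule integral_bound)
    show "continuous_on {0..R} (\<lambda>k. complex_of_real (k ^ m) * cis (\<phi> k))"
      by (intro continuous_intros continuous_on_subset[OF assms(1)]) auto
    show "norm (complex_of_real (k ^ m) * cis (\<phi> k)) \<le> s ^ m" if "k \<in> {0..R}" for k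
      using that assms by (simp add: norm_mult norm_power power_mono)
  qed (use assms in auto)
  also have "s ^ m * (R - 0) \<le> s * s ^ m" using assms mult_right_mono[of R s "s ^ m"] by (simp add: mult.commute)
  finally show ?thesis .
qed

lemma continuous_on_dispersion: "continuous_on A (dispersion n w)"
  by (rule DERIV_continuous_on[OF has_real_derivative_dispersion])

text \<open>The phase is stationary only at \<open>k \<approx> r\<close>, where \<open>r = \<bar>x\<bar>\<^bsup>1/(n-1)\<^esup>\<close>; below that scale \<open>x\<close>
  dominates the derivative of the phase, above it \<open>k\<^bsup>n-1\<^esup>\<close> does.\<close>

lemma halfline_growth_bound_large:
  assumes n: "2 \<le> n" and wn: "0 < w n" and ab: "0 < a" "a \<le> b" and d: "m + d + 1 = n" "1 \<le> d"
  obtains C r0 where "0 \<le> C" "1 \<le> r0" and "\<And>x t R r. r0 \<le> r \<Longrightarrow> \<bar>x\<bar> = r ^ (n - 1) \<Longrightarrow> a \<le> t \<Longrightarrow> t \<le> b \<Longrightarrow> 0 \<le> R \<Longrightarrow>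
     norm (integral {0..R} (\<lambda>k. complex_of_real (k ^ m) * cis (dispersion n w k * t + k * x)))
       \<le> C * (r ^ m / sqrt (r ^ (n - 2)))"
proof -
  obtain C \<beta> where C: "0 \<le> C" and beta: "1 \<le> \<beta>" and tail:
    "\<And>x t R R' e r. 0 \<le> r \<Longrightarrow> \<bar>x\<bar> \<le> r ^ (n - 1) \<Longrightarrow> a \<le> t \<Longrightarrow> t \<le> b \<Longrightarrow> 0 \<le> e \<Longrightarrow>
     1 \<le> R \<Longrightarrow> disp_weight n w \<le> w n * R \<Longrightarrow> \<beta> * r \<le> R \<Longrightarrow> R \<le> R' \<Longrightarrow>
     norm (integral {R..R'} (\<lambda>k. complex_of_real (k ^ m * exp (- e * k\<^sup>2)) *
       cis (dispersion n w k * t + k * x))) \<le> C / R ^ d"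
    by (rule halfline_tail_bound[of n w a b m d, OF n wn ab d]) (rule that)
  define W where "W = disp_weight n w"
  have W: "0 \<le> W" by (simp add: W_def disp_weight_nonneg)
  have bW: "0 \<le> b * W" using W ab by simp
  \<comment> \<open>Chosen for \<open>b * W * \<alpha> <= 1 / 2\<close>: on
    \<open>k <= \<alpha> * r\<close> the dispersive part of the phase derivative is then at most
    half of \<open>|x| = r ^ (n - 1)\<close>.\<close>
  define \<alpha> where "\<alpha> = 1 / (2 * (b * W) + 1)"
  have alpha: "0 < \<alpha>" "\<alpha> \<le> 1" "b * W * \<alpha> \<le> 1 / 2"
    using bW by (auto simp: \<alpha>_def field_simps)
  define K0 where "K0 = max 1 (W / w n)"
  have K0: "1 \<le> K0" by (simp add: K0_def)
  have K0': "W \<le> w n * k" if "K0 \<le> k" for k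
    using that wn by (auto simp: K0_def field_simps)
  \<comment> \<open>For \<open>r >= r0\<close> the point \<open>\<alpha> * r\<close> already lies
    where the leading coefficient dominates, so \<open>\<omega>''\<close> is bounded below on the
    whole middle range.\<close>
  define r0 where "r0 = K0 / \<alpha>"
  have r0: "1 \<le> r0" using alpha K0 by (simp add: r0_def field_simps)
  define C2 where "C2 = 8 * \<beta> ^ m / sqrt (a * w n * \<alpha> ^ (n - 2))"
  have C2: "0 \<le> C2" using beta alpha ab wn by (simp add: C2_def)
  have "norm (integral {0..R} (\<lambda>k. complex_of_real (k ^ m) * cis (dispersion n w k * t + k * x)))
       \<le> ((6 + 4 * (b * W)) + C2 + C) * (r ^ m / sqrt (r ^ (n - 2)))"
    if r: "r0 \<le> r" "\<bar>x\<bar> = r ^ (n - 1)" and t: "a \<le> t" "t \<le> b" and R: "0 \<le> R" for x t R r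
  proof -
    have t0: "0 < t" using t ab by simp
    have r1: "1 \<le> r" using r r0 by simp
    have ar: "K0 \<le> \<alpha> * r" using r alpha by (simp add: r0_def field_simps)
    have ar1: "1 \<le> \<alpha> * r" using ar K0 by simp
    have ar_le: "\<alpha> * r \<le> r" "r \<le> \<beta> * r" using alpha r1 beta by (auto simp: mult_le_cancel_right1 mult_le_cancel_right2)
    define \<phi> where "\<phi> k = dispersion n w k * t + k * x" for k
    define \<phi>' where "\<phi>' k = disp_deriv n w k * t + x" for k
    define \<phi>'' where "\<phi>'' k = disp_deriv2 n w k * t" for k
    have phi: "(\<phi> has_real_derivative \<phi>' k) (at k within A)" for k A
      unfolding \<phi>_def[abs_def] \<phi>'_def by (auto intro!: derivative_eq_intros has_real_derivative_dispersion)
    have phi': "(\<phi>' has_real_derivative \<phi>'' k) (at k within A)" for k A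
      unfolding \<phi>'_def[abs_def] \<phi>''_def by (auto intro!: derivative_eq_intros has_real_derivative_disp_deriv)
    have contphi: "continuous_on A \<phi>" for A by (rule DERIV_continuous_on[OF phi])
    define f where "f k = complex_of_real (k ^ m) * cis (\<phi> k)" for k
    have intf: "f integrable_on {u..v}" for u v
      unfolding f_def[abs_def] by (intro integrable_continuous_interval continuous_intros contphi)
    define A where "A = r ^ m / sqrt (r ^ (n - 2))"
    \<comment> \<open>Away from the stationary point the estimates give
      \<open>r ^ m / r ^ (n - 1)\<close>, which is no larger than the stationary contribution
      \<open>A\<close>.\<close>
    have le_A: "r ^ m / r ^ (n - 1) \<le> A" unfolding A_def
    proof (rule divide_left_mono)
      have "sqrt (r ^ (n - 2)) \<le> r ^ (n - 2)" using r1 by (simp add: real_le_lsqrt power2_eq_square mult_le_cancel_left1)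
      also have "\<dots> \<le> r ^ (n - 1)" using r1 by (intro power_increasing) auto
      finally show "sqrt (r ^ (n - 2)) \<le> r ^ (n - 1)" .
    qed (use r1 in auto)
    have A: "0 \<le> A" unfolding A_def using r1 by simp
    have small: "norm (integral {0..s} f) \<le> (6 + 4 * (b * W)) * A" if s: "0 \<le> s" "s \<le> \<alpha> * r" for s
    proof -
      define q where "q = r ^ (n - 1)"
      have q: "0 < q" using r1 by (simp add: q_def)
      have phi'_ge: "q / 2 \<le> \<bar>\<phi>' k\<bar>" if "0 \<le> k" "k \<le> s" for k
      proof -
        have "\<bar>disp_deriv n w k\<bar> * \<bar>t\<bar> \<le> (W * (\<alpha> * r) ^ (n - 1)) * b"
          using abs_disp_deriv_le[of k "\<alpha> * r" n w] that s t t0 W ar1 by (intro mult_mono) (auto simp: W_def)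
        also have "\<dots> = b * W * \<alpha> ^ (n - 1) * q" by (simp add: q_def power_mult_distrib)
        also have "\<dots> \<le> b * W * \<alpha> * q"
        proof -
          have "\<alpha> ^ (n - 1) \<le> \<alpha> ^ 1" using alpha n by (intro power_decreasing) auto
          then show ?thesis using bW q by (intro mult_right_mono mult_left_mono) auto
        qed
        also have "\<dots> \<le> 1 / 2 * q" using alpha q by (intro mult_right_mono) auto
        finally show ?thesis using r(2) unfolding \<phi>'_def q_def[symmetric] abs_mult[symmetric] by linarith
      qed
      have sr: "s \<le> r" using s ar_le by linarith
      \<comment> \<open>The bound \<open>1 / |\<phi>'| <= c1\<close> leaves the derivative of
        \<open>k ^ m\<close>, which is integrated exactly; \<open>c2\<close> bounds the term with
        \<open>\<phi>''\<close> by its largest value on \<open>k <= r\<close>.\<close>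
      define c1 where "c1 = 2 / q"
      define c2 where "c2 = 4 * (b * W) * r ^ m * r ^ (n - 2) / q\<^sup>2"
      have c12: "0 \<le> c1" "0 \<le> c2" using q r1 bW by (auto simp: c1_def c2_def)
      define B where "B k = c1 * k ^ m + c2 * k" for k :: real
      define B' where "B' k = c1 * (real m * k ^ (m - 1)) + c2" for k :: real
      have "norm (integral {0..s} (\<lambda>k. complex_of_real (k ^ m) * cis (\<phi> k)))
        \<le> \<bar>s ^ m\<bar> / \<bar>\<phi>' s\<bar> + \<bar>0 ^ m\<bar> / \<bar>\<phi>' 0\<bar> + (B s - B 0)"
      proof (rule van_der_Corput_first[OF s(1) phi phi', where \<psi>' = "\<lambda>k. real m * k ^ (m - 1)" and B' = B'])
        fix k assume "k \<in> {0..s}"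
        then have k: "0 \<le> k" "k \<le> s" by auto
        have p: "q / 2 \<le> \<bar>\<phi>' k\<bar>" by (rule phi'_ge[OF k])
        then show "\<phi>' k \<noteq> 0" using q by auto
        show "((\<lambda>k. k ^ m) has_real_derivative real m * k ^ (m - 1)) (at k within {0..s})"
          by (auto intro!: derivative_eq_intros)
        show "(B has_real_derivative B' k) (at k within {0..s})"
          unfolding B_def[abs_def] B'_def by (auto intro!: derivative_eq_intros)
        have "\<bar>real m * k ^ (m - 1)\<bar> / \<bar>\<phi>' k\<bar> \<le> (real m * k ^ (m - 1)) / (q / 2)"
          using p q k by (intro frac_le) auto
        moreover have "\<bar>k ^ m\<bar> * \<bar>\<phi>'' k\<bar> / (\<phi>' k)\<^sup>2 \<le> (r ^ m * (b * W * r ^ (n - 2))) / (q / 2)\<^sup>2"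
        proof (rule frac_le)
          have "\<bar>disp_deriv2 n w k\<bar> * \<bar>t\<bar> \<le> (W * r ^ (n - 2)) * b"
            using abs_disp_deriv2_le[of k r n w] k s t t0 W r1 ar_le by (intro mult_mono) (auto simp: W_def)
          then have "\<bar>\<phi>'' k\<bar> \<le> b * W * r ^ (n - 2)" by (simp add: \<phi>''_def abs_mult mult_ac)
          then show "\<bar>k ^ m\<bar> * \<bar>\<phi>'' k\<bar> \<le> r ^ m * (b * W * r ^ (n - 2))"
            using k sr r1 by (intro mult_mono) (auto simp: power_mono)
          show "(q / 2)\<^sup>2 \<le> (\<phi>' k)\<^sup>2" using p q power_mono[of "q / 2" "\<bar>\<phi>' k\<bar>" 2] by simp
        qed (use q r1 bW in auto)
        ultimately show "\<bar>real m * k ^ (m - 1)\<bar> / \<bar>\<phi>' k\<bar> + \<bar>k ^ m\<bar> * \<bar>\<phi>'' k\<bar> / (\<phi>' k)\<^sup>2 \<le> B' k"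
          unfolding B'_def c1_def c2_def by (simp add: power2_eq_square mult_ac)
      qed
      also have "\<bar>s ^ m\<bar> / \<bar>\<phi>' s\<bar> \<le> r ^ m / (q / 2)"
        using phi'_ge[of s] s(1) q sr r1 by (intro frac_le) (auto simp: power_mono)
      \<comment> \<open>The left endpoint contributes only for \<open>m = 0\<close>, where
        \<open>0 ^ 0 = 1\<close>.\<close>
      also have "\<bar>0 ^ m\<bar> / \<bar>\<phi>' 0\<bar> \<le> r ^ m / (q / 2)"
      proof (rule frac_le)
        have "(0::real) ^ m \<le> r ^ m" using r1 by (intro power_mono) auto
        then show "\<bar>(0::real) ^ m\<bar> \<le> r ^ m" by simp
      qed (use phi'_ge[of 0] s q r1 in auto)
      also have "B s - B 0 \<le> (2 + 4 * (b * W)) * (r ^ m / q)"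
      proof -
        have "c1 * s ^ m \<le> c1 * r ^ m" using c12 s(1) sr by (intro mult_left_mono power_mono) auto
        moreover have "0 \<le> c1 * (0::real) ^ m" using c12 by simp
        moreover have "c2 * s \<le> c2 * r" using c12 sr by (intro mult_left_mono) auto
        moreover have "c2 * r = 4 * (b * W) * (r ^ m / q)"
        proof -
          have "r ^ (n - 2) * r = q"
            using n by (simp add: q_def power_Suc2[symmetric] Suc_diff_Suc numeral_2_eq_2)
          then have "(4 * (b * W) * r ^ m * r ^ (n - 2) / q\<^sup>2) * r = 4 * (b * W) * r ^ m * q / q\<^sup>2"
            by (metis mult.assoc times_divide_eq_left)
          then show ?thesis using q by (simp add: c2_def power2_eq_square)
        qed
        moreover have "c1 * r ^ m = 2 * (r ^ m / q)" by (simp add: c1_def)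
        ultimately show ?thesis unfolding B_def distrib_right by linarith
      qed
      also have "r ^ m / (q / 2) + r ^ m / (q / 2) + (2 + 4 * (b * W)) * (r ^ m / q) = (6 + 4 * (b * W)) * (r ^ m / q)"
        by (simp add: algebra_simps)
      also have "\<dots> \<le> (6 + 4 * (b * W)) * A"
        using le_A bW unfolding q_def by (intro mult_left_mono) auto
      finally show ?thesis unfolding f_def by simp
    qed
    have middle: "norm (integral {\<alpha> * r..s} f) \<le> C2 * A" if s: "\<alpha> * r \<le> s" "s \<le> \<beta> * r" for s
    proof -
      \<comment> \<open>The stationary point can only lie in this range, so the second derivative
        has to be used; \<open>\<mu>\<close> is a lower bound for \<open>t * \<omega>''\<close>
        here, of order \<open>r ^ (n - 2)\<close>.\<close>
      define \<mu> where "\<mu> = a * w n * (\<alpha> * r) ^ (n - 2)"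
      have mu: "0 < \<mu>" unfolding \<mu>_def using ab wn alpha r1 by simp
      have "norm (integral {\<alpha> * r..s} (\<lambda>k. complex_of_real (k ^ m) * cis (\<phi> k))) \<le> 8 * s ^ m / sqrt \<mu>"
      proof (rule van_der_Corput_second[OF s(1) mu phi phi', where \<psi>' = "\<lambda>k. real m * k ^ (m - 1)"])
        fix k assume "k \<in> {\<alpha> * r..s}"
        then have k: "\<alpha> * r \<le> k" "1 \<le> k" "K0 \<le> k" using ar ar1 by auto
        have "a * (w n * (\<alpha> * r) ^ (n - 2)) \<le> t * disp_deriv2 n w k"
        proof (rule mult_mono)
          have "w n * (\<alpha> * r) ^ (n - 2) \<le> w n * k ^ (n - 2)"
            using wn k ar1 by (intro mult_left_mono power_mono) auto
          also have "\<dots> \<le> disp_deriv2 n w k"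
            using disp_deriv2_ge[of n w k] n wn k K0' by (simp add: W_def)
          finally show "w n * (\<alpha> * r) ^ (n - 2) \<le> disp_deriv2 n w k" .
        qed (use t t0 wn ar1 in auto)
        then show "\<mu> \<le> \<phi>'' k" by (simp add: \<mu>_def \<phi>''_def mult_ac)
        show "((\<lambda>k. k ^ m) has_real_derivative real m * k ^ (m - 1)) (at k within {\<alpha> * r..s})"
          by (auto intro!: derivative_eq_intros)
        show "0 \<le> real m * k ^ (m - 1)" using k by simp
      qed (use ar1 in auto)
      also have "\<dots> \<le> 8 * (\<beta> * r) ^ m / sqrt \<mu>"
        using s ar1 mu by (intro divide_right_mono mult_left_mono power_mono) auto
      also have "sqrt \<mu> = sqrt (a * w n * \<alpha> ^ (n - 2)) * sqrt (r ^ (n - 2))"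
        unfolding \<mu>_def by (simp add: power_mult_distrib real_sqrt_mult[symmetric] mult_ac)
      also have "8 * (\<beta> * r) ^ m / \<dots> = C2 * A"
        by (simp add: C2_def A_def power_mult_distrib)
      finally show ?thesis unfolding f_def .
    qed
    have tail': "norm (integral {\<beta> * r..s} f) \<le> C * A" if s: "\<beta> * r \<le> s" for s
    proof -
      have br: "1 \<le> \<beta> * r" "K0 \<le> \<beta> * r" using ar_le ar ar1 by (linarith, linarith)
      have "norm (integral {\<beta> * r..s} f) \<le> C / (\<beta> * r) ^ d"
        using tail[of r x t 0 "\<beta> * r" s] r r1 t br K0' s unfolding f_def \<phi>_def by (simp add: W_def)
      also have "\<dots> \<le> C / r ^ d"
        using C ar_le r1 br by (intro divide_left_mono power_mono) auto
      also have "C / r ^ d = C * (r ^ m / r ^ (n - 1))"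
      proof -
        have "n - 1 = m + d" using d by auto
        then show ?thesis using r1 by (simp add: power_add)
      qed
      also have "\<dots> \<le> C * A" using C le_A by (intro mult_left_mono) auto
      finally show ?thesis .
    qed
    have nn: "0 \<le> (6 + 4 * (b * W)) * A" "0 \<le> C2 * A" "0 \<le> C * A" using bW A C2 C by auto
    have "norm (integral {0..R} f) \<le> (6 + 4 * (b * W)) * A + C2 * A + C * A"
    proof -
      consider "R \<le> \<alpha> * r" | "\<alpha> * r \<le> R" "R \<le> \<beta> * r" | "\<beta> * r \<le> R" using ar_le by linarith
      then show ?thesis
      proof cases
        case 1
        then show ?thesis using small[of R] R nn by linarith
      next
        case 2
        have "integral {0..R} f = integral {0..\<alpha> * r} f + integral {\<alpha> * r..R} f"
          using 2 ar1 Henstock_Kurzweil_Integration.integral_combine[OF _ _ intf, of 0 "\<alpha> * r" R] by simp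
        then show ?thesis using small[of "\<alpha> * r"] middle[of R] 2 ar1 nn
          norm_triangle_ineq[of "integral {0..\<alpha> * r} f" "integral {\<alpha> * r..R} f"] by auto
      next
        case 3
        have o: "0 \<le> \<alpha> * r" "\<alpha> * r \<le> \<beta> * r" "\<alpha> * r \<le> R" using 3 ar1 ar_le by (linarith, linarith, linarith)
        have "integral {0..R} f = integral {0..\<alpha> * r} f + integral {\<alpha> * r..R} f"
          by (rule Henstock_Kurzweil_Integration.integral_combine[OF o(1) o(3) intf, symmetric])
        also have "integral {\<alpha> * r..R} f = integral {\<alpha> * r..\<beta> * r} f + integral {\<beta> * r..R} f"
          by (rule Henstock_Kurzweil_Integration.integral_combine[OF o(2) 3 intf, symmetric])
        finally have "norm (integral {0..R} f) \<le> norm (integral {0..\<alpha> * r} f) + (norm (integral {\<alpha> * r..\<beta> * r} f) + norm (integral {\<beta> * r..R} f))"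
          by (simp add: norm_triangle_le norm_triangle_mono)
        then show ?thesis using small[OF o(1) order_refl] middle[OF o(2) order_refl] tail'[OF 3] by linarith
      qed
    qed
    then show ?thesis unfolding f_def \<phi>_def A_def by (simp only: distrib_right)
  qed
  moreover have "0 \<le> (6 + 4 * (b * W)) + C2 + C" using C C2 bW by simp
  ultimately show ?thesis using r0 by (blast intro: that[of "(6 + 4 * (b * W)) + C2 + C" r0])
qed


text \<open>At the stationary point \<open>k = \<bar>x\<bar>\<^bsup>1/(n-1)\<^esup>\<close> the amplitude \<open>k\<^sup>m\<close> divided by the root of
  \<open>\<omega>'' = O(k\<^bsup>n-2\<^esup>)\<close> is \<open>\<bar>x\<bar>\<close> to this power.\<close>

definition growth_exponent :: "nat \<Rightarrow> nat \<Rightarrow> real" where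
  "growth_exponent n m = (2 * real m - real n + 2) / (2 * (real n - 1))"

text \<open>For \<open>y >= 1\<close> the numbers \<open>y\<close> and \<open>1 + y\<close> agree up
  to a factor 2; the exponent may have either sign, whence \<open>\<bar>p\<bar>\<close>.\<close>

lemma powr_le_one_plus_powr:
  fixes p y :: real
  assumes "1 \<le> y"
  shows "y powr p \<le> 2 powr \<bar>p\<bar> * (1 + y) powr p"
proof (cases "0 \<le> p")
  case True
  have "y powr p \<le> (1 + y) powr p" using True assms by (intro powr_mono2) auto
  also have "\<dots> \<le> 2 powr \<bar>p\<bar> * (1 + y) powr p"
    using True powr_ge_zero[of "1 + y" p] ge_one_powr_ge_zero[of 2 "\<bar>p\<bar>"]
    by (simp add: mult_le_cancel_right1)
  finally show ?thesis .
next
  case False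
  have "y powr p \<le> ((1 + y) / 2) powr p" using False assms by (intro powr_mono2') auto
  also have "\<dots> = 2 powr \<bar>p\<bar> * (1 + y) powr p"
    using False assms by (simp add: powr_divide powr_minus_divide abs_if field_simps)
  finally show ?thesis .
qed

text \<open>On a bounded range of \<open>y\<close> every power of \<open>1 + y\<close> is bounded
  away from 0. This turns a constant bound for bounded \<open>x\<close> into one of the required
  form even when the exponent is negative.\<close>

lemma one_le_one_plus_powr:
  fixes p y Y :: real
  assumes "0 \<le> y" "y \<le> Y"
  shows "1 \<le> (1 + Y) powr \<bar>p\<bar> * (1 + y) powr p"
proof (cases "0 \<le> p")
  case True
  have "1 * 1 \<le> (1 + Y) powr \<bar>p\<bar> * (1 + y) powr p"
    using True assms by (intro mult_mono ge_one_powr_ge_zero) auto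
  then show ?thesis by simp
next
  case False
  have "(1 + Y) powr p \<le> (1 + y) powr p" using False assms by (intro powr_mono2') auto
  then have "(1 + Y) powr \<bar>p\<bar> * (1 + Y) powr p \<le> (1 + Y) powr \<bar>p\<bar> * (1 + y) powr p"
    by (intro mult_left_mono) auto
  moreover have "(1 + Y) powr \<bar>p\<bar> * (1 + Y) powr p = 1"
    using False assms by (simp add: powr_add[symmetric])
  ultimately show ?thesis by simp
qed

text \<open>Large \<open>\<bar>x\<bar>\<close> is the stationary phase estimate with
  \<open>r\<close> the root of \<open>\<bar>x\<bar>\<close>. For the remaining bounded range of
  \<open>x\<close> the integral is split at a fixed \<open>\<rho>\<close> into a trivially bounded
  part and a tail.\<close>

lemma halfline_growth_bound:
  assumes n: "2 \<le> n" and wn: "0 < w n" and ab: "0 < a" "a \<le> b" and m: "m + 2 \<le> n"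
  obtains C where "0 \<le> C" and "\<And>x t R. a \<le> t \<Longrightarrow> t \<le> b \<Longrightarrow> 0 \<le> R \<Longrightarrow>
     norm (integral {0..R} (\<lambda>k. complex_of_real (k ^ m) * cis (dispersion n w k * t + k * x)))
       \<le> C * (1 + \<bar>x\<bar>) powr growth_exponent n m"
proof -
  define d where "d = n - 1 - m"
  have d: "m + d + 1 = n" "1 \<le> d" using m by (auto simp: d_def)
  obtain C \<beta> where C: "0 \<le> C" and beta: "1 \<le> \<beta>" and tail:
    "\<And>x t R R' e r. 0 \<le> r \<Longrightarrow> \<bar>x\<bar> \<le> r ^ (n - 1) \<Longrightarrow> a \<le> t \<Longrightarrow> t \<le> b \<Longrightarrow> 0 \<le> e \<Longrightarrow>
     1 \<le> R \<Longrightarrow> disp_weight n w \<le> w n * R \<Longrightarrow> \<beta> * r \<le> R \<Longrightarrow> R \<le> R' \<Longrightarrow>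
     norm (integral {R..R'} (\<lambda>k. complex_of_real (k ^ m * exp (- e * k\<^sup>2)) *
       cis (dispersion n w k * t + k * x))) \<le> C / R ^ d"
    by (rule halfline_tail_bound[of n w a b m d, OF n wn ab d]) (rule that)
  obtain C' r0 where C': "0 \<le> C'" and r0: "1 \<le> r0" and large:
    "\<And>x t R r. r0 \<le> r \<Longrightarrow> \<bar>x\<bar> = r ^ (n - 1) \<Longrightarrow> a \<le> t \<Longrightarrow> t \<le> b \<Longrightarrow> 0 \<le> R \<Longrightarrow>
     norm (integral {0..R} (\<lambda>k. complex_of_real (k ^ m) * cis (dispersion n w k * t + k * x)))
       \<le> C' * (r ^ m / sqrt (r ^ (n - 2)))"
    by (rule halfline_growth_bound_large[of n w a b m d, OF n wn ab d]) (rule that)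
  define p where "p = growth_exponent n m"
  \<comment> \<open>Beyond \<open>\<rho>\<close> the tail estimate applies with
    \<open>r = r0\<close> to all \<open>x\<close> with \<open>\<bar>x\<bar> < r0 ^ (n - 1)\<close>
    at once.\<close>
  define \<rho> where "\<rho> = max (max 1 (disp_weight n w / w n)) (\<beta> * r0)"
  have rho: "1 \<le> \<rho>" "disp_weight n w \<le> w n * \<rho>" "\<beta> * r0 \<le> \<rho>"
  proof -
    show "1 \<le> \<rho>" "\<beta> * r0 \<le> \<rho>" by (auto simp: \<rho>_def)
    have "disp_weight n w / w n \<le> \<rho>" by (auto simp: \<rho>_def)
    then show "disp_weight n w \<le> w n * \<rho>" using wn by (simp add: field_simps)
  qed
  define C1 where "C1 = C' * 2 powr \<bar>p\<bar>"
  define C2 where "C2 = (\<rho> * \<rho> ^ m + C) * (1 + r0 ^ (n - 1)) powr \<bar>p\<bar>"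
  have C12: "0 \<le> C1" "0 \<le> C2" using C C' rho by (auto simp: C1_def C2_def)
  have "norm (integral {0..R} (\<lambda>k. complex_of_real (k ^ m) * cis (dispersion n w k * t + k * x)))
       \<le> (C1 + C2) * (1 + \<bar>x\<bar>) powr p" if t: "a \<le> t" "t \<le> b" and R: "0 \<le> R" for x t R
  proof (cases "r0 ^ (n - 1) \<le> \<bar>x\<bar>")
    case True
    define r where "r = root (n - 1) \<bar>x\<bar>"
    have n1: "0 < n - 1" using n by simp
    have x1: "1 \<le> \<bar>x\<bar>" using True r0 one_le_power[of r0 "n - 1"] by linarith
    have r: "r0 \<le> r" "\<bar>x\<bar> = r ^ (n - 1)"
    proof -
      show "\<bar>x\<bar> = r ^ (n - 1)" unfolding r_def using n1 by simp
      have "root (n - 1) (r0 ^ (n - 1)) \<le> r" unfolding r_def using n1 True by simp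
      then show "r0 \<le> r" using n1 r0 by (simp add: real_root_power_cancel)
    qed
    have r_powr: "r = \<bar>x\<bar> powr (1 / real (n - 1))"
      unfolding r_def using n1 x1 by (simp add: root_powr_inverse)
    have "r ^ m / sqrt (r ^ (n - 2)) = r powr (real m - real (n - 2) / 2)"
    proof -
      have rpos: "0 < r" using r r0 by linarith
      have "sqrt (r ^ (n - 2)) = r powr (real (n - 2) / 2)"
        using rpos by (simp add: powr_half_sqrt[symmetric] powr_realpow[symmetric] powr_powr)
      then show ?thesis using rpos by (simp add: powr_diff powr_realpow)
    qed
    also have "\<dots> = \<bar>x\<bar> powr (1 / real (n - 1) * (real m - real (n - 2) / 2))"
      unfolding r_powr by (rule powr_powr)
    \<comment> \<open>This identity is the origin of \<open>growth_exponent\<close>.\<close>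
    also have "1 / real (n - 1) * (real m - real (n - 2) / 2) = p"
      using n by (simp add: p_def growth_exponent_def field_simps of_nat_diff)
    finally have rp: "r ^ m / sqrt (r ^ (n - 2)) = \<bar>x\<bar> powr p" .
    have "norm (integral {0..R} (\<lambda>k. complex_of_real (k ^ m) * cis (dispersion n w k * t + k * x)))
       \<le> C' * \<bar>x\<bar> powr p" using large[OF r t R] unfolding rp .
    also have "\<dots> \<le> C' * (2 powr \<bar>p\<bar> * (1 + \<bar>x\<bar>) powr p)"
      using C' powr_le_one_plus_powr[OF x1] by (intro mult_left_mono) auto
    also have "\<dots> \<le> (C1 + C2) * (1 + \<bar>x\<bar>) powr p"
      using C12 by (simp add: C1_def distrib_right mult.assoc)
    finally show ?thesis .
  next
    case False
    define f where "f k = complex_of_real (k ^ m) * cis (dispersion n w k * t + k * x)" for k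
    have cont: "continuous_on A (\<lambda>k. dispersion n w k * t + k * x)" for A
      by (intro continuous_intros continuous_on_dispersion)
    have intf: "f integrable_on {u..v}" for u v
      unfolding f_def[abs_def] by (intro integrable_continuous_interval continuous_intros cont)
    have init: "norm (integral {0..s} f) \<le> \<rho> * \<rho> ^ m" if "0 \<le> s" "s \<le> \<rho>" for s
      unfolding f_def using norm_integral_cis_le[OF cont that] .
    have "norm (integral {0..R} f) \<le> \<rho> * \<rho> ^ m + C"
    proof (cases "R \<le> \<rho>")
      case True
      then show ?thesis using init[of R] R C by linarith
    next
      case R: False
      have "norm (integral {\<rho>..R} f) \<le> C / \<rho> ^ d"
        using tail[of r0 x t 0 \<rho> R] False r0 t rho R unfolding f_def by simp
      also have "\<dots> \<le> C" using C rho by (simp add: divide_le_eq mult_le_cancel_left1)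
      finally have "norm (integral {\<rho>..R} f) \<le> C" .
      moreover have "integral {0..R} f = integral {0..\<rho>} f + integral {\<rho>..R} f"
        using R rho Henstock_Kurzweil_Integration.integral_combine[OF _ _ intf, of 0 \<rho> R] by simp
      ultimately show ?thesis using init[of \<rho>] rho
        norm_triangle_ineq[of "integral {0..\<rho>} f" "integral {\<rho>..R} f"] by auto
    qed
    also have "\<dots> \<le> (\<rho> * \<rho> ^ m + C) * ((1 + r0 ^ (n - 1)) powr \<bar>p\<bar> * (1 + \<bar>x\<bar>) powr p)"
      using one_le_one_plus_powr[of "\<bar>x\<bar>" "r0 ^ (n - 1)" p] False C rho
        mult_left_mono[of 1 "(1 + r0 ^ (n - 1)) powr \<bar>p\<bar> * (1 + \<bar>x\<bar>) powr p" "\<rho> * \<rho> ^ m + C"]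
      by simp
    also have "\<dots> \<le> (C1 + C2) * (1 + \<bar>x\<bar>) powr p"
      using C12 by (simp add: C2_def distrib_right mult.assoc)
    finally show ?thesis unfolding f_def .
  qed
  moreover have "0 \<le> C1 + C2" using C12 by simp
  ultimately show ?thesis unfolding p_def by (blast intro: that[of "C1 + C2"])
qed

text \<open>The constant \<open>C\<close> is independent of the bound \<open>X\<close> on
  \<open>x\<close>; only the starting point \<open>\<rho>\<close> depends on it. Decay of order
  \<open>1 / R\<close> is what uniform convergence on compact sets requires.\<close>

lemma halfline_tail_small:
  assumes n: "2 \<le> n" and wn: "0 < w n" and ab: "0 < a" "a \<le> b" and m: "m + 2 \<le> n"
  obtains C where "0 \<le> C" and "\<And>X. \<exists>\<rho>\<ge>1. \<forall>x t R R' e. \<bar>x\<bar> \<le> X \<longrightarrow> a \<le> t \<longrightarrow> t \<le> b \<longrightarrow> 0 \<le> e \<longrightarrow> \<rho> \<le> R \<longrightarrow> R \<le> R' \<longrightarrow>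
     norm (integral {R..R'} (\<lambda>k. complex_of_real (k ^ m * exp (- e * k\<^sup>2)) *
       cis (dispersion n w k * t + k * x))) \<le> C / R"
proof -
  define d where "d = n - 1 - m"
  have d: "m + d + 1 = n" "1 \<le> d" using m by (auto simp: d_def)
  obtain C \<beta> where C: "0 \<le> C" and beta: "1 \<le> \<beta>" and tail:
    "\<And>x t R R' e r. 0 \<le> r \<Longrightarrow> \<bar>x\<bar> \<le> r ^ (n - 1) \<Longrightarrow> a \<le> t \<Longrightarrow> t \<le> b \<Longrightarrow> 0 \<le> e \<Longrightarrow>
     1 \<le> R \<Longrightarrow> disp_weight n w \<le> w n * R \<Longrightarrow> \<beta> * r \<le> R \<Longrightarrow> R \<le> R' \<Longrightarrow>
     norm (integral {R..R'} (\<lambda>k. complex_of_real (k ^ m * exp (- e * k\<^sup>2)) *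
       cis (dispersion n w k * t + k * x))) \<le> C / R ^ d"
    by (rule halfline_tail_bound[of n w a b m d, OF n wn ab d]) (rule that)
  have "\<exists>\<rho>\<ge>1. \<forall>x t R R' e. \<bar>x\<bar> \<le> X \<longrightarrow> a \<le> t \<longrightarrow> t \<le> b \<longrightarrow> 0 \<le> e \<longrightarrow> \<rho> \<le> R \<longrightarrow> R \<le> R' \<longrightarrow>
     norm (integral {R..R'} (\<lambda>k. complex_of_real (k ^ m * exp (- e * k\<^sup>2)) *
       cis (dispersion n w k * t + k * x))) \<le> C / R" for X
  proof -
    define r where "r = max 1 X"
    define \<rho> where "\<rho> = max (max 1 (disp_weight n w / w n)) (\<beta> * r)"
    have "norm (integral {R..R'} (\<lambda>k. complex_of_real (k ^ m * exp (- e * k\<^sup>2)) *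
       cis (dispersion n w k * t + k * x))) \<le> C / R"
      if x: "\<bar>x\<bar> \<le> X" and t: "a \<le> t" "t \<le> b" and e: "0 \<le> e" and R: "\<rho> \<le> R" "R \<le> R'" for x t R R' e
    proof -
      have R1: "1 \<le> R" "disp_weight n w / w n \<le> R" "\<beta> * r \<le> R" using R by (auto simp: \<rho>_def)
      have "r ^ 1 \<le> r ^ (n - 1)" using n by (intro power_increasing) (auto simp: r_def)
      then have "\<bar>x\<bar> \<le> r ^ (n - 1)" using x by (simp add: r_def)
      moreover have "disp_weight n w \<le> w n * R" using R1 wn by (simp add: field_simps)
      ultimately have "norm (integral {R..R'} (\<lambda>k. complex_of_real (k ^ m * exp (- e * k\<^sup>2)) *
         cis (dispersion n w k * t + k * x))) \<le> C / R ^ d"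
        using t e R R1 by (intro tail[of r]) (auto simp: r_def)
      also have "\<dots> \<le> C / R"
      proof -
        have "R ^ 1 \<le> R ^ d" using R1 d by (intro power_increasing) auto
        then show ?thesis using C R1 by (intro divide_left_mono) auto
      qed
      finally show ?thesis .
    qed
    then show ?thesis by (intro exI[of _ \<rho>]) (auto simp: \<rho>_def)
  qed
  with C show ?thesis by (rule that)
qed

section \<open>From half-lines to symmetric intervals, for either sign of the leading
  coefficient\<close>

lemma dispersion_minus: "dispersion n w (- k) = dispersion n (\<lambda>j. (- 1) ^ j * w j) k"
  unfolding dispersion_def by (intro sum.cong refl) (simp add: power_minus[of k] mult_ac)

lemma dispersion_uminus_coeff: "dispersion n (\<lambda>j. - w j) k = - dispersion n w k"
  unfolding dispersion_def by (simp add: sum_negf)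

text \<open>The parameter \<open>e\<close> is the strength of the Gaussian regularization;
  \<open>e = 0\<close> gives the true integrand, whose order \<open>m\<close> corresponds to
  \<open>m\<close> derivatives in \<open>x\<close> up to a power of \<open>\<i>\<close>.\<close>

definition osc :: "nat \<Rightarrow> (nat \<Rightarrow> real) \<Rightarrow> nat \<Rightarrow> real \<Rightarrow> real \<Rightarrow> real \<Rightarrow> real \<Rightarrow> complex" where
  "osc n w m e x t k = complex_of_real (k ^ m * exp (- e * k\<^sup>2)) * cis (k * x - dispersion n w k * t)"

lemma continuous_on_osc: "continuous_on A (osc n w m e x t)"
  unfolding osc_def[abs_def] by (intro continuous_intros continuous_on_dispersion)

lemma osc_integrable: "osc n w m e x t integrable_on {u..v}"
  by (intro integrable_continuous_interval continuous_on_osc)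

lemma osc_minus: "osc n w m e x t (- k) = (- 1) ^ m * osc n (\<lambda>j. (- 1) ^ j * w j) m e (- x) t k"
  by (simp add: osc_def dispersion_minus power_minus[of k])

text \<open>Conjugation reverses the phase. This matches the sign of \<open>\<omega>\<close> in the
  half-line bounds, at the price of replacing \<open>x\<close> by \<open>- x\<close>.\<close>

lemma norm_integral_osc_eq:
  "norm (integral S (osc n w m e x t)) =
    norm (integral S (\<lambda>k. complex_of_real (k ^ m * exp (- e * k\<^sup>2)) * cis (dispersion n w k * t + k * (- x))))"
proof -
  have "cnj (integral S (osc n w m e x t)) = integral S (\<lambda>k. complex_of_real (k ^ m * exp (- e * k\<^sup>2)) * cis (dispersion n w k * t + k * (- x)))"
    unfolding Henstock_Kurzweil_Integration.integral_cnj osc_def by (simp add: cis_cnj)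
  then show ?thesis by (metis complex_mod_cnj)
qed

text \<open>For a negative leading coefficient no conjugation is made: the minus sign in the phase
  goes into the coefficients, whose leading one then is positive.\<close>

lemma integral_osc_uminus_coeff:
  "integral S (osc n w m e x t) =
    integral S (\<lambda>k. complex_of_real (k ^ m * exp (- e * k\<^sup>2)) * cis (dispersion n (\<lambda>j. - w j) k * t + k * x))"
  unfolding osc_def[abs_def] dispersion_uminus_coeff by (simp add: algebra_simps)

lemma halfline_osc_growth:
  assumes n: "2 \<le> n" and wn: "w n \<noteq> 0" and ab: "0 < a" "a \<le> b" and m: "m + 2 \<le> n"
  obtains C where "0 \<le> C" and "\<And>x t R. a \<le> t \<Longrightarrow> t \<le> b \<Longrightarrow> 0 \<le> R \<Longrightarrow>
     norm (integral {0..R} (osc n w m 0 x t)) \<le> C * (1 + \<bar>x\<bar>) powr growth_exponent n m"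
proof (cases "0 < w n")
  case True
  obtain C where "0 \<le> C" and "\<And>x t R. a \<le> t \<Longrightarrow> t \<le> b \<Longrightarrow> 0 \<le> R \<Longrightarrow>
     norm (integral {0..R} (\<lambda>k. complex_of_real (k ^ m) * cis (dispersion n w k * t + k * x)))
       \<le> C * (1 + \<bar>x\<bar>) powr growth_exponent n m"
    by (rule halfline_growth_bound[of n w a b m, OF n True ab m]) (rule that)
  note C = this(1) this(2)[of _ _ "- x" for x]
  show ?thesis
  proof (rule that[OF C(1)])
    fix x t R :: real assume "a \<le> t" "t \<le> b" "0 \<le> R"
    then show "norm (integral {0..R} (osc n w m 0 x t)) \<le> C * (1 + \<bar>x\<bar>) powr growth_exponent n m"
      unfolding norm_integral_osc_eq using C(2)[of t R x] by simp
  qed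
next
  case False
  then have wn': "0 < - w n" using wn by simp
  obtain C where "0 \<le> C" and "\<And>x t R. a \<le> t \<Longrightarrow> t \<le> b \<Longrightarrow> 0 \<le> R \<Longrightarrow>
     norm (integral {0..R} (\<lambda>k. complex_of_real (k ^ m) * cis (dispersion n (\<lambda>j. - w j) k * t + k * x)))
       \<le> C * (1 + \<bar>x\<bar>) powr growth_exponent n m"
    by (rule halfline_growth_bound[of n "\<lambda>j. - w j" a b m, OF n wn' ab m]) (rule that)
  note C = this
  show ?thesis
  proof (rule that[OF C(1)])
    fix x t R :: real assume "a \<le> t" "t \<le> b" "0 \<le> R"
    then show "norm (integral {0..R} (osc n w m 0 x t)) \<le> C * (1 + \<bar>x\<bar>) powr growth_exponent n m"
      unfolding integral_osc_uminus_coeff using C(2)[of t R x] by simp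
  qed
qed

lemma halfline_osc_tail:
  assumes n: "2 \<le> n" and wn: "w n \<noteq> 0" and ab: "0 < a" "a \<le> b" and m: "m + 2 \<le> n"
  obtains C where "0 \<le> C" and "\<And>X. \<exists>\<rho>\<ge>1. \<forall>x t R R' e. \<bar>x\<bar> \<le> X \<longrightarrow> a \<le> t \<longrightarrow> t \<le> b \<longrightarrow> 0 \<le> e \<longrightarrow> \<rho> \<le> R \<longrightarrow> R \<le> R' \<longrightarrow>
     norm (integral {R..R'} (osc n w m e x t)) \<le> C / R"
proof (cases "0 < w n")
  case True
  obtain C where C: "0 \<le> C" and 1: "\<And>X. \<exists>\<rho>\<ge>1. \<forall>x t R R' e. \<bar>x\<bar> \<le> X \<longrightarrow> a \<le> t \<longrightarrow> t \<le> b \<longrightarrow> 0 \<le> e \<longrightarrow> \<rho> \<le> R \<longrightarrow> R \<le> R' \<longrightarrow>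
     norm (integral {R..R'} (\<lambda>k. complex_of_real (k ^ m * exp (- e * k\<^sup>2)) *
       cis (dispersion n w k * t + k * x))) \<le> C / R"
    by (rule halfline_tail_small[of n w a b m, OF n True ab m]) (rule that)
  show ?thesis
  proof (rule that[OF C])
    fix X :: real
    obtain \<rho> where \<rho>: "\<rho> \<ge> 1" and 2: "\<And>x t R R' e. \<bar>x\<bar> \<le> X \<Longrightarrow> a \<le> t \<Longrightarrow> t \<le> b \<Longrightarrow> 0 \<le> e \<Longrightarrow> \<rho> \<le> R \<Longrightarrow> R \<le> R' \<Longrightarrow>
      norm (integral {R..R'} (\<lambda>k. complex_of_real (k ^ m * exp (- e * k\<^sup>2)) *
       cis (dispersion n w k * t + k * x))) \<le> C / R"
      using 1[of X] by blast
    have "norm (integral {R..R'} (osc n w m e x t)) \<le> C / R"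
      if "\<bar>x\<bar> \<le> X" "a \<le> t" "t \<le> b" "0 \<le> e" "\<rho> \<le> R" "R \<le> R'" for x t R R' e
      unfolding norm_integral_osc_eq using 2[of "- x" t e R R'] that by simp
    with \<rho> show "\<exists>\<rho>\<ge>1. \<forall>x t R R' e. \<bar>x\<bar> \<le> X \<longrightarrow> a \<le> t \<longrightarrow> t \<le> b \<longrightarrow> 0 \<le> e \<longrightarrow> \<rho> \<le> R \<longrightarrow> R \<le> R' \<longrightarrow>
      norm (integral {R..R'} (osc n w m e x t)) \<le> C / R"
      by blast
  qed
next
  case False
  then have wn': "0 < - w n" using wn by simp
  show ?thesis
    by (rule halfline_tail_small[of n "\<lambda>j. - w j" a b m, OF n wn' ab m], fold integral_osc_uminus_coeff) (rule that)
qed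

text \<open>The substitution of \<open>- k\<close> for \<open>k\<close> maps the negative half-line
  to the positive one and the coefficients to \<open>(- 1) ^ j * w j\<close>. The leading one stays
  nonzero but may change sign, so half-line bounds are needed for both signs.\<close>

lemma norm_integral_osc_reflect:
  "norm (integral {- v..- u} (osc n w m e x t)) = norm (integral {u..v} (osc n (\<lambda>j. (- 1) ^ j * w j) m e (- x) t))"
proof -
  have "integral {- v..- u} (osc n w m e x t) = integral {u..v} (\<lambda>k. osc n w m e x t (- k))"
    using Henstock_Kurzweil_Integration.integral_reflect_real[of v u "\<lambda>k. osc n w m e x t (- k)"] by simp
  also have "\<dots> = (- 1) ^ m * integral {u..v} (osc n (\<lambda>j. (- 1) ^ j * w j) m e (- x) t)"
    unfolding osc_minus by simp
  finally show ?thesis by (simp add: norm_mult norm_power)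
qed

text \<open>Uniformity in the truncation \<open>R\<close> serves twice: the bound passes to the
  limit kernel, and it provides the majorant when the convolutions with truncated kernels
  converge.\<close>

lemma osc_growth:
  assumes n: "2 \<le> n" and wn: "w n \<noteq> 0" and ab: "0 < a" "a \<le> b" and m: "m + 2 \<le> n"
  obtains C where "0 \<le> C" and "\<And>x t R. a \<le> t \<Longrightarrow> t \<le> b \<Longrightarrow> 0 \<le> R \<Longrightarrow>
     norm (integral {- R..R} (osc n w m 0 x t)) \<le> C * (1 + \<bar>x\<bar>) powr growth_exponent n m"
proof -
  define v where "v j = (- 1) ^ j * w j" for j
  have vn: "v n \<noteq> 0" using wn by (simp add: v_def)
  obtain C where C: "0 \<le> C" and 1: "\<And>x t R. a \<le> t \<Longrightarrow> t \<le> b \<Longrightarrow> 0 \<le> R \<Longrightarrow>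
     norm (integral {0..R} (osc n w m 0 x t)) \<le> C * (1 + \<bar>x\<bar>) powr growth_exponent n m"
    by (rule halfline_osc_growth[of n w a b m, OF n wn ab m]) (rule that)
  obtain D where D: "0 \<le> D" and 2: "\<And>x t R. a \<le> t \<Longrightarrow> t \<le> b \<Longrightarrow> 0 \<le> R \<Longrightarrow>
     norm (integral {0..R} (osc n v m 0 x t)) \<le> D * (1 + \<bar>x\<bar>) powr growth_exponent n m"
    by (rule halfline_osc_growth[of n v a b m, OF n vn ab m]) (rule that)
  have "norm (integral {- R..R} (osc n w m 0 x t)) \<le> (C + D) * (1 + \<bar>x\<bar>) powr growth_exponent n m"
    if t: "a \<le> t" "t \<le> b" and R: "0 \<le> R" for x t R
  proof -
    have "integral {- R..R} (osc n w m 0 x t) = integral {- R..- 0} (osc n w m 0 x t) + integral {0..R} (osc n w m 0 x t)"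
      using R Henstock_Kurzweil_Integration.integral_combine[OF _ _ osc_integrable, of "- R" 0 R] by simp
    then have "norm (integral {- R..R} (osc n w m 0 x t))
        \<le> norm (integral {- R..- 0} (osc n w m 0 x t)) + norm (integral {0..R} (osc n w m 0 x t))"
      by (simp add: norm_triangle_ineq)
    also have "norm (integral {- R..- 0} (osc n w m 0 x t)) \<le> D * (1 + \<bar>x\<bar>) powr growth_exponent n m"
      unfolding norm_integral_osc_reflect using 2[of t R "- x"] t R by (simp add: v_def[abs_def])
    also have "norm (integral {0..R} (osc n w m 0 x t)) \<le> C * (1 + \<bar>x\<bar>) powr growth_exponent n m"
      using 1 t R by simp
    finally show ?thesis by (simp add: algebra_simps)
  qed
  moreover have "0 \<le> C + D" using C D by simp
  ultimately show ?thesis by (blast intro: that[of "C + D"])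
qed

text \<open>A Cauchy estimate for symmetric truncations; its uniformity in \<open>e >= 0\<close>
  allows the limits in \<open>R'\<close> and in \<open>e\<close> to be interchanged.\<close>

lemma osc_tail:
  assumes n: "2 \<le> n" and wn: "w n \<noteq> 0" and ab: "0 < a" "a \<le> b" and m: "m + 2 \<le> n"
  obtains C where "0 \<le> C" and "\<And>X. \<exists>\<rho>\<ge>1. \<forall>x t R R' e. \<bar>x\<bar> \<le> X \<longrightarrow> a \<le> t \<longrightarrow> t \<le> b \<longrightarrow> 0 \<le> e \<longrightarrow> \<rho> \<le> R \<longrightarrow> R \<le> R' \<longrightarrow>
     norm (integral {- R'..R'} (osc n w m e x t) - integral {- R..R} (osc n w m e x t)) \<le> C / R"
proof -
  define v where "v j = (- 1) ^ j * w j" for j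
  have vn: "v n \<noteq> 0" using wn by (simp add: v_def)
  obtain C where C: "0 \<le> C" and 1: "\<And>X. \<exists>\<rho>\<ge>1. \<forall>x t R R' e. \<bar>x\<bar> \<le> X \<longrightarrow> a \<le> t \<longrightarrow> t \<le> b \<longrightarrow> 0 \<le> e \<longrightarrow> \<rho> \<le> R \<longrightarrow> R \<le> R' \<longrightarrow>
     norm (integral {R..R'} (osc n w m e x t)) \<le> C / R"
    by (rule halfline_osc_tail[of n w a b m, OF n wn ab m]) (rule that)
  obtain D where D: "0 \<le> D" and 2: "\<And>X. \<exists>\<rho>\<ge>1. \<forall>x t R R' e. \<bar>x\<bar> \<le> X \<longrightarrow> a \<le> t \<longrightarrow> t \<le> b \<longrightarrow> 0 \<le> e \<longrightarrow> \<rho> \<le> R \<longrightarrow> R \<le> R' \<longrightarrow>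
     norm (integral {R..R'} (osc n v m e x t)) \<le> D / R"
    by (rule halfline_osc_tail[of n v a b m, OF n vn ab m]) (rule that)
  have main: "\<exists>\<rho>\<ge>1. \<forall>x t R R' e. \<bar>x\<bar> \<le> X \<longrightarrow> a \<le> t \<longrightarrow> t \<le> b \<longrightarrow> 0 \<le> e \<longrightarrow> \<rho> \<le> R \<longrightarrow> R \<le> R' \<longrightarrow>
     norm (integral {- R'..R'} (osc n w m e x t) - integral {- R..R} (osc n w m e x t)) \<le> (C + D) / R" for X
  proof -
    obtain \<rho>1 where r1: "\<rho>1 \<ge> 1" and 11: "\<And>x t R R' e. \<bar>x\<bar> \<le> X \<Longrightarrow> a \<le> t \<Longrightarrow> t \<le> b \<Longrightarrow> 0 \<le> e \<Longrightarrow> \<rho>1 \<le> R \<Longrightarrow> R \<le> R' \<Longrightarrow>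
     norm (integral {R..R'} (osc n w m e x t)) \<le> C / R" using 1[of X] by blast
    obtain \<rho>2 where r2: "\<rho>2 \<ge> 1" and 22: "\<And>x t R R' e. \<bar>x\<bar> \<le> X \<Longrightarrow> a \<le> t \<Longrightarrow> t \<le> b \<Longrightarrow> 0 \<le> e \<Longrightarrow> \<rho>2 \<le> R \<Longrightarrow> R \<le> R' \<Longrightarrow>
     norm (integral {R..R'} (osc n v m e x t)) \<le> D / R" using 2[of X] by blast
    have "norm (integral {- R'..R'} (osc n w m e x t) - integral {- R..R} (osc n w m e x t)) \<le> (C + D) / R"
      if x: "\<bar>x\<bar> \<le> X" and t: "a \<le> t" "t \<le> b" and e: "0 \<le> e" and R: "max \<rho>1 \<rho>2 \<le> R" "R \<le> R'" for x t R R' e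
    proof -
      let ?f = "osc n w m e x t"
      have R0: "0 \<le> R" using R r1 by simp
      have intf: "?f integrable_on {u..v}" for u v by (rule osc_integrable)
      have "integral {- R'..R'} ?f = integral {- R'..- R} ?f + integral {- R..R} ?f + integral {R..R'} ?f"
        using R R0 Henstock_Kurzweil_Integration.integral_combine[OF _ _ intf, of "- R'" "- R" R']
          Henstock_Kurzweil_Integration.integral_combine[OF _ _ intf, of "- R" R R'] by (simp add: add.assoc)
      then have "norm (integral {- R'..R'} ?f - integral {- R..R} ?f)
          \<le> norm (integral {- R'..- R} ?f) + norm (integral {R..R'} ?f)"
        by (simp add: norm_triangle_ineq)
      also have "norm (integral {- R'..- R} ?f) \<le> D / R"
        unfolding norm_integral_osc_reflect using 22[of "- x" t e R R'] x t e R by (simp add: v_def[abs_def])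
      also have "norm (integral {R..R'} ?f) \<le> C / R" using 11 x t e R by simp
      finally show ?thesis by (simp add: add_divide_distrib)
    qed
    then show ?thesis using r1 by (intro exI[of _ "max \<rho>1 \<rho>2"]) auto
  qed
  have "0 \<le> C + D" using C D by simp
  then show ?thesis using main by (rule that)
qed

section \<open>Differentiation and limits of integrals\<close>

lemma has_vector_derivative_iff_quotient:
  fixes f :: "real \<Rightarrow> 'a::real_normed_vector"
  shows "(f has_vector_derivative D) (at x within S) \<longleftrightarrow> ((\<lambda>y. (f y - f x) /\<^sub>R (y - x)) \<longlongrightarrow> D) (at x within S)"
proof -
  have eq: "norm ((1 / norm (y - x)) *\<^sub>R (f y - (f x + (y - x) *\<^sub>R D))) = norm ((f y - f x) /\<^sub>R (y - x) - D)"
    if "y \<noteq> x" for y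
  proof -
    have "(f y - f x) /\<^sub>R (y - x) - D = (1 / (y - x)) *\<^sub>R (f y - (f x + (y - x) *\<^sub>R D))"
      using that by (simp add: scaleR_diff_right scaleR_add_right divide_inverse_commute)
    then show ?thesis by simp
  qed
  have "(f has_vector_derivative D) (at x within S) \<longleftrightarrow>
      ((\<lambda>y. norm ((1 / norm (y - x)) *\<^sub>R (f y - (f x + (y - x) *\<^sub>R D)))) \<longlongrightarrow> 0) (at x within S)"
    unfolding has_vector_derivative_def has_derivative_within tendsto_norm_zero_iff
    by (simp add: bounded_linear_scaleR_left)
  also have "\<dots> \<longleftrightarrow> ((\<lambda>y. norm ((f y - f x) /\<^sub>R (y - x) - D)) \<longlongrightarrow> 0) (at x within S)"
    by (intro tendsto_cong) (use eq in \<open>auto simp: eventually_at_filter\<close>)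
  also have "\<dots> \<longleftrightarrow> ((\<lambda>y. (f y - f x) /\<^sub>R (y - x)) \<longlongrightarrow> D) (at x within S)"
    unfolding tendsto_norm_zero_iff by (rule LIM_zero_iff)
  finally show ?thesis .
qed

text \<open>On the convex set the mean value inequality turns the bound on the derivative into the
  same bound \<open>g\<close> for all difference quotients, to which dominated convergence
  applies.\<close>

lemma has_vector_derivative_lebesgue_integral:
  fixes f :: "real \<Rightarrow> 'a \<Rightarrow> complex"
  assumes S: "open S" "convex S" "x0 \<in> S"
    and deriv: "\<And>x y. x \<in> S \<Longrightarrow> ((\<lambda>x. f x y) has_vector_derivative f' x y) (at x)"
    and int: "\<And>x. x \<in> S \<Longrightarrow> integrable M (f x)"
    and meas: "f' x0 \<in> borel_measurable M"
    and bound: "\<And>x y. x \<in> S \<Longrightarrow> norm (f' x y) \<le> g y" and g: "integrable M g"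
  shows "((\<lambda>x. LINT y|M. f x y) has_vector_derivative (LINT y|M. f' x0 y)) (at x0)"
proof -
  have quot: "((\<lambda>x. (f x y - f x0 y) /\<^sub>R (x - x0)) \<longlongrightarrow> f' x0 y) (at x0 within S)" for y
    using has_vector_derivative_at_within[OF deriv[OF S(3)], of y S]
    by (simp add: has_vector_derivative_iff_quotient)
  have diff_le: "norm (f x y - f x0 y) \<le> g y * \<bar>x - x0\<bar>" if "x \<in> S" for x y
  proof -
    have "norm (f x y - f x0 y) \<le> g y * norm (x - x0)"
    proof (rule differentiable_bound[OF S(2) _ _ that S(3)])
      show "((\<lambda>x. f x y) has_derivative (\<lambda>h. h *\<^sub>R f' x y)) (at x within S)" if "x \<in> S" for x
        using has_vector_derivative_at_within[OF deriv[OF that]] unfolding has_vector_derivative_def .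
      show "onorm (\<lambda>h. h *\<^sub>R f' x y) \<le> g y" if "x \<in> S" for x
        by (rule onorm_le) (simp add: mult.commute[of "g y"] mult_left_mono bound[OF that])
    qed
    then show ?thesis by simp
  qed
  have "((\<lambda>x. ((LINT y|M. f x y) - (LINT y|M. f x0 y)) /\<^sub>R (x - x0)) \<longlongrightarrow> (LINT y|M. f' x0 y)) (at x0 within S)"
    unfolding tendsto_at_iff_sequentially comp_def
  proof (intro allI impI)
    fix X assume X: "\<forall>i. X i \<in> S - {x0}" "X \<longlonglongrightarrow> x0"
    have "(\<lambda>i. LINT y|M. (f (X i) y - f x0 y) /\<^sub>R (X i - x0)) \<longlonglongrightarrow> (LINT y|M. f' x0 y)"
    proof (rule integral_dominated_convergence[OF meas _ g])
      show "(\<lambda>y. (f (X i) y - f x0 y) /\<^sub>R (X i - x0)) \<in> borel_measurable M" for i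
        using int X S by (auto intro!: borel_measurable_scaleR borel_measurable_diff)
      show "AE y in M. (\<lambda>i. (f (X i) y - f x0 y) /\<^sub>R (X i - x0)) \<longlonglongrightarrow> f' x0 y"
        using quot[unfolded tendsto_at_iff_sequentially comp_def] X by auto
      show "AE y in M. norm ((f (X i) y - f x0 y) /\<^sub>R (X i - x0)) \<le> g y" for i
        using X diff_le[of "X i"] by (auto simp: divide_simps mult.commute)
    qed
    moreover have "(LINT y|M. (f (X i) y - f x0 y) /\<^sub>R (X i - x0)) = ((LINT y|M. f (X i) y) - (LINT y|M. f x0 y)) /\<^sub>R (X i - x0)" for i
      using int X S by (simp add: Bochner_Integration.integral_diff)
    ultimately show "(\<lambda>i. ((LINT y|M. f (X i) y) - (LINT y|M. f x0 y)) /\<^sub>R (X i - x0)) \<longlonglongrightarrow> (LINT y|M. f' x0 y)"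
      by (simp only:)
  qed
  then have "((\<lambda>x. LINT y|M. f x y) has_vector_derivative (LINT y|M. f' x0 y)) (at x0 within S)"
    by (simp add: has_vector_derivative_iff_quotient)
  then show ?thesis unfolding has_vector_derivative_within_open[OF S(3) S(1)] .
qed

lemma continuous_on_lebesgue_integral:
  fixes f :: "'b::metric_space \<Rightarrow> 'a \<Rightarrow> complex"
  assumes cont: "\<And>y. continuous_on S (\<lambda>z. f z y)"
    and meas: "\<And>z. z \<in> S \<Longrightarrow> f z \<in> borel_measurable M"
    and bound: "\<And>z y. z \<in> S \<Longrightarrow> norm (f z y) \<le> g y" and g: "integrable M g"
  shows "continuous_on S (\<lambda>z. LINT y|M. f z y)"
  unfolding continuous_on_sequentially comp_def
proof (intro allI ballI impI, elim conjE)
  fix X z assume X: "\<forall>i. X i \<in> S" "X \<longlonglongrightarrow> z" and z: "z \<in> S"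
  show "(\<lambda>i. LINT y|M. f (X i) y) \<longlonglongrightarrow> (LINT y|M. f z y)"
  proof (rule integral_dominated_convergence[OF _ _ g])
    show "AE y in M. (\<lambda>i. f (X i) y) \<longlonglongrightarrow> f z y"
      by (intro AE_I2 continuous_on_tendsto_compose[OF cont X(2) z]) (use X in auto)
  qed (use meas bound X z in auto)
qed

lemma has_vector_derivative_uniform_limit:
  fixes f :: "nat \<Rightarrow> real \<Rightarrow> complex"
  assumes S: "convex S" "x \<in> S"
    and deriv: "\<And>N x. x \<in> S \<Longrightarrow> (f N has_vector_derivative f' N x) (at x within S)"
    and lim: "\<And>x. x \<in> S \<Longrightarrow> (\<lambda>N. f N x) \<longlonglongrightarrow> g x"
    and unif: "uniform_limit S f' g' sequentially"
  shows "(g has_vector_derivative g' x) (at x within S)"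
proof -
  have "\<exists>h. \<forall>x\<in>S. (\<lambda>N. f N x) \<longlonglongrightarrow> h x \<and> (h has_derivative (\<lambda>y. y *\<^sub>R g' x)) (at x within S)"
  proof (rule has_derivative_sequence[where f = f and f' = "\<lambda>N x y. y *\<^sub>R f' N x", OF S(1) _ _ S(2) lim[OF S(2)]])
    show "(f N has_derivative (\<lambda>y. y *\<^sub>R f' N x)) (at x within S)" if "x \<in> S" for N x
      using deriv[OF that] unfolding has_vector_derivative_def .
    fix e :: real assume "e > 0"
    from uniform_limitD[OF unif this]
    show "\<forall>\<^sub>F N in sequentially. \<forall>x\<in>S. \<forall>h. norm (h *\<^sub>R f' N x - h *\<^sub>R g' x) \<le> e * norm h"
    proof (rule eventually_mono)
      fix N assume "\<forall>x\<in>S. dist (f' N x) (g' x) < e"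
      then have N: "norm (f' N x - g' x) \<le> e" if "x \<in> S" for x
        using that by (force simp: dist_norm)
      have "norm (h *\<^sub>R f' N x - h *\<^sub>R g' x) = norm (f' N x - g' x) * norm h" for x h
        unfolding scaleR_diff_right[symmetric] by simp
      then show "\<forall>x\<in>S. \<forall>h. norm (h *\<^sub>R f' N x - h *\<^sub>R g' x) \<le> e * norm h"
        using N by (simp add: mult_right_mono)
    qed
  qed
  then obtain h where h: "\<And>x. x \<in> S \<Longrightarrow> (\<lambda>N. f N x) \<longlonglongrightarrow> h x"
      "\<And>x. x \<in> S \<Longrightarrow> (h has_derivative (\<lambda>y. y *\<^sub>R g' x)) (at x within S)" by blast
  have eq: "h x = g x" if "x \<in> S" for x using h(1)[OF that] lim[OF that] by (rule LIMSEQ_unique)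
  show ?thesis unfolding has_vector_derivative_def
    by (rule has_derivative_transform[OF S(2) _ h(2)[OF S(2)]]) (use eq in auto)
qed

text \<open>The source of all integrations by parts in \<open>k\<close>: applied to the regularized
  integrand, which vanishes at both ends, it yields the differential equation for its
  moments.\<close>

lemma lebesgue_integral_derivative_eq_0:
  fixes F F' :: "real \<Rightarrow> complex"
  assumes F: "\<And>x. (F has_vector_derivative F' x) (at x)"
    and F': "continuous_on UNIV F'" "integrable lborel F'"
    and lim: "(\<lambda>N. F (real N)) \<longlonglongrightarrow> 0" "(\<lambda>N. F (- real N)) \<longlonglongrightarrow> 0"
  shows "(LINT x|lborel. F' x) = 0"
proof -
  have "(\<lambda>N. LINT x|lborel. indicator {- real N..real N} x *\<^sub>R F' x) \<longlonglongrightarrow> (LINT x|lborel. F' x)"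
  proof (rule integral_dominated_convergence[where w = "\<lambda>x. norm (F' x)"])
    show "AE x in lborel. (\<lambda>N. indicator {- real N..real N} x *\<^sub>R F' x) \<longlonglongrightarrow> F' x"
    proof (rule AE_I2, rule tendsto_eventually)
      fix x :: real
      obtain N0 :: nat where "\<bar>x\<bar> \<le> real N0" using real_arch_simple by blast
      then show "\<forall>\<^sub>F N in sequentially. indicator {- real N..real N} x *\<^sub>R F' x = F' x"
        unfolding eventually_sequentially by (intro exI[of _ N0]) (auto simp: indicator_def)
    qed
  qed (use F' in \<open>auto simp: indicator_def\<close>)
  moreover have "(LINT x|lborel. indicator {- real N..real N} x *\<^sub>R F' x) = F (real N) - F (- real N)" for N
    by (rule integral_FTC_atLeastAtMost)
      (auto intro: has_vector_derivative_at_within F continuous_on_subset[OF F'(1)])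
  ultimately have "(\<lambda>N. F (real N) - F (- real N)) \<longlonglongrightarrow> (LINT x|lborel. F' x)" by simp
  moreover have "(\<lambda>N. F (real N) - F (- real N)) \<longlonglongrightarrow> 0 - 0" by (intro tendsto_diff lim)
  ultimately show ?thesis using LIMSEQ_unique by fastforce
qed

text \<open>Rescaling by \<open>sqrt (2 * e)\<close> reduces this to the absolute moments of the
  standard normal density.\<close>

lemma integrable_power_gauss:
  fixes e :: real
  assumes "0 < e"
  shows "integrable lborel (\<lambda>k. \<bar>k\<bar> ^ m * exp (- e * k\<^sup>2))"
proof -
  define c where "c = sqrt (2 * e)"
  have c: "0 < c" "c\<^sup>2 = 2 * e" using assms by (auto simp: c_def)
  have "integrable lborel (\<lambda>x. std_normal_density (0 + c * x) * \<bar>0 + c * x\<bar> ^ m)"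
    by (rule lborel_integrable_real_affine[OF integrable_std_normal_moment_abs]) (use c in auto)
  then have "integrable lborel (\<lambda>x. (sqrt (2 * pi) / c ^ m) * (std_normal_density (0 + c * x) * \<bar>0 + c * x\<bar> ^ m))"
    by (rule integrable_mult_right)
  moreover have "(sqrt (2 * pi) / c ^ m) * (std_normal_density (0 + c * x) * \<bar>0 + c * x\<bar> ^ m) = \<bar>x\<bar> ^ m * exp (- e * x\<^sup>2)" for x
  proof -
    have "- ((c * x)\<^sup>2) / 2 = - e * x\<^sup>2" using c by (simp add: power_mult_distrib)
    then have "std_normal_density (0 + c * x) = 1 / sqrt (2 * pi) * exp (- e * x\<^sup>2)"
      by (simp add: std_normal_density_def)
    then show ?thesis using c by (simp add: abs_mult power_mult_distrib)
  qed
  ultimately show ?thesis by simp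
qed

lemma power_gauss_tendsto_0:
  fixes e :: real
  assumes "0 < e"
  shows "(\<lambda>N. real N ^ m * exp (- e * (real N)\<^sup>2)) \<longlonglongrightarrow> 0"
proof -
  have lim: "filterlim (\<lambda>N. e * (real N)\<^sup>2) at_top sequentially"
    by (intro filterlim_tendsto_pos_mult_at_top[OF tendsto_const assms] filterlim_pow_at_top filterlim_real_sequentially) auto
  have 1: "(\<lambda>N. (e * (real N)\<^sup>2) ^ m / exp (e * (real N)\<^sup>2) / e ^ m) \<longlonglongrightarrow> 0 / e ^ m"
    by (intro tendsto_divide filterlim_compose[OF tendsto_power_div_exp_0 lim] tendsto_const) (use assms in auto)
  show ?thesis
  proof (rule tendsto_sandwich[OF _ _ tendsto_const])
    show "\<forall>\<^sub>F N in sequentially. real N ^ m * exp (- e * (real N)\<^sup>2) \<le> (e * (real N)\<^sup>2) ^ m / exp (e * (real N)\<^sup>2) / e ^ m"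
      using eventually_ge_at_top[of "1::nat"]
    proof eventually_elim
      fix N :: nat assume "1 \<le> N"
      then have "real N ^ m \<le> ((real N)\<^sup>2) ^ m" by (intro power_mono) (auto simp: power2_eq_square)
      then show "real N ^ m * exp (- e * (real N)\<^sup>2) \<le> (e * (real N)\<^sup>2) ^ m / exp (e * (real N)\<^sup>2) / e ^ m"
        using assms by (simp add: power_mult_distrib exp_minus divide_simps)
    qed
  qed (use 1 in auto)
qed

section \<open>The fundamental solution\<close>

text \<open>The Gaussian factor makes the moments of all orders absolutely convergent without leaving
  boundary terms in the differential equations.\<close>

definition gmom :: "nat \<Rightarrow> (nat \<Rightarrow> real) \<Rightarrow> nat \<Rightarrow> real \<Rightarrow> real \<Rightarrow> real \<Rightarrow> complex" where
  "gmom n w m e x t = (LINT k|lborel. osc n w m e x t k)"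

lemma norm_osc: "norm (osc n w m e x t k) = \<bar>k\<bar> ^ m * exp (- e * k\<^sup>2)"
  by (simp add: osc_def norm_mult norm_power)

lemma osc_measurable [measurable]: "osc n w m e x t \<in> borel_measurable borel"
  by (rule borel_measurable_continuous_onI[OF continuous_on_osc])

lemma integrable_osc:
  assumes "0 < e"
  shows "integrable lborel (osc n w m e x t)"
  by (rule Bochner_Integration.integrable_bound[OF integrable_power_gauss[OF assms, of m]])
    (auto simp: norm_osc)

lemma has_bochner_integral_osc:
  assumes "0 < e"
  shows "has_bochner_integral lborel (osc n w m e x t) (gmom n w m e x t)"
  unfolding gmom_def by (rule has_bochner_integral_integrable[OF integrable_osc[OF assms]])

lemma osc_has_vector_derivative_x:
  "((\<lambda>x. osc n w m e x t k) has_vector_derivative \<i> * osc n w (m + 1) e x t k) (at x within A)"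
proof -
  have "((\<lambda>x. k * x - dispersion n w k * t) has_real_derivative k) (at x within A)"
    by (auto intro!: derivative_eq_intros)
  from has_vector_derivative_mult_right[OF has_vector_derivative_cis[OF this], of "complex_of_real (k ^ m * exp (- e * k\<^sup>2))"]
  show ?thesis by (simp add: osc_def[abs_def] mult_ac)
qed

lemma sum_coeff_osc:
  "(\<Sum>j=2..n. of_real (c j) * osc n w (m + j) e x t k) = of_real (\<Sum>j=2..n. c j * k ^ j) * osc n w m e x t k"
  unfolding of_real_sum sum_distrib_right by (intro sum.cong refl) (simp add: osc_def power_add)

lemma osc_has_vector_derivative_t:
  "((\<lambda>t. osc n w m e x t k) has_vector_derivative (\<Sum>j=2..n. - \<i> * of_real (w j) * osc n w (m + j) e x t k)) (at t within A)"
proof -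
  have "((\<lambda>t. k * x - dispersion n w k * t) has_real_derivative - dispersion n w k) (at t within A)"
    by (auto intro!: derivative_eq_intros)
  from has_vector_derivative_mult_right[OF has_vector_derivative_cis[OF this], of "complex_of_real (k ^ m * exp (- e * k\<^sup>2))"]
  have "((\<lambda>t. osc n w m e x t k) has_vector_derivative - \<i> * (of_real (\<Sum>j=2..n. w j * k ^ j) * osc n w m e x t k)) (at t within A)"
    by (simp add: osc_def[abs_def] dispersion_def mult_ac)
  then show ?thesis
    unfolding sum_coeff_osc[symmetric] by (simp add: sum_distrib_left mult_ac)
qed

lemma osc_has_vector_derivative_k:
  "((osc n w m e x t) has_vector_derivative
     (of_real (real m) * osc n w (m - 1) e x t k - 2 * of_real e * osc n w (m + 1) e x t k + \<i> * of_real x * osc n w m e x t k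
      - \<i> * (\<Sum>j=2..n. of_real (real j * w j * t) * osc n w (m + j - 1) e x t k))) (at k within A)"
proof -
  have 1: "((\<lambda>k. k ^ m * exp (- e * k\<^sup>2)) has_real_derivative
      real m * k ^ (m - 1) * exp (- e * k\<^sup>2) - 2 * e * (k ^ (m + 1) * exp (- e * k\<^sup>2))) (at k within A)"
    by (auto intro!: derivative_eq_intros)
  have 2: "((\<lambda>k. k * x - dispersion n w k * t) has_real_derivative x - disp_deriv n w k * t) (at k within A)"
    by (auto intro!: derivative_eq_intros has_real_derivative_dispersion)
  have "(\<Sum>j=2..n. of_real (real j * w j * t) * osc n w (m + j - 1) e x t k) = of_real (disp_deriv n w k * t) * osc n w m e x t k"
    unfolding disp_deriv_def of_real_sum sum_distrib_right
  proof (intro sum.cong refl)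
    fix j assume "j \<in> {2..n}"
    then have "k ^ (m + j - 1) = k ^ m * k ^ (j - 1)" by (simp add: power_add[symmetric])
    then show "complex_of_real (real j * w j * t) * osc n w (m + j - 1) e x t k = of_real (w j * (real j * k ^ (j - 1)) * t) * osc n w m e x t k"
      by (simp add: osc_def)
  qed
  moreover have "((osc n w m e x t) has_vector_derivative
     of_real (k ^ m * exp (- e * k\<^sup>2)) * (of_real (x - disp_deriv n w k * t) * (\<i> * cis (k * x - dispersion n w k * t)))
     + of_real (real m * k ^ (m - 1) * exp (- e * k\<^sup>2) - 2 * e * (k ^ (m + 1) * exp (- e * k\<^sup>2))) * cis (k * x - dispersion n w k * t)) (at k within A)"
    unfolding osc_def[abs_def]
    by (intro has_vector_derivative_mult has_vector_derivative_of_real has_vector_derivative_cis 1 2)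
  ultimately show ?thesis by (simp add: osc_def algebra_simps)
qed

lemma gmom_has_vector_derivative_x:
  assumes "0 < e"
  shows "((\<lambda>x. gmom n w m e x t) has_vector_derivative \<i> * gmom n w (m + 1) e x t) (at x)"
proof -
  have "((\<lambda>x. LINT k|lborel. osc n w m e x t k) has_vector_derivative (LINT k|lborel. \<i> * osc n w (m + 1) e x t k)) (at x)"
  proof (rule has_vector_derivative_lebesgue_integral[where S = UNIV and g = "\<lambda>k. \<bar>k\<bar> ^ (m + 1) * exp (- e * k\<^sup>2)"])
    show "((\<lambda>x. osc n w m e x t k) has_vector_derivative \<i> * osc n w (m + 1) e x t k) (at x)" for x k
      by (rule osc_has_vector_derivative_x)
    show "integrable lborel (osc n w m e x t)" for x
      by (rule integrable_osc[OF assms])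
    show "(\<lambda>k. \<i> * osc n w (m + 1) e x t k) \<in> borel_measurable lborel"
      by measurable
    show "norm (\<i> * osc n w (m + 1) e x t k) \<le> \<bar>k\<bar> ^ (m + 1) * exp (- e * k\<^sup>2)" for x k
      by (simp only: norm_mult norm_ii norm_osc mult_1_left order_refl)
    show "integrable lborel (\<lambda>k. \<bar>k\<bar> ^ (m + 1) * exp (- e * k\<^sup>2))"
      by (rule integrable_power_gauss[OF assms])
  qed simp_all
  then show ?thesis by (simp add: gmom_def)
qed

lemma gmom_has_vector_derivative_t:
  assumes "0 < e"
  shows "((\<lambda>t. gmom n w m e x t) has_vector_derivative (\<Sum>j=2..n. - \<i> * of_real (w j) * gmom n w (m + j) e x t)) (at t)"
proof -
  have "((\<lambda>t. LINT k|lborel. osc n w m e x t k) has_vector_derivative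
      (LINT k|lborel. (\<Sum>j=2..n. - \<i> * of_real (w j) * osc n w (m + j) e x t k))) (at t)"
  proof (rule has_vector_derivative_lebesgue_integral[where S = UNIV and g = "\<lambda>k. \<Sum>j=2..n. \<bar>w j\<bar> * (\<bar>k\<bar> ^ (m + j) * exp (- e * k\<^sup>2))"])
    show "((\<lambda>t. osc n w m e x t k) has_vector_derivative (\<Sum>j=2..n. - \<i> * of_real (w j) * osc n w (m + j) e x t k)) (at t)" for t k
      by (rule osc_has_vector_derivative_t)
    show "integrable lborel (osc n w m e x t)" for t
      by (rule integrable_osc[OF assms])
    show "(\<lambda>k. \<Sum>j=2..n. - \<i> * of_real (w j) * osc n w (m + j) e x t k) \<in> borel_measurable lborel"
      by measurable
    show "norm (\<Sum>j=2..n. - \<i> * of_real (w j) * osc n w (m + j) e x t k) \<le> (\<Sum>j=2..n. \<bar>w j\<bar> * (\<bar>k\<bar> ^ (m + j) * exp (- e * k\<^sup>2)))" for t k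
    proof (rule sum_norm_le)
      show "norm (- \<i> * of_real (w j) * osc n w (m + j) e x t k) \<le> \<bar>w j\<bar> * (\<bar>k\<bar> ^ (m + j) * exp (- e * k\<^sup>2))" for j
        by (simp only: norm_mult norm_ii norm_minus_cancel norm_of_real norm_osc mult_1_left order_refl)
    qed
    show "integrable lborel (\<lambda>k. \<Sum>j=2..n. \<bar>w j\<bar> * (\<bar>k\<bar> ^ (m + j) * exp (- e * k\<^sup>2)))"
      by (intro Bochner_Integration.integrable_sum integrable_mult_right integrable_power_gauss assms)
  qed simp_all
  moreover have "has_bochner_integral lborel (\<lambda>k. \<Sum>j=2..n. - \<i> * of_real (w j) * osc n w (m + j) e x t k) (\<Sum>j=2..n. - \<i> * of_real (w j) * gmom n w (m + j) e x t)"
    by (intro has_bochner_integral_sum has_bochner_integral_mult_right has_bochner_integral_osc assms)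
  ultimately show ?thesis by (simp only: has_bochner_integral_integral_eq gmom_def)
qed

text \<open>The derivative in \<open>k\<close> of the regularized integrand has integral 0; its
  pieces come from \<open>k ^ m\<close>, the Gaussian and the phase. For \<open>m = 0\<close> the
  term of order \<open>m - 1\<close> has the coefficient 0, so the truncated subtraction is
  harmless.\<close>

lemma gmom_ode:
  assumes "0 < e"
  shows "(\<Sum>j=2..n. of_real (real j * w j * t) * gmom n w (m + j - 1) e x t) =
    of_real x * gmom n w m e x t - \<i> * of_real (real m) * gmom n w (m - 1) e x t + 2 * \<i> * of_real e * gmom n w (m + 1) e x t"
proof -
  define F' where "F' k = of_real (real m) * osc n w (m - 1) e x t k - 2 * of_real e * osc n w (m + 1) e x t k + \<i> * of_real x * osc n w m e x t k
      - \<i> * (\<Sum>j=2..n. of_real (real j * w j * t) * osc n w (m + j - 1) e x t k)" for k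
  note int = integrable_osc[OF assms]
  have "(LINT k|lborel. F' k) = 0"
  proof (rule lebesgue_integral_derivative_eq_0[where F = "osc n w m e x t"])
    show "(osc n w m e x t has_vector_derivative F' k) (at k)" for k
      unfolding F'_def by (rule osc_has_vector_derivative_k)
    show "continuous_on UNIV F'"
      unfolding F'_def[abs_def] by (intro continuous_intros continuous_on_osc)
    show "integrable lborel F'"
      unfolding F'_def[abs_def]
      by (intro Bochner_Integration.integrable_add Bochner_Integration.integrable_diff integrable_mult_right
          Bochner_Integration.integrable_sum int)
    show "(\<lambda>N. osc n w m e x t (real N)) \<longlonglongrightarrow> 0"
      by (rule tendsto_norm_zero_cancel) (use power_gauss_tendsto_0[OF assms, of m] in \<open>simp add: norm_osc\<close>)
    show "(\<lambda>N. osc n w m e x t (- real N)) \<longlonglongrightarrow> 0"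
      by (rule tendsto_norm_zero_cancel) (use power_gauss_tendsto_0[OF assms, of m] in \<open>simp add: norm_osc\<close>)
  qed
  also have "(LINT k|lborel. F' k) = of_real (real m) * gmom n w (m - 1) e x t - 2 * of_real e * gmom n w (m + 1) e x t + \<i> * of_real x * gmom n w m e x t
      - \<i> * (\<Sum>j=2..n. of_real (real j * w j * t) * gmom n w (m + j - 1) e x t)"
    unfolding F'_def
    by (intro has_bochner_integral_integral_eq has_bochner_integral_add has_bochner_integral_diff
        has_bochner_integral_sum has_bochner_integral_mult_right has_bochner_integral_osc assms)
  finally have "\<i> * (\<Sum>j=2..n. of_real (real j * w j * t) * gmom n w (m + j - 1) e x t) =
     of_real (real m) * gmom n w (m - 1) e x t - 2 * of_real e * gmom n w (m + 1) e x t + \<i> * of_real x * gmom n w m e x t"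
    by simp
  then have "- \<i> * (\<i> * (\<Sum>j=2..n. of_real (real j * w j * t) * gmom n w (m + j - 1) e x t)) =
     - \<i> * (of_real (real m) * gmom n w (m - 1) e x t - 2 * of_real e * gmom n w (m + 1) e x t + \<i> * of_real x * gmom n w m e x t)"
    by simp
  then show ?thesis by (simp add: algebra_simps)
qed

lemma continuous_on_gmom:
  assumes "0 < e"
  shows "continuous_on UNIV (\<lambda>z. gmom n w m e (fst z) (snd z))"
  unfolding gmom_def
proof (rule continuous_on_lebesgue_integral[where g = "\<lambda>k. \<bar>k\<bar> ^ m * exp (- e * k\<^sup>2)"])
  show "continuous_on UNIV (\<lambda>z. osc n w m e (fst z) (snd z) k)" for k
    unfolding osc_def by (intro continuous_intros)
  show "integrable lborel (\<lambda>k. \<bar>k\<bar> ^ m * exp (- e * k\<^sup>2))"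
    by (rule integrable_power_gauss[OF assms])
  show "norm (osc n w m e (fst z) (snd z) k) \<le> \<bar>k\<bar> ^ m * exp (- e * k\<^sup>2)" for z k
    by (simp only: norm_osc order_refl)
qed simp_all

lemma integral_osc_eq_lborel:
  "integral {u..v} (osc n w m e x t) = (LINT k|lborel. indicator {u..v} k *\<^sub>R osc n w m e x t k)"
  using set_borel_integral_eq_integral(2)[of "{u..v}" "osc n w m e x t"]
    borel_integrable_compact[of "{u..v}" "osc n w m e x t"]
  by (simp add: set_integrable_def set_lebesgue_integral_def continuous_on_osc)

lemma trunc_tendsto_gmom:
  assumes "0 < e"
  shows "(\<lambda>N. integral {- real N..real N} (osc n w m e x t)) \<longlonglongrightarrow> gmom n w m e x t"
proof -
  have "(\<lambda>N. LINT k|lborel. indicator {- real N..real N} k *\<^sub>R osc n w m e x t k) \<longlonglongrightarrow> gmom n w m e x t"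
    unfolding gmom_def
  proof (rule integral_dominated_convergence[where w = "\<lambda>k. norm (osc n w m e x t k)"])
    show "AE k in lborel. (\<lambda>N. indicator {- real N..real N} k *\<^sub>R osc n w m e x t k) \<longlonglongrightarrow> osc n w m e x t k"
    proof (rule AE_I2, rule tendsto_eventually)
      fix k :: real
      obtain N0 :: nat where "\<bar>k\<bar> \<le> real N0" using real_arch_simple by blast
      then show "\<forall>\<^sub>F N in sequentially. indicator {- real N..real N} k *\<^sub>R osc n w m e x t k = osc n w m e x t k"
        unfolding eventually_sequentially by (intro exI[of _ N0]) (auto simp: indicator_def)
    qed
  qed (use integrable_osc[OF assms] in \<open>auto simp: indicator_def\<close>)
  then show ?thesis by (simp only: integral_osc_eq_lborel)
qed

section \<open>Removal of the Gaussian factor\<close>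

text \<open>Up to the factor \<open>\<i> ^ m / (2 * pi)\<close> this is the \<open>m\<close>-th
  space derivative of the fundamental solution at times \<open>t > 0\<close>; the normalization
  \<open>1 / (2 * pi)\<close> is supplied only when the solution is identified.\<close>

definition kern :: "nat \<Rightarrow> (nat \<Rightarrow> real) \<Rightarrow> nat \<Rightarrow> real \<Rightarrow> real \<Rightarrow> complex" where
  "kern n w m x t = lim (\<lambda>N. gmom n w m (inverse (real (Suc N))) x t)"

lemma abs_exp_diff_le:
  fixes a b :: real
  assumes "0 \<le> a" "0 \<le> b"
  shows "\<bar>exp (- a) - exp (- b)\<bar> \<le> \<bar>a - b\<bar>"
proof -
  have *: "exp (- a) - exp (- b) \<le> b - a \<and> 0 \<le> exp (- a) - exp (- b)" if "0 \<le> a" "a \<le> b" for a b :: real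
  proof -
    have "exp (- a) - exp (- b) = exp (- a) * (1 - exp (- (b - a)))" by (simp add: right_diff_distrib exp_add[symmetric])
    also have "\<dots> \<le> 1 * (b - a)"
    proof (rule mult_mono)
      show "1 - exp (- (b - a)) \<le> b - a" using exp_ge_add_one_self[of "- (b - a)"] by linarith
    qed (use that in auto)
    finally show ?thesis using that by simp
  qed
  show ?thesis using *[of a b] *[of b a] assms by (cases "a \<le> b") auto
qed

text \<open>The power \<open>R ^ (m + 3)\<close> collects \<open>R ^ m\<close> from the amplitude,
  \<open>R^2\<close> from the Lipschitz bound of the exponential and one factor from the length
  \<open>2 * R\<close> of the interval.\<close>

lemma norm_integral_osc_diff_le:
  assumes "0 \<le> R" "0 \<le> e" "0 \<le> e'"
  shows "norm (integral {- R..R} (osc n w m e x t) - integral {- R..R} (osc n w m e' x t)) \<le> 2 * R ^ (m + 3) * \<bar>e - e'\<bar>"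
proof -
  have "norm (integral {- R..R} (\<lambda>k. osc n w m e x t k - osc n w m e' x t k)) \<le> R ^ m * (\<bar>e - e'\<bar> * R\<^sup>2) * (R - (- R))"
  proof (rule integral_bound)
    fix k assume "k \<in> {- R..R}"
    then have k: "\<bar>k\<bar> \<le> R" by auto
    have k2: "k\<^sup>2 \<le> R\<^sup>2" using k assms by (simp add: abs_le_square_iff[symmetric])
    have "osc n w m e x t k - osc n w m e' x t k = of_real (k ^ m * (exp (- (e * k\<^sup>2)) - exp (- (e' * k\<^sup>2)))) * cis (k * x - dispersion n w k * t)"
      by (simp add: osc_def algebra_simps)
    then have "norm (osc n w m e x t k - osc n w m e' x t k) = \<bar>k\<bar> ^ m * \<bar>exp (- (e * k\<^sup>2)) - exp (- (e' * k\<^sup>2))\<bar>"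
      by (simp add: norm_mult abs_mult power_abs del: of_real_mult of_real_diff)
    also have "\<dots> \<le> R ^ m * (\<bar>e - e'\<bar> * R\<^sup>2)"
    proof (intro mult_mono power_mono)
      have "\<bar>exp (- (e * k\<^sup>2)) - exp (- (e' * k\<^sup>2))\<bar> \<le> \<bar>e * k\<^sup>2 - e' * k\<^sup>2\<bar>"
        using assms by (intro abs_exp_diff_le) auto
      also have "\<dots> = \<bar>e - e'\<bar> * k\<^sup>2" by (simp add: left_diff_distrib[symmetric] abs_mult)
      also have "\<dots> \<le> \<bar>e - e'\<bar> * R\<^sup>2" using k2 by (intro mult_left_mono) auto
      finally show "\<bar>exp (- (e * k\<^sup>2)) - exp (- (e' * k\<^sup>2))\<bar> \<le> \<bar>e - e'\<bar> * R\<^sup>2" .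
    qed (use k assms in auto)
    finally show "norm (osc n w m e x t k - osc n w m e' x t k) \<le> R ^ m * (\<bar>e - e'\<bar> * R\<^sup>2)" .
  next
    show "continuous_on {- R..R} (\<lambda>k. osc n w m e x t k - osc n w m e' x t k)"
      by (intro continuous_intros continuous_on_osc)
  qed (use assms in auto)
  also have "R ^ m * (\<bar>e - e'\<bar> * R\<^sup>2) * (R - (- R)) = 2 * R ^ (m + 3) * \<bar>e - e'\<bar>"
    by (simp add: power_add power2_eq_square power3_eq_cube)
  finally show ?thesis
    by (simp add: Henstock_Kurzweil_Integration.integral_diff[OF osc_integrable osc_integrable])
qed

lemma gmom_trunc_le:
  assumes "0 < e" and tail: "\<And>R'. R \<le> R' \<Longrightarrow>
     norm (integral {- R'..R'} (osc n w m e x t) - integral {- R..R} (osc n w m e x t)) \<le> B"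
  shows "norm (gmom n w m e x t - integral {- R..R} (osc n w m e x t)) \<le> B"
proof -
  obtain N0 :: nat where N0: "R \<le> real N0" using real_arch_simple by blast
  have 1: "(\<lambda>N. norm (integral {- real N..real N} (osc n w m e x t) - integral {- R..R} (osc n w m e x t)))
      \<longlonglongrightarrow> norm (gmom n w m e x t - integral {- R..R} (osc n w m e x t))"
    by (intro tendsto_intros trunc_tendsto_gmom assms)
  have 2: "\<forall>N\<ge>N0. norm (integral {- real N..real N} (osc n w m e x t) - integral {- R..R} (osc n w m e x t)) \<le> B"
    using N0 by (auto intro: tail)
  show ?thesis by (rule Lim_bounded[OF 1 2])
qed

text \<open>The part with \<open>|k| <= R\<close> is Lipschitz in \<open>e\<close>, and the rest is
  small uniformly in \<open>e\<close>. This works for \<open>m <= n - 2\<close>, where the tails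
  decay.\<close>

lemma gmom_uniformly_convergent_low:
  assumes n: "2 \<le> n" and wn: "w n \<noteq> 0" and ab: "0 < a" "a \<le> b" and m: "m + 2 \<le> n"
  shows "uniformly_convergent_on ({- X..X} \<times> {a..b}) (\<lambda>N z. gmom n w m (inverse (real (Suc N))) (fst z) (snd z))"
proof (rule Cauchy_uniformly_convergent, rule uniformly_Cauchy_onI)
  fix \<epsilon> :: real assume eps: "0 < \<epsilon>"
  obtain C where C: "0 \<le> C" and "\<And>X. \<exists>\<rho>\<ge>1. \<forall>x t R R' e. \<bar>x\<bar> \<le> X \<longrightarrow> a \<le> t \<longrightarrow> t \<le> b \<longrightarrow> 0 \<le> e \<longrightarrow> \<rho> \<le> R \<longrightarrow> R \<le> R' \<longrightarrow>
     norm (integral {- R'..R'} (osc n w m e x t) - integral {- R..R} (osc n w m e x t)) \<le> C / R"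
    by (rule osc_tail[of n w a b m, OF n wn ab m]) (rule that)
  from this(2)[of X] obtain \<rho> where \<rho>: "1 \<le> \<rho>" and tail: "\<And>x t R R' e. \<bar>x\<bar> \<le> X \<Longrightarrow> a \<le> t \<Longrightarrow> t \<le> b \<Longrightarrow> 0 \<le> e \<Longrightarrow> \<rho> \<le> R \<Longrightarrow> R \<le> R' \<Longrightarrow>
     norm (integral {- R'..R'} (osc n w m e x t) - integral {- R..R} (osc n w m e x t)) \<le> C / R"
    by blast
  \<comment> \<open>The error is split into two tails of at most \<open>\<epsilon> / 4\<close> each
    and a compact part below \<open>\<epsilon> / 2\<close>.\<close>
  define R where "R = max \<rho> (4 * C / \<epsilon>)"
  have R: "\<rho> \<le> R" "1 \<le> R" "C / R \<le> \<epsilon> / 4"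
  proof -
    show "\<rho> \<le> R" "1 \<le> R" using \<rho> by (auto simp: R_def)
    then have "4 * C / \<epsilon> \<le> R" by (simp add: R_def)
    then show "C / R \<le> \<epsilon> / 4" using eps \<open>1 \<le> R\<close> by (simp add: field_simps)
  qed
  obtain N0 :: nat where N0: "8 * R ^ (m + 3) / \<epsilon> < real N0" using reals_Archimedean2 by blast
  have small: "2 * R ^ (m + 3) * inverse (real (Suc N)) < \<epsilon> / 4" if "N0 \<le> N" for N
  proof -
    have "8 * R ^ (m + 3) / \<epsilon> < real (Suc N)" using N0 that by linarith
    then show ?thesis using eps by (simp add: field_simps)
  qed
  have "dist (gmom n w m (inverse (real (Suc M))) x t) (gmom n w m (inverse (real (Suc N))) x t) < \<epsilon>"
    if x: "\<bar>x\<bar> \<le> X" and t: "a \<le> t" "t \<le> b" and MN: "N0 \<le> M" "N0 \<le> N" for x t M N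
  proof -
    define J where "J e = integral {- R..R} (osc n w m e x t)" for e
    have g: "norm (gmom n w m e x t - J e) \<le> \<epsilon> / 4" if "0 < e" for e
    proof -
      have "norm (gmom n w m e x t - J e) \<le> C / R"
        unfolding J_def by (rule gmom_trunc_le[OF that]) (rule tail[OF x t less_imp_le[OF that] R(1)])
      then show ?thesis using R(3) by linarith
    qed
    define d where "d = inverse (real (Suc M))"
    define e where "e = inverse (real (Suc N))"
    have de: "0 < d" "0 < e" by (auto simp: d_def e_def)
    have "norm (J d - J e) \<le> 2 * R ^ (m + 3) * \<bar>d - e\<bar>"
      unfolding J_def using R de by (intro norm_integral_osc_diff_le) auto
    also have "\<dots> \<le> 2 * R ^ (m + 3) * (d + e)" using R de by (intro mult_left_mono) auto
    also have "\<dots> = 2 * R ^ (m + 3) * d + 2 * R ^ (m + 3) * e" by (rule distrib_left)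
    also have "\<dots> < \<epsilon> / 4 + \<epsilon> / 4"
      unfolding d_def e_def using small[OF MN(1)] small[OF MN(2)] by (rule add_strict_mono)
    finally have J: "norm (J d - J e) < \<epsilon> / 2" by simp
    have "norm ((gmom n w m d x t - J d) + (J d - J e) - (gmom n w m e x t - J e))
       \<le> norm (gmom n w m d x t - J d) + norm (J d - J e) + norm (gmom n w m e x t - J e)"
      using norm_triangle_ineq4[of "(gmom n w m d x t - J d) + (J d - J e)" "gmom n w m e x t - J e"]
        norm_triangle_ineq[of "gmom n w m d x t - J d" "J d - J e"] by linarith
    then have "norm (gmom n w m d x t - gmom n w m e x t) \<le> norm (gmom n w m d x t - J d) + norm (J d - J e) + norm (gmom n w m e x t - J e)"
      by simp
    then show ?thesis using g[OF de(1)] g[OF de(2)] J unfolding dist_norm d_def[symmetric] e_def[symmetric] by linarith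
  qed
  then show "\<exists>M. \<forall>x\<in>{- X..X} \<times> {a..b}. \<forall>m'\<ge>M. \<forall>n'\<ge>M.
      dist (gmom n w m (inverse (real (Suc m'))) (fst x) (snd x)) (gmom n w m (inverse (real (Suc n'))) (fst x) (snd x)) < \<epsilon>"
    by (intro exI[of _ N0]) (auto simp: abs_le_iff)
qed

lemma uniform_limit_tendsto:
  assumes "(f \<longlongrightarrow> c) F"
  shows "uniform_limit S (\<lambda>N z. f N) (\<lambda>z. c) F"
  by (rule uniform_limitI) (use tendstoD[OF assms] in \<open>auto elim: eventually_mono\<close>)

lemma uniform_limit_sum:
  fixes f :: "'i \<Rightarrow> 'a \<Rightarrow> 'b \<Rightarrow> 'c::real_normed_vector"
  assumes "\<And>i. i \<in> I \<Longrightarrow> uniform_limit S (f i) (l i) F"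
  shows "uniform_limit S (\<lambda>a b. \<Sum>i\<in>I. f i a b) (\<lambda>b. \<Sum>i\<in>I. l i b) F"
  using assms
proof (induction I rule: infinite_finite_induct)
  case (insert i I)
  then show ?case by (simp add: uniform_limit_add)
qed (simp_all add: uniform_limit_const)

text \<open>The orders from \<open>n - 1\<close> on are reached through the differential equation in \<open>x\<close>
  solved for the moment of highest order.\<close>

lemma gmom_uniform_limit:
  assumes n: "2 \<le> n" and wn: "w n \<noteq> 0" and ab: "0 < a" "a \<le> b"
  shows "uniform_limit ({- X..X} \<times> {a..b}) (\<lambda>N z. gmom n w m (inverse (real (Suc N))) (fst z) (snd z))
     (\<lambda>z. kern n w m (fst z) (snd z)) sequentially"
proof (induction m rule: less_induct)
  case (less M)
  let ?K = "{- X..X} \<times> {a..b}"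
  let ?g = "\<lambda>m N z. gmom n w m (inverse (real (Suc N))) (fst z) (snd z)"
  have compK: "compact ?K" by (intro compact_Times) auto
  \<comment> \<open>Uniform convergence of products and quotients below uses bounded limits; the
    limits of lower order are continuous on a compact set.\<close>
  have bdd: "bounded ((\<lambda>z. kern n w m (fst z) (snd z)) ` ?K)" if "m < M" for m
  proof (rule compact_imp_bounded, rule compact_continuous_image[OF _ compK])
    show "continuous_on ?K (\<lambda>z. kern n w m (fst z) (snd z))"
      by (rule uniform_limit_theorem[OF _ less[OF that]])
        (auto intro!: always_eventually continuous_on_subset[OF continuous_on_gmom])
  qed
  have bddc: "bounded ((\<lambda>z. f z) ` ?K)" if "continuous_on ?K f" for f :: "real \<times> real \<Rightarrow> complex"
    by (rule compact_imp_bounded, rule compact_continuous_image[OF that compK])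
  have "uniformly_convergent_on ?K (?g M)"
  proof (cases "M + 2 \<le> n")
    case True
    then show ?thesis by (rule gmom_uniformly_convergent_low[of n w a b M X, OF n wn ab])
  next
    case False
    \<comment> \<open>With this \<open>m\<close> the highest order in the sum over \<open>j\<close>
      of \<open>gmom_ode\<close> is \<open>m + n - 1 = M\<close>, reached at
      \<open>j = n\<close>.\<close>
    define m where "m = M + 1 - n"
    have M: "M = m + n - 1" using False n by (simp add: m_def)
    have lt: "m < M" "m - 1 < M" "n \<noteq> 2 \<Longrightarrow> m + 1 < M" "\<And>j. j \<in> {2..<n} \<Longrightarrow> m + j - 1 < M" using M n by auto
    define ee where "ee N = (inverse (real (Suc N)))" for N
    have ee: "0 < ee N" for N by (simp add: ee_def)
    have ee_lim: "(\<lambda>N. complex_of_real (ee N)) \<longlonglongrightarrow> 0"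
      using tendsto_of_real[OF LIMSEQ_inverse_real_of_nat, where 'a = complex] by (simp only: ee_def[abs_def] of_real_0)
    \<comment> \<open>For \<open>n = 2\<close> the regularizing term contains the moment of order
      \<open>m + 1 = M\<close> itself and is moved into the coefficient \<open>c\<close> of the
      unknown; for larger \<open>n\<close> it stays on the right-hand side \<open>r\<close>. The
      conditional index in \<open>r\<close> keeps the dummy moment, which then has coefficient 0,
      below \<open>M\<close>.\<close>
    define c where "c N z = complex_of_real (real n * w n) * complex_of_real (snd z) - (if n = 2 then 2 * \<i> else 0) * of_real (ee N)" for N and z :: "real \<times> real"
    define r where "r N z = of_real (fst z) * ?g m N z - \<i> * of_real (real m) * ?g (m - 1) N z
       + (if n = 2 then 0 else 2 * \<i>) * of_real (ee N) * ?g (if n = 2 then m else m + 1) N z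
       - (\<Sum>j=2..<n. of_real (real j * w j) * of_real (snd z) * ?g (m + j - 1) N z)" for N z
    \<comment> \<open>The correction in \<open>c\<close> is purely imaginary, so the real part alone
      keeps \<open>c\<close> away from 0, uniformly in \<open>N\<close>.\<close>
    have Re_c: "norm (c N z) \<ge> real n * \<bar>w n\<bar> * a" if "z \<in> ?K" for N z
    proof -
      have "real n * \<bar>w n\<bar> * a \<le> real n * \<bar>w n\<bar> * snd z" using that by (intro mult_left_mono) auto
      also have "\<dots> = \<bar>Re (c N z)\<bar>" using that ab by (auto simp: c_def abs_mult)
      also have "\<dots> \<le> norm (c N z)" by (rule abs_Re_le_cmod)
      finally show ?thesis .
    qed
    have pos: "0 < real n * \<bar>w n\<bar> * a" using n wn ab by simp
    have solve: "?g M N z = r N z / c N z" if "z \<in> ?K" for N z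
    proof -
      obtain x t where z: "z = (x, t)" by (cases z)
      have "(\<Sum>j=2..n. of_real (real j * w j * t) * gmom n w (m + j - 1) (ee N) x t) =
         of_real (real n * w n * t) * gmom n w M (ee N) x t + (\<Sum>j=2..<n. of_real (real j * w j * t) * gmom n w (m + j - 1) (ee N) x t)"
        using n M by (simp add: sum.last_plus)
      with gmom_ode[OF ee[of N], where n = n and w = w and t = t and m = m and x = x]
      have eq: "of_real (real n * w n * t) * gmom n w M (ee N) x t =
        of_real x * gmom n w m (ee N) x t - \<i> * of_real (real m) * gmom n w (m - 1) (ee N) x t + 2 * \<i> * of_real (ee N) * gmom n w (m + 1) (ee N) x t
        - (\<Sum>j=2..<n. of_real (real j * w j * t) * gmom n w (m + j - 1) (ee N) x t)"
        by (simp add: algebra_simps)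
      have "c N z * gmom n w M (ee N) x t = r N z"
      proof (cases "n = 2")
        case True
        then have "M = m + 1" using M by simp
        then show ?thesis using eq True by (simp add: c_def r_def z ee_def algebra_simps)
      next
        case False
        then show ?thesis using eq by (simp add: c_def r_def z ee_def mult.assoc)
      qed
      moreover have "c N z \<noteq> 0" using Re_c[OF that, of N] pos by auto
      ultimately show ?thesis by (simp add: z ee_def field_simps)
    qed
    define c0 where "c0 z = complex_of_real (real n * w n) * complex_of_real (snd z)" for z :: "real \<times> real"
    define r0 where "r0 z = of_real (fst z) * kern n w m (fst z) (snd z) - \<i> * of_real (real m) * kern n w (m - 1) (fst z) (snd z)
       - (\<Sum>j=2..<n. of_real (real j * w j) * of_real (snd z) * kern n w (m + j - 1) (fst z) (snd z))" for z
    have scal: "uniform_limit ?K (\<lambda>N z. f z * ?g i N z) (\<lambda>z. f z * kern n w i (fst z) (snd z)) sequentially"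
      if "continuous_on ?K f" "i < M" for i and f :: "real \<times> real \<Rightarrow> complex"
      by (intro uniform_lim_mult uniform_limit_const less[OF that(2)] bdd[OF that(2)] bddc[OF that(1)])
    have vanish: "uniform_limit ?K (\<lambda>N z. (if n = 2 then 0 else 2 * \<i>) * of_real (ee N) * ?g (if n = 2 then m else m + 1) N z) (\<lambda>z. 0) sequentially"
    proof -
      have i: "(if n = 2 then m else m + 1) < M" using lt by auto
      have "(\<lambda>N. (if n = 2 then 0 else 2 * \<i>) * of_real (ee N)) \<longlonglongrightarrow> (if n = 2 then 0 else 2 * \<i>) * 0"
        by (intro tendsto_mult tendsto_const ee_lim)
      then have "uniform_limit ?K (\<lambda>N z. (if n = 2 then 0 else 2 * \<i>) * of_real (ee N)) (\<lambda>z. 0) sequentially"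
        by (intro uniform_limit_tendsto) simp
      from uniform_lim_mult[OF this less[OF i] _ bdd[OF i]]
      show ?thesis by (simp add: bounded_pos exI[of _ "1::real"])
    qed
    have r_lim: "uniform_limit ?K r r0 sequentially"
    proof -
      have "uniform_limit ?K (\<lambda>N z. of_real (fst z) * ?g m N z - \<i> * of_real (real m) * ?g (m - 1) N z
        + (if n = 2 then 0 else 2 * \<i>) * of_real (ee N) * ?g (if n = 2 then m else m + 1) N z
        - (\<Sum>j=2..<n. of_real (real j * w j) * of_real (snd z) * ?g (m + j - 1) N z))
        (\<lambda>z. of_real (fst z) * kern n w m (fst z) (snd z) - \<i> * of_real (real m) * kern n w (m - 1) (fst z) (snd z) + 0
       - (\<Sum>j=2..<n. of_real (real j * w j) * of_real (snd z) * kern n w (m + j - 1) (fst z) (snd z))) sequentially"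
        by (intro uniform_limit_minus uniform_limit_add uniform_limit_sum scal vanish lt continuous_intros) auto
      then show ?thesis unfolding r_def[abs_def] r0_def[abs_def] by simp
    qed
    have c_lim: "uniform_limit ?K c c0 sequentially"
    proof -
      have "(\<lambda>N. (if n = 2 then 2 * \<i> else 0) * complex_of_real (ee N)) \<longlonglongrightarrow> (if n = 2 then 2 * \<i> else 0) * 0"
        by (intro tendsto_mult tendsto_const ee_lim)
      then have "uniform_limit ?K (\<lambda>N z. c0 z - (if n = 2 then 2 * \<i> else 0) * of_real (ee N)) (\<lambda>z. c0 z - 0) sequentially"
        by (intro uniform_limit_minus uniform_limit_const uniform_limit_tendsto) simp
      then show ?thesis unfolding c_def[abs_def] c0_def[abs_def] by simp
    qed
    have "uniform_limit ?K (\<lambda>N z. r N z / c N z) (\<lambda>z. r0 z / c0 z) sequentially"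
    proof (rule uniform_lim_divide[OF r_lim c_lim])
      show "bounded (r0 ` ?K)"
      proof (rule bddc)
        show "continuous_on ?K r0"
          by (rule uniform_limit_theorem[OF _ r_lim])
            (auto intro!: always_eventually continuous_intros continuous_on_subset[OF continuous_on_gmom] simp: r_def[abs_def])
      qed
      show "real n * \<bar>w n\<bar> * a \<le> norm (c0 z)" if "z \<in> ?K" for z
      proof -
        have "real n * \<bar>w n\<bar> * a \<le> real n * \<bar>w n\<bar> * snd z" using that by (intro mult_left_mono) auto
        also have "\<dots> = norm (c0 z)" using that ab by (auto simp: c0_def norm_mult)
        finally show ?thesis .
      qed
    qed (use pos in auto)
    then have "uniform_limit ?K (?g M) (\<lambda>z. r0 z / c0 z) sequentially"
      by (rule uniform_limit_cong'[THEN iffD1, rotated -1]) (use solve in auto)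
    then show ?thesis unfolding uniformly_convergent_on_def by blast
  qed
  then show ?case unfolding uniformly_convergent_uniform_limit_iff kern_def .
qed

lemma gmom_tendsto_kern:
  assumes "2 \<le> n" "w n \<noteq> 0" "0 < t"
  shows "(\<lambda>N. gmom n w m (inverse (real (Suc N))) x t) \<longlonglongrightarrow> kern n w m x t"
proof -
  have "(x, t) \<in> {- \<bar>x\<bar>..\<bar>x\<bar>} \<times> {t..t}" by (auto simp: abs_if)
  from tendsto_uniform_limitI[OF gmom_uniform_limit[where n = n and w = w and a = t and b = t and m = m, OF assms(1-3) order_refl] this]
  show ?thesis by (simp only: fst_conv snd_conv)
qed

lemma kern_has_vector_derivative_x:
  assumes "2 \<le> n" "w n \<noteq> 0" "0 < t"
  shows "((\<lambda>x. kern n w m x t) has_vector_derivative \<i> * kern n w (m + 1) x t) (at x)"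
proof -
  define S where "S = {- (\<bar>x\<bar> + 1)..\<bar>x\<bar> + 1}"
  have x: "x \<in> interior S" by (auto simp: S_def)
  have "((\<lambda>x. kern n w m x t) has_vector_derivative \<i> * kern n w (m + 1) x t) (at x within S)"
  proof (rule has_vector_derivative_uniform_limit[where f = "\<lambda>N x. gmom n w m (inverse (real (Suc N))) x t"
        and f' = "\<lambda>N x. \<i> * gmom n w (m + 1) (inverse (real (Suc N))) x t"])
    show "x \<in> S" using x interior_subset by blast
    show "((\<lambda>x. gmom n w m (inverse (real (Suc N))) x t) has_vector_derivative
        \<i> * gmom n w (m + 1) (inverse (real (Suc N))) x t) (at x within S)" for N x
      by (rule has_vector_derivative_at_within, rule gmom_has_vector_derivative_x) simp
    show "(\<lambda>N. gmom n w m (inverse (real (Suc N))) x t) \<longlonglongrightarrow> kern n w m x t" for x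
      by (rule gmom_tendsto_kern[of n w t m x, OF assms])
    have "uniform_limit S (\<lambda>N x. gmom n w (m + 1) (inverse (real (Suc N))) (fst (x, t)) (snd (x, t)))
       (\<lambda>x. kern n w (m + 1) (fst (x, t)) (snd (x, t))) sequentially"
      by (rule uniform_limit_compose'[OF gmom_uniform_limit[where n = n and w = w and a = t and b = t and X = "\<bar>x\<bar> + 1" and m = "m + 1", OF assms order_refl]])
        (auto simp: S_def)
    from bounded_linear.uniform_limit[OF bounded_linear_mult_right[of \<i>] this]
    show "uniform_limit S (\<lambda>N x. \<i> * gmom n w (m + 1) (inverse (real (Suc N))) x t) (\<lambda>x. \<i> * kern n w (m + 1) x t) sequentially"
      by (simp only: fst_conv snd_conv)
  qed (simp add: S_def)
  then show ?thesis by (simp only: at_within_interior[OF x])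
qed

lemma kern_has_vector_derivative_t:
  assumes "2 \<le> n" "w n \<noteq> 0" "0 < t"
  shows "((\<lambda>t. kern n w m x t) has_vector_derivative (\<Sum>j=2..n. - \<i> * of_real (w j) * kern n w (m + j) x t)) (at t)"
proof -
  define S where "S = {t / 2..2 * t}"
  have t: "t \<in> interior S" using assms by (auto simp: S_def)
  have S0: "0 < s" if "s \<in> S" for s using that assms by (auto simp: S_def)
  have ab: "0 < t / 2" "t / 2 \<le> 2 * t" using assms by auto
  have "((\<lambda>t. kern n w m x t) has_vector_derivative (\<Sum>j=2..n. - \<i> * of_real (w j) * kern n w (m + j) x t)) (at t within S)"
  proof (rule has_vector_derivative_uniform_limit[where f = "\<lambda>N t. gmom n w m (inverse (real (Suc N))) x t"
        and f' = "\<lambda>N t. \<Sum>j=2..n. - \<i> * of_real (w j) * gmom n w (m + j) (inverse (real (Suc N))) x t"])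
    show "t \<in> S" using t interior_subset by blast
    show "((\<lambda>t. gmom n w m (inverse (real (Suc N))) x t) has_vector_derivative
        (\<Sum>j=2..n. - \<i> * of_real (w j) * gmom n w (m + j) (inverse (real (Suc N))) x t)) (at t within S)" for N t
      by (rule has_vector_derivative_at_within, rule gmom_has_vector_derivative_t) simp
    show "(\<lambda>N. gmom n w m (inverse (real (Suc N))) x s) \<longlonglongrightarrow> kern n w m x s" if "s \<in> S" for s
      by (rule gmom_tendsto_kern[of n w s m x, OF assms(1,2) S0[OF that]])
    have "uniform_limit S (\<lambda>N t. gmom n w (m + j) (inverse (real (Suc N))) (fst (x, t)) (snd (x, t)))
       (\<lambda>t. kern n w (m + j) (fst (x, t)) (snd (x, t))) sequentially" for j
      by (rule uniform_limit_compose'[OF gmom_uniform_limit[where n = n and w = w and a = "t / 2" and b = "2 * t" and X = "\<bar>x\<bar>" and m = "m + j", OF assms(1,2) ab]])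
        (auto simp: S_def)
    from bounded_linear.uniform_limit[OF bounded_linear_mult_right this]
    have "uniform_limit S (\<lambda>N t. - \<i> * of_real (w j) * gmom n w (m + j) (inverse (real (Suc N))) x t)
       (\<lambda>t. - \<i> * of_real (w j) * kern n w (m + j) x t) sequentially" for j
      by (simp only: fst_conv snd_conv)
    then show "uniform_limit S (\<lambda>N t. \<Sum>j=2..n. - \<i> * of_real (w j) * gmom n w (m + j) (inverse (real (Suc N))) x t)
       (\<lambda>t. \<Sum>j=2..n. - \<i> * of_real (w j) * kern n w (m + j) x t) sequentially"
      by (rule uniform_limit_sum)
  qed (simp add: S_def)
  then show ?thesis by (simp only: at_within_interior[OF t])
qed

lemma continuous_on_kern:
  assumes "2 \<le> n" "w n \<noteq> 0"
  shows "continuous_on (UNIV \<times> {0<..}) (\<lambda>z. kern n w m (fst z) (snd z))"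
proof -
  have "isCont (\<lambda>z. kern n w m (fst z) (snd z)) (x, t)" if "0 < t" for x t
  proof (rule continuous_on_interior)
    show "continuous_on ({- (\<bar>x\<bar> + 1)..\<bar>x\<bar> + 1} \<times> {t / 2..2 * t}) (\<lambda>z. kern n w m (fst z) (snd z))"
      using that
      by (intro uniform_limit_theorem[OF _ gmom_uniform_limit[where n = n and w = w and a = "t / 2" and b = "2 * t" and X = "\<bar>x\<bar> + 1" and m = m, OF assms]])
        (auto intro!: always_eventually continuous_on_subset[OF continuous_on_gmom])
    show "(x, t) \<in> interior ({- (\<bar>x\<bar> + 1)..\<bar>x\<bar> + 1} \<times> {t / 2..2 * t})"
      using that by (auto simp: interior_Times)
  qed
  then show ?thesis by (intro continuous_at_imp_continuous_on) auto
qed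

text \<open>The regularizing term of \<open>gmom_ode\<close> disappears in the limit, because the
  moment of order \<open>m + 1\<close> multiplied by \<open>e\<close> converges as well.\<close>

lemma kern_ode:
  assumes "2 \<le> n" "w n \<noteq> 0" "0 < t"
  shows "(\<Sum>j=2..n. of_real (real j * w j * t) * kern n w (m + j - 1) x t) =
    of_real x * kern n w m x t - \<i> * of_real (real m) * kern n w (m - 1) x t"
proof (rule LIMSEQ_unique)
  let ?e = "\<lambda>N. inverse (real (Suc N))"
  note lim = gmom_tendsto_kern[of n w t _ x, OF assms]
  show "(\<lambda>N. \<Sum>j=2..n. of_real (real j * w j * t) * gmom n w (m + j - 1) (?e N) x t)
     \<longlonglongrightarrow> (\<Sum>j=2..n. of_real (real j * w j * t) * kern n w (m + j - 1) x t)"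
    by (intro tendsto_intros lim)
  have "(\<lambda>N. complex_of_real (?e N)) \<longlonglongrightarrow> 0"
    using tendsto_of_real[OF LIMSEQ_inverse_real_of_nat, where 'a = complex] by (simp only: of_real_0)
  then have "(\<lambda>N. of_real x * gmom n w m (?e N) x t - \<i> * of_real (real m) * gmom n w (m - 1) (?e N) x t
      + 2 * \<i> * of_real (?e N) * gmom n w (m + 1) (?e N) x t)
     \<longlonglongrightarrow> of_real x * kern n w m x t - \<i> * of_real (real m) * kern n w (m - 1) x t + 2 * \<i> * 0 * kern n w (m + 1) x t"
    by (intro tendsto_intros lim)
  moreover have "(\<Sum>j=2..n. of_real (real j * w j * t) * gmom n w (m + j - 1) (?e N) x t) =
      of_real x * gmom n w m (?e N) x t - \<i> * of_real (real m) * gmom n w (m - 1) (?e N) x t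
      + 2 * \<i> * of_real (?e N) * gmom n w (m + 1) (?e N) x t" for N
    by (rule gmom_ode) simp
  ultimately show "(\<lambda>N. \<Sum>j=2..n. of_real (real j * w j * t) * gmom n w (m + j - 1) (?e N) x t)
     \<longlonglongrightarrow> of_real x * kern n w m x t - \<i> * of_real (real m) * kern n w (m - 1) x t"
    by (simp only: mult_zero_left mult_zero_right add_0_right)
qed

text \<open>Gaussian summation and symmetric truncation of the conditionally convergent integral
  agree, since the tail estimate is uniform in \<open>e\<close>. This transfers the growth bounds of
  truncated integrals to \<open>kern\<close>, and for \<open>m = 0\<close> it links
  \<open>kern\<close> with the truncated inversion integrals.\<close>

lemma trunc_tendsto_kern:
  assumes n: "2 \<le> n" and wn: "w n \<noteq> 0" and t: "0 < t" and m: "m + 2 \<le> n"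
  shows "(\<lambda>N. integral {- real N..real N} (osc n w m 0 x t)) \<longlonglongrightarrow> kern n w m x t"
proof -
  obtain C where C: "0 \<le> C" and "\<And>X. \<exists>\<rho>\<ge>1. \<forall>x s R R' e. \<bar>x\<bar> \<le> X \<longrightarrow> t \<le> s \<longrightarrow> s \<le> t \<longrightarrow> 0 \<le> e \<longrightarrow> \<rho> \<le> R \<longrightarrow> R \<le> R' \<longrightarrow>
     norm (integral {- R'..R'} (osc n w m e x s) - integral {- R..R} (osc n w m e x s)) \<le> C / R"
    by (rule osc_tail[of n w t t m, OF n wn t order_refl m]) (rule that)
  from this(2)[of "\<bar>x\<bar>"] obtain \<rho> where \<rho>: "1 \<le> \<rho>" and tail: "\<And>R R' e. 0 \<le> e \<Longrightarrow> \<rho> \<le> R \<Longrightarrow> R \<le> R' \<Longrightarrow>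
     norm (integral {- R'..R'} (osc n w m e x t) - integral {- R..R} (osc n w m e x t)) \<le> C / R"
    by blast
  \<comment> \<open>With \<open>R\<close> fixed, \<open>e\<close> tends to 0 in the bound
    \<open>C / R\<close> for the distance between \<open>gmom\<close> and its truncation.\<close>
  have le: "norm (integral {- R..R} (osc n w m 0 x t) - kern n w m x t) \<le> C / R" if R: "\<rho> \<le> R" for R
  proof (rule Lim_bounded[where M = 0])
    let ?e = "\<lambda>N. inverse (real (Suc N))"
    have R0: "0 \<le> R" using R \<rho> by simp
    have "(\<lambda>N. integral {- R..R} (osc n w m (?e N) x t) - integral {- R..R} (osc n w m 0 x t)) \<longlonglongrightarrow> 0"
    proof (rule Lim_null_comparison)
      have "(\<lambda>N. 2 * R ^ (m + 3) * ?e N) \<longlonglongrightarrow> 2 * R ^ (m + 3) * 0"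
        by (intro tendsto_mult tendsto_const LIMSEQ_inverse_real_of_nat)
      then show "(\<lambda>N. 2 * R ^ (m + 3) * ?e N) \<longlonglongrightarrow> 0" by (simp only: mult_zero_right)
      show "\<forall>\<^sub>F N in sequentially. norm (integral {- R..R} (osc n w m (?e N) x t) - integral {- R..R} (osc n w m 0 x t)) \<le> 2 * R ^ (m + 3) * ?e N"
        using norm_integral_osc_diff_le[OF R0, of "?e N" 0 n w m x t for N] by (intro always_eventually allI) simp
    qed
    then have "(\<lambda>N. integral {- R..R} (osc n w m (?e N) x t)) \<longlonglongrightarrow> integral {- R..R} (osc n w m 0 x t)"
      by (rule Lim_transform[OF tendsto_const])
    then show "(\<lambda>N. norm (integral {- R..R} (osc n w m (?e N) x t) - gmom n w m (?e N) x t))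
        \<longlonglongrightarrow> norm (integral {- R..R} (osc n w m 0 x t) - kern n w m x t)"
      by (intro tendsto_intros gmom_tendsto_kern[of n w t m x, OF n wn t])
    have "norm (gmom n w m (?e N) x t - integral {- R..R} (osc n w m (?e N) x t)) \<le> C / R" for N
      by (rule gmom_trunc_le) (auto intro!: tail R)
    then show "\<forall>N\<ge>0. norm (integral {- R..R} (osc n w m (?e N) x t) - gmom n w m (?e N) x t) \<le> C / R"
      by (simp add: norm_minus_commute)
  qed
  have "(\<lambda>N. integral {- real N..real N} (osc n w m 0 x t) - kern n w m x t) \<longlonglongrightarrow> 0"
  proof (rule Lim_null_comparison)
    show "(\<lambda>N. C / real N) \<longlonglongrightarrow> 0" by (rule lim_const_over_n)
    obtain N0 :: nat where "\<rho> \<le> real N0" using real_arch_simple by blast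
    then show "\<forall>\<^sub>F N in sequentially. norm (integral {- real N..real N} (osc n w m 0 x t) - kern n w m x t) \<le> C / real N"
      unfolding eventually_sequentially by (intro exI[of _ N0]) (auto intro!: le)
  qed
  then show ?thesis by (rule LIM_zero_cancel)
qed

section \<open>Growth of the moments of all orders\<close>

lemma growth_exponent_mono: "2 \<le> n \<Longrightarrow> i \<le> m \<Longrightarrow> growth_exponent n i \<le> growth_exponent n m"
  unfolding growth_exponent_def by (intro divide_right_mono) auto

text \<open>The increment 1 matches the single factor \<open>x\<close> in \<open>kern_ode\<close>,
  so the recursion reproduces the right growth at every order.\<close>

lemma growth_exponent_shift: "2 \<le> n \<Longrightarrow> growth_exponent n (m + n - 1) = growth_exponent n m + 1"
  unfolding growth_exponent_def by (simp add: of_nat_diff field_simps)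

text \<open>Up to order \<open>n - 2\<close> the bound is inherited from the truncated integrals.
  Beyond, \<open>kern_ode\<close> is solved for its highest moment: \<open>x\<close> times the
  moment of order \<open>m\<close> has exactly the admissible growth, and the exponents of the
  remaining terms are no larger.\<close>

lemma kern_growth:
  assumes n: "2 \<le> n" and wn: "w n \<noteq> 0" and ab: "0 < a" "a \<le> b"
  shows "\<exists>C\<ge>0. \<forall>x t. a \<le> t \<longrightarrow> t \<le> b \<longrightarrow> norm (kern n w m x t) \<le> C * (1 + \<bar>x\<bar>) powr growth_exponent n m"
proof (induction m rule: less_induct)
  case (less M)
  show ?case
  proof (cases "M + 2 \<le> n")
    case True
    obtain C where C: "0 \<le> C" and le: "\<And>x t R. a \<le> t \<Longrightarrow> t \<le> b \<Longrightarrow> 0 \<le> R \<Longrightarrow>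
       norm (integral {- R..R} (osc n w M 0 x t)) \<le> C * (1 + \<bar>x\<bar>) powr growth_exponent n M"
      by (rule osc_growth[of n w a b M, OF n wn ab True]) (rule that)
    have "norm (kern n w M x t) \<le> C * (1 + \<bar>x\<bar>) powr growth_exponent n M" if t: "a \<le> t" "t \<le> b" for x t
    proof (rule Lim_bounded[where M = 0])
      show "(\<lambda>N. norm (integral {- real N..real N} (osc n w M 0 x t))) \<longlonglongrightarrow> norm (kern n w M x t)"
        using t ab by (intro tendsto_norm trunc_tendsto_kern[of n w t M x] n wn True) auto
    qed (auto intro: le t)
    with C show ?thesis by blast
  next
    case False
    define m where "m = M + 1 - n"
    have M: "M = m + n - 1" using False n by (simp add: m_def)
    have lt: "m < M" "m - 1 < M" "\<And>j. j \<in> {2..<n} \<Longrightarrow> m + j - 1 < M" using M n by auto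
    \<comment> \<open>The induction hypothesis is existential; one constant is fixed for each lower
      order so that finitely many of them can be combined in \<open>E\<close>.\<close>
    define D where "D i = (SOME C. C \<ge> 0 \<and> (\<forall>x t. a \<le> t \<longrightarrow> t \<le> b \<longrightarrow> norm (kern n w i x t) \<le> C * (1 + \<bar>x\<bar>) powr growth_exponent n i))" for i
    have D: "0 \<le> D i" "\<And>x t. a \<le> t \<Longrightarrow> t \<le> b \<Longrightarrow> norm (kern n w i x t) \<le> D i * (1 + \<bar>x\<bar>) powr growth_exponent n i"
      if "i < M" for i
      using someI_ex[OF less[OF that, unfolded Bex_def]] unfolding D_def[symmetric] by auto
    define p where "p = growth_exponent n M"
    have p: "p = growth_exponent n m + 1" using growth_exponent_shift[OF n] by (simp add: p_def M)
    have Dp: "norm (kern n w i x t) \<le> D i * (1 + \<bar>x\<bar>) powr p" if "i < M" "a \<le> t" "t \<le> b" for i x t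
    proof -
      have "D i * (1 + \<bar>x\<bar>) powr growth_exponent n i \<le> D i * (1 + \<bar>x\<bar>) powr p"
        using D(1)[OF that(1)] growth_exponent_mono[OF n, of i M] that unfolding p_def
        by (intro mult_left_mono powr_mono) auto
      then show ?thesis using D(2)[OF that, of x] by linarith
    qed
    have Dx: "norm (of_real x * kern n w m x t) \<le> D m * (1 + \<bar>x\<bar>) powr p" if "a \<le> t" "t \<le> b" for x t
    proof -
      have "norm (of_real x * kern n w m x t) \<le> (1 + \<bar>x\<bar>) * (D m * (1 + \<bar>x\<bar>) powr growth_exponent n m)"
        unfolding norm_mult using D[OF lt(1)] that by (intro mult_mono) auto
      also have "\<dots> = D m * (1 + \<bar>x\<bar>) powr p" unfolding p by (simp add: powr_add)
      finally show ?thesis .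
    qed
    \<comment> \<open>A lower bound, uniform for \<open>t >= a\<close>, of the coefficient
      \<open>n * \<bar>w n\<bar> * t\<close> by which the equation is divided.\<close>
    define A where "A = real n * \<bar>w n\<bar> * a"
    have A: "0 < A" using n wn ab by (simp add: A_def)
    define E where "E = D m + real m * D (m - 1) + (\<Sum>j=2..<n. real j * \<bar>w j\<bar> * b * D (m + j - 1))"
    have E: "0 \<le> E" unfolding E_def using D(1) lt ab by (intro add_nonneg_nonneg sum_nonneg mult_nonneg_nonneg) auto
    have "norm (kern n w M x t) \<le> E / A * (1 + \<bar>x\<bar>) powr p" if t: "a \<le> t" "t \<le> b" for x t
    proof -
      have t0: "0 < t" using t ab by simp
      have "(\<Sum>j=2..n. of_real (real j * w j * t) * kern n w (m + j - 1) x t) =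
         of_real (real n * w n * t) * kern n w M x t + (\<Sum>j=2..<n. of_real (real j * w j * t) * kern n w (m + j - 1) x t)"
        using n M by (simp add: sum.last_plus)
      with kern_ode[of n w t m x, OF n wn t0]
      have eq: "of_real (real n * w n * t) * kern n w M x t = of_real x * kern n w m x t - \<i> * of_real (real m) * kern n w (m - 1) x t
        - (\<Sum>j=2..<n. of_real (real j * w j * t) * kern n w (m + j - 1) x t)"
        by (simp add: algebra_simps)
      have "norm (of_real (real n * w n * t) * kern n w M x t) \<le> norm (of_real x * kern n w m x t) + norm (\<i> * of_real (real m) * kern n w (m - 1) x t)
        + (\<Sum>j=2..<n. norm (of_real (real j * w j * t) * kern n w (m + j - 1) x t))"
        unfolding eq by (intro order_trans[OF norm_triangle_ineq4] add_mono norm_triangle_ineq4 norm_sum)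
      also have "\<dots> \<le> D m * (1 + \<bar>x\<bar>) powr p + real m * (D (m - 1) * (1 + \<bar>x\<bar>) powr p)
        + (\<Sum>j=2..<n. real j * \<bar>w j\<bar> * b * (D (m + j - 1) * (1 + \<bar>x\<bar>) powr p))"
      proof (intro add_mono sum_mono Dx t)
        show "norm (\<i> * of_real (real m) * kern n w (m - 1) x t) \<le> real m * (D (m - 1) * (1 + \<bar>x\<bar>) powr p)"
          using Dp[OF lt(2) t, of x] by (simp add: norm_mult mult_left_mono)
        show "norm (of_real (real j * w j * t) * kern n w (m + j - 1) x t) \<le> real j * \<bar>w j\<bar> * b * (D (m + j - 1) * (1 + \<bar>x\<bar>) powr p)"
          if "j \<in> {2..<n}" for j
        proof -
          have "norm (complex_of_real (real j * w j * t)) = real j * \<bar>w j\<bar> * t"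
            using t0 by (simp add: norm_mult)
          moreover have "real j * \<bar>w j\<bar> * t \<le> real j * \<bar>w j\<bar> * b" using t by (intro mult_left_mono) auto
          ultimately show ?thesis
            unfolding norm_mult[of "complex_of_real (real j * w j * t)"]
            using Dp[OF lt(3)[OF that] t, of x] ab by (intro mult_mono) auto
        qed
      qed
      also have "\<dots> = E * (1 + \<bar>x\<bar>) powr p"
        by (simp add: E_def distrib_right sum_distrib_right mult.assoc)
      finally have "norm (complex_of_real (real n * w n * t) * kern n w M x t) \<le> E * (1 + \<bar>x\<bar>) powr p" .
      moreover have "norm (complex_of_real (real n * w n * t)) = real n * \<bar>w n\<bar> * t"
        using t0 by (simp add: norm_mult)
      moreover have "A \<le> real n * \<bar>w n\<bar> * t" unfolding A_def using t by (intro mult_left_mono) auto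
      ultimately have "A * norm (kern n w M x t) \<le> E * (1 + \<bar>x\<bar>) powr p"
        using mult_right_mono[of A "real n * \<bar>w n\<bar> * t" "norm (kern n w M x t)"] unfolding norm_mult by simp
      then show ?thesis using A by (simp add: field_simps)
    qed
    then show ?thesis unfolding p_def using E A by (intro exI[of _ "E / A"]) auto
  qed
qed

section \<open>Convolution with the fundamental solution\<close>

text \<open>The class of kernels that may be convolved with data of weight exponent
  \<open>l\<close>. The bound is uniform only for \<open>t\<close> in compact subsets of the open
  half-line, which suffices because continuity and differentiability are local.\<close>

definition tame :: "real \<Rightarrow> (real \<Rightarrow> real \<Rightarrow> complex) \<Rightarrow> bool" where
  "tame l G \<longleftrightarrow> continuous_on (UNIV \<times> {0<..}) (\<lambda>z. G (fst z) (snd z)) \<and>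
     (\<forall>a b. 0 < a \<longrightarrow> a \<le> b \<longrightarrow> (\<exists>C\<ge>0. \<forall>x t. a \<le> t \<longrightarrow> t \<le> b \<longrightarrow> norm (G x t) \<le> C * (1 + \<bar>x\<bar>) powr l))"

lemma tame_kern:
  assumes "2 \<le> n" "w n \<noteq> 0" "growth_exponent n m \<le> l"
  shows "tame l (kern n w m)"
  unfolding tame_def
proof (intro conjI allI impI)
  show "continuous_on (UNIV \<times> {0<..}) (\<lambda>z. kern n w m (fst z) (snd z))"
    by (rule continuous_on_kern[of n w m, OF assms(1,2)])
  fix a b :: real assume ab: "0 < a" "a \<le> b"
  obtain C where C: "0 \<le> C" and le: "\<And>x t. a \<le> t \<Longrightarrow> t \<le> b \<Longrightarrow> norm (kern n w m x t) \<le> C * (1 + \<bar>x\<bar>) powr growth_exponent n m"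
    using kern_growth[of n w a b m, OF assms(1,2) ab] by blast
  have "norm (kern n w m x t) \<le> C * (1 + \<bar>x\<bar>) powr l" if "a \<le> t" "t \<le> b" for x t
  proof -
    have "C * (1 + \<bar>x\<bar>) powr growth_exponent n m \<le> C * (1 + \<bar>x\<bar>) powr l"
      using C assms(3) by (intro mult_left_mono powr_mono) auto
    then show ?thesis using le[OF that, of x] by linarith
  qed
  with C show "\<exists>C\<ge>0. \<forall>x t. a \<le> t \<longrightarrow> t \<le> b \<longrightarrow> norm (kern n w m x t) \<le> C * (1 + \<bar>x\<bar>) powr l"
    by blast
qed

lemma tame_cmult:
  assumes "tame l G"
  shows "tame l (\<lambda>x t. c * G x t)"
  unfolding tame_def
proof (intro conjI allI impI)
  show "continuous_on (UNIV \<times> {0<..}) (\<lambda>z. c * G (fst z) (snd z))"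
    using assms unfolding tame_def by (intro continuous_on_mult_left) auto
  fix a b :: real assume ab: "0 < a" "a \<le> b"
  then obtain C where C: "0 \<le> C" and le: "\<And>x t. a \<le> t \<Longrightarrow> t \<le> b \<Longrightarrow> norm (G x t) \<le> C * (1 + \<bar>x\<bar>) powr l"
    using assms unfolding tame_def by blast
  have "norm (c * G x t) \<le> (norm c * C) * (1 + \<bar>x\<bar>) powr l" if "a \<le> t" "t \<le> b" for x t
    using mult_left_mono[OF le[OF that, of x], of "norm c"] by (simp add: norm_mult mult.assoc)
  then show "\<exists>C\<ge>0. \<forall>x t. a \<le> t \<longrightarrow> t \<le> b \<longrightarrow> norm (c * G x t) \<le> C * (1 + \<bar>x\<bar>) powr l"
    using C by (intro exI[of _ "norm c * C"]) auto
qed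

lemma tame_add:
  assumes "tame l G" "tame l H"
  shows "tame l (\<lambda>x t. G x t + H x t)"
  unfolding tame_def
proof (intro conjI allI impI)
  show "continuous_on (UNIV \<times> {0<..}) (\<lambda>z. G (fst z) (snd z) + H (fst z) (snd z))"
    using assms unfolding tame_def by (intro continuous_on_add) auto
  fix a b :: real assume ab: "0 < a" "a \<le> b"
  then obtain C where C: "0 \<le> C" and G: "\<And>x t. a \<le> t \<Longrightarrow> t \<le> b \<Longrightarrow> norm (G x t) \<le> C * (1 + \<bar>x\<bar>) powr l"
    using assms(1) unfolding tame_def by blast
  obtain D where D: "0 \<le> D" and H: "\<And>x t. a \<le> t \<Longrightarrow> t \<le> b \<Longrightarrow> norm (H x t) \<le> D * (1 + \<bar>x\<bar>) powr l"
    using assms(2) ab unfolding tame_def by blast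
  have "norm (G x t + H x t) \<le> (C + D) * (1 + \<bar>x\<bar>) powr l" if "a \<le> t" "t \<le> b" for x t
    using norm_triangle_ineq[of "G x t" "H x t"] G[OF that, of x] H[OF that, of x] by (simp only: distrib_right)
  then show "\<exists>C\<ge>0. \<forall>x t. a \<le> t \<longrightarrow> t \<le> b \<longrightarrow> norm (G x t + H x t) \<le> C * (1 + \<bar>x\<bar>) powr l"
    using C D by (intro exI[of _ "C + D"]) auto
qed

lemma tame_0: "tame l (\<lambda>x t. 0)"
  unfolding tame_def by (auto intro!: exI[of _ 0])

lemma tame_sum:
  assumes "\<And>i. i \<in> I \<Longrightarrow> tame l (G i)"
  shows "tame l (\<lambda>x t. \<Sum>i\<in>I. G i x t)"
  using assms by (induction I rule: infinite_finite_induct) (auto simp: tame_0 tame_add)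

text \<open>The \<open>i\<close>-th time derivative of \<open>kern n w m\<close>, written through
  moments: each time derivative brings down a factor \<open>- \<i> * \<omega>(k)\<close>, which
  raises the order by up to \<open>n\<close>.\<close>

primrec tkern :: "nat \<Rightarrow> (nat \<Rightarrow> real) \<Rightarrow> nat \<Rightarrow> nat \<Rightarrow> real \<Rightarrow> real \<Rightarrow> complex" where
  "tkern n w 0 m = kern n w m"
| "tkern n w (Suc i) m = (\<lambda>x t. \<Sum>j=2..n. - \<i> * of_real (w j) * tkern n w i (m + j) x t)"

text \<open>Growth exponents increase with the order, so the highest moment involved, of order
  \<open>m + n * i\<close>, decides.\<close>

lemma tame_tkern:
  assumes "2 \<le> n" "w n \<noteq> 0" "growth_exponent n (m + n * i) \<le> l"
  shows "tame l (tkern n w i m)"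
  using assms(3)
proof (induction i arbitrary: m)
  case 0
  then show ?case using tame_kern[of n w m l, OF assms(1,2)] by simp
next
  case (Suc i)
  show ?case unfolding tkern.simps
  proof (intro tame_sum tame_cmult Suc.IH)
    fix j assume "j \<in> {2..n}"
    then have "growth_exponent n (m + j + n * i) \<le> growth_exponent n (m + n * Suc i)"
      by (intro growth_exponent_mono assms) auto
    with Suc.prems show "growth_exponent n (m + j + n * i) \<le> l" by linarith
  qed
qed

lemma tkern_has_vector_derivative_t:
  assumes "2 \<le> n" "w n \<noteq> 0" "0 < t"
  shows "((\<lambda>t. tkern n w i m x t) has_vector_derivative tkern n w (Suc i) m x t) (at t)"
proof (induction i arbitrary: m)
  case 0
  show ?case using kern_has_vector_derivative_t[of n w t m x, OF assms] by simp
next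
  case (Suc i)
  have "((\<lambda>t. \<Sum>j=2..n. - \<i> * of_real (w j) * tkern n w i (m + j) x t) has_vector_derivative
      (\<Sum>j=2..n. - \<i> * of_real (w j) * tkern n w (Suc i) (m + j) x t)) (at t)"
    by (intro has_vector_derivative_sum has_vector_derivative_mult_right Suc.IH)
  then show ?case by (simp only: tkern.simps)
qed

section \<open>Continuity and differentiability of the convolution integrals\<close>

text \<open>Peetre's inequality: \<open>1 + |x - y| <= (1 + |x|) (1 + |y|)\<close> for nonnegative
  exponents, and the same applied to \<open>y = x - (x - y)\<close> for negative ones. It moves the
  weight from \<open>x - y\<close> to \<open>y\<close> at a cost that is bounded for bounded
  \<open>x\<close>.\<close>

lemma one_plus_abs_diff_powr_le:
  fixes l x y :: real
  shows "(1 + \<bar>x - y\<bar>) powr l \<le> (1 + \<bar>x\<bar>) powr \<bar>l\<bar> * (1 + \<bar>y\<bar>) powr l"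
proof (cases "0 \<le> l")
  case True
  have "1 + \<bar>x - y\<bar> \<le> (1 + \<bar>x\<bar>) * (1 + \<bar>y\<bar>)"
  proof -
    have "(1 + \<bar>x\<bar>) * (1 + \<bar>y\<bar>) = 1 + \<bar>x\<bar> + \<bar>y\<bar> + \<bar>x\<bar> * \<bar>y\<bar>" by (simp add: distrib_left distrib_right)
    moreover have "0 \<le> \<bar>x\<bar> * \<bar>y\<bar>" by simp
    ultimately show ?thesis by linarith
  qed
  then have "(1 + \<bar>x - y\<bar>) powr l \<le> ((1 + \<bar>x\<bar>) * (1 + \<bar>y\<bar>)) powr l"
    using True by (intro powr_mono2) auto
  then show ?thesis using True by (simp add: powr_mult)
next
  case False
  have "1 + \<bar>y\<bar> \<le> (1 + \<bar>x\<bar>) * (1 + \<bar>x - y\<bar>)"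
  proof -
    have "(1 + \<bar>x\<bar>) * (1 + \<bar>x - y\<bar>) = 1 + \<bar>x\<bar> + \<bar>x - y\<bar> + \<bar>x\<bar> * \<bar>x - y\<bar>" by (simp add: distrib_left distrib_right)
    moreover have "0 \<le> \<bar>x\<bar> * \<bar>x - y\<bar>" by simp
    ultimately show ?thesis by linarith
  qed
  then have "((1 + \<bar>x\<bar>) * (1 + \<bar>x - y\<bar>)) powr l \<le> (1 + \<bar>y\<bar>) powr l"
    using False by (intro powr_mono2') auto
  then have "(1 + \<bar>x\<bar>) powr \<bar>l\<bar> * ((1 + \<bar>x\<bar>) powr l * (1 + \<bar>x - y\<bar>) powr l) \<le> (1 + \<bar>x\<bar>) powr \<bar>l\<bar> * (1 + \<bar>y\<bar>) powr l"
    by (intro mult_left_mono) (auto simp: powr_mult)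
  moreover have "(1 + \<bar>x\<bar>) powr \<bar>l\<bar> * ((1 + \<bar>x\<bar>) powr l * (1 + \<bar>x - y\<bar>) powr l) = (1 + \<bar>x - y\<bar>) powr l"
    using False by (simp add: mult.assoc[symmetric] powr_add[symmetric])
  ultimately show ?thesis by simp
qed

definition conv :: "(real \<Rightarrow> complex) \<Rightarrow> (real \<Rightarrow> real \<Rightarrow> complex) \<Rightarrow> real \<Rightarrow> real \<Rightarrow> complex" where
  "conv f G x t = (LINT y|lebesgue. f y * G (x - y) t)"

lemma tame_borel_measurable:
  assumes "tame l G" "0 < t"
  shows "(\<lambda>y. G (x - y) t) \<in> borel_measurable borel"
proof -
  have "continuous_on (UNIV \<times> {0<..}) (\<lambda>z. G (fst z) (snd z))" using assms(1) by (simp add: tame_def)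
  moreover have "continuous_on UNIV (\<lambda>y. (x - y, t))" by (intro continuous_intros)
  moreover have "range (\<lambda>y. (x - y, t)) \<subseteq> UNIV \<times> {0<..}" using assms(2) by auto
  ultimately have "continuous_on UNIV (\<lambda>y. G (fst (x - y, t)) (snd (x - y, t)))" by (rule continuous_on_compose2)
  then show ?thesis by (simp only: fst_conv snd_conv borel_measurable_continuous_onI)
qed

lemma conv_measurable:
  assumes "tame l G" "weighted_integrable l f" "0 < t"
  shows "(\<lambda>y. f y * G (x - y) t) \<in> borel_measurable lebesgue"
proof -
  have "(\<lambda>y. G (x - y) t) \<in> borel_measurable lebesgue"
    by (intro measurable_completion) (simp add: tame_borel_measurable[OF assms(1,3)])
  moreover have "f \<in> borel_measurable lebesgue" using assms(2) by (simp add: weighted_integrable_def)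
  ultimately show ?thesis by (rule borel_measurable_times[rotated])
qed

text \<open>For \<open>x\<close> and \<open>t\<close> in a compact box the majorant is a multiple of
  the integrand in \<open>weighted_integrable\<close>; it serves integrability, continuity and both
  kinds of derivative.\<close>

lemma tame_majorant:
  assumes "tame l G" "0 < a" "a \<le> b"
  obtains C where "0 \<le> C" and "\<And>x y t. \<bar>x\<bar> \<le> X \<Longrightarrow> a \<le> t \<Longrightarrow> t \<le> b \<Longrightarrow>
    norm (f y * G (x - y) t) \<le> C * ((1 + \<bar>y\<bar>) powr l * norm (f y))"
proof -
  obtain C where C: "0 \<le> C" and le: "\<And>x t. a \<le> t \<Longrightarrow> t \<le> b \<Longrightarrow> norm (G x t) \<le> C * (1 + \<bar>x\<bar>) powr l"
    using assms unfolding tame_def by blast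
  have "norm (f y * G (x - y) t) \<le> (C * (1 + X) powr \<bar>l\<bar>) * ((1 + \<bar>y\<bar>) powr l * norm (f y))"
    if x: "\<bar>x\<bar> \<le> X" and t: "a \<le> t" "t \<le> b" for x y t
  proof -
    have "norm (G (x - y) t) \<le> C * (1 + \<bar>x - y\<bar>) powr l" by (rule le[OF t])
    also have "\<dots> \<le> C * ((1 + \<bar>x\<bar>) powr \<bar>l\<bar> * (1 + \<bar>y\<bar>) powr l)"
      using C by (intro mult_left_mono one_plus_abs_diff_powr_le)
    also have "\<dots> \<le> C * ((1 + X) powr \<bar>l\<bar> * (1 + \<bar>y\<bar>) powr l)"
      using C x by (intro mult_left_mono mult_right_mono powr_mono2) auto
    finally have "norm (f y) * norm (G (x - y) t) \<le> norm (f y) * (C * ((1 + X) powr \<bar>l\<bar> * (1 + \<bar>y\<bar>) powr l))"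
      by (intro mult_left_mono) auto
    then show ?thesis by (simp add: norm_mult mult_ac)
  qed
  moreover have "0 \<le> C * (1 + X) powr \<bar>l\<bar>" using C by simp
  ultimately show ?thesis by (rule that[rotated])
qed

lemma conv_integrable:
  assumes "tame l G" "weighted_integrable l f" "0 < t"
  shows "integrable lebesgue (\<lambda>y. f y * G (x - y) t)"
proof -
  obtain C where C: "0 \<le> C" and le: "\<And>z y s. \<bar>z\<bar> \<le> \<bar>x\<bar> \<Longrightarrow> t \<le> s \<Longrightarrow> s \<le> t \<Longrightarrow>
    norm (f y * G (z - y) s) \<le> C * ((1 + \<bar>y\<bar>) powr l * norm (f y))"
    by (rule tame_majorant[OF assms(1) assms(3) order_refl]) (rule that)
  show ?thesis
  proof (rule Bochner_Integration.integrable_bound)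
    show "integrable lebesgue (\<lambda>y. C * ((1 + \<bar>y\<bar>) powr l * norm (f y)))"
      using assms(2) unfolding weighted_integrable_def by (intro integrable_mult_right) auto
    show "(\<lambda>y. f y * G (x - y) t) \<in> borel_measurable lebesgue" by (rule conv_measurable[OF assms])
    show "AE y in lebesgue. norm (f y * G (x - y) t) \<le> norm (C * ((1 + \<bar>y\<bar>) powr l * norm (f y)))"
    proof (rule AE_I2)
      fix y
      have "norm (f y * G (x - y) t) \<le> C * ((1 + \<bar>y\<bar>) powr l * norm (f y))" by (rule le) auto
      also have "\<dots> \<le> norm (C * ((1 + \<bar>y\<bar>) powr l * norm (f y)))" by simp
      finally show "norm (f y * G (x - y) t) \<le> norm (C * ((1 + \<bar>y\<bar>) powr l * norm (f y)))" .
    qed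
  qed
qed

lemma continuous_on_conv:
  assumes G: "tame l G" and f: "weighted_integrable l f"
  shows "continuous_on (UNIV \<times> {0<..}) (\<lambda>z. conv f G (fst z) (snd z))"
proof -
  have "isCont (\<lambda>z. conv f G (fst z) (snd z)) (x, t)" if t: "0 < t" for x t
  proof (rule continuous_on_interior)
    let ?K = "{- (\<bar>x\<bar> + 1)..\<bar>x\<bar> + 1} \<times> {t / 2..2 * t}"
    have K0: "0 < snd z" if "z \<in> ?K" for z using that t by auto
    have ab: "0 < t / 2" "t / 2 \<le> 2 * t" using t by auto
    obtain C where C: "0 \<le> C" and le: "\<And>z y s. \<bar>z\<bar> \<le> \<bar>x\<bar> + 1 \<Longrightarrow> t / 2 \<le> s \<Longrightarrow> s \<le> 2 * t \<Longrightarrow>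
      norm (f y * G (z - y) s) \<le> C * ((1 + \<bar>y\<bar>) powr l * norm (f y))"
      by (rule tame_majorant[OF G ab]) (rule that)
    show "continuous_on ?K (\<lambda>z. conv f G (fst z) (snd z))"
      unfolding conv_def
    proof (rule continuous_on_lebesgue_integral)
      show "continuous_on ?K (\<lambda>z. f y * G (fst z - y) (snd z))" for y
      proof (intro continuous_on_mult_left)
        have "continuous_on (UNIV \<times> {0<..}) (\<lambda>z. G (fst z) (snd z))" using G by (simp add: tame_def)
        moreover have "continuous_on ?K (\<lambda>z. (fst z - y, snd z))" by (intro continuous_intros)
        moreover have "(\<lambda>z. (fst z - y, snd z)) ` ?K \<subseteq> UNIV \<times> {0<..}" using K0 by blast
        ultimately have "continuous_on ?K (\<lambda>z. G (fst (fst z - y, snd z)) (snd (fst z - y, snd z)))" by (rule continuous_on_compose2)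
        then show "continuous_on ?K (\<lambda>z. G (fst z - y) (snd z))" by (simp only: fst_conv snd_conv)
      qed
      show "(\<lambda>y. f y * G (fst z - y) (snd z)) \<in> borel_measurable lebesgue" if "z \<in> ?K" for z
        by (rule conv_measurable[OF G f K0[OF that]])
      show "norm (f y * G (fst z - y) (snd z)) \<le> C * ((1 + \<bar>y\<bar>) powr l * norm (f y))" if "z \<in> ?K" for z y
        using that by (intro le) (auto simp: abs_le_iff)
      show "integrable lebesgue (\<lambda>y. C * ((1 + \<bar>y\<bar>) powr l * norm (f y)))"
        using f unfolding weighted_integrable_def by (intro integrable_mult_right) auto
    qed
    show "(x, t) \<in> interior ?K" using t by (auto simp: interior_Times)
  qed
  then show ?thesis by (intro continuous_at_imp_continuous_on) auto
qed

lemma conv_has_vector_derivative_x: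
  assumes G: "tame l G" and G': "tame l G'" and f: "weighted_integrable l f" and t: "0 < t"
    and deriv: "\<And>x. ((\<lambda>x. G x t) has_vector_derivative G' x t) (at x)"
  shows "((\<lambda>x. conv f G x t) has_vector_derivative conv f G' x t) (at x)"
proof -
  obtain C where C: "0 \<le> C" and le: "\<And>z y s. \<bar>z\<bar> \<le> \<bar>x\<bar> + 1 \<Longrightarrow> t \<le> s \<Longrightarrow> s \<le> t \<Longrightarrow>
      norm (f y * G' (z - y) s) \<le> C * ((1 + \<bar>y\<bar>) powr l * norm (f y))"
    by (rule tame_majorant[OF G' t order_refl]) (rule that)
  show ?thesis unfolding conv_def
  proof (rule has_vector_derivative_lebesgue_integral[where S = "{- (\<bar>x\<bar> + 1)<..<\<bar>x\<bar> + 1}"])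
    show "((\<lambda>x. f y * G (x - y) t) has_vector_derivative f y * G' (x - y) t) (at x)" for x y
    proof (rule has_vector_derivative_mult_right)
      have "((\<lambda>x. x - y) has_vector_derivative 1) (at x)"
        by (auto intro!: derivative_eq_intros)
      from vector_diff_chain_at[OF this deriv]
      show "((\<lambda>x. G (x - y) t) has_vector_derivative G' (x - y) t) (at x)" by (simp add: comp_def)
    qed
    show "integrable lebesgue (\<lambda>y. f y * G (x - y) t)" for x by (rule conv_integrable[OF G f t])
    show "(\<lambda>y. f y * G' (x - y) t) \<in> borel_measurable lebesgue" by (rule conv_measurable[OF G' f t])
    show "norm (f y * G' (z - y) t) \<le> C * ((1 + \<bar>y\<bar>) powr l * norm (f y))" if "z \<in> {- (\<bar>x\<bar> + 1)<..<\<bar>x\<bar> + 1}" for z y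
      using that by (intro le) (auto simp: abs_le_iff)
    show "integrable lebesgue (\<lambda>y. C * ((1 + \<bar>y\<bar>) powr l * norm (f y)))"
      using f unfolding weighted_integrable_def by (intro integrable_mult_right) auto
  qed auto
qed

lemma conv_has_vector_derivative_t:
  assumes G: "tame l G" and G': "tame l G'" and f: "weighted_integrable l f" and t: "0 < t"
    and deriv: "\<And>x t. 0 < t \<Longrightarrow> ((\<lambda>t. G x t) has_vector_derivative G' x t) (at t)"
  shows "((\<lambda>t. conv f G x t) has_vector_derivative conv f G' x t) (at t)"
proof -
  have ab: "0 < t / 2" "t / 2 \<le> 2 * t" using t by auto
  obtain C where C: "0 \<le> C" and le: "\<And>z y s. \<bar>z\<bar> \<le> \<bar>x\<bar> \<Longrightarrow> t / 2 \<le> s \<Longrightarrow> s \<le> 2 * t \<Longrightarrow>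
      norm (f y * G' (z - y) s) \<le> C * ((1 + \<bar>y\<bar>) powr l * norm (f y))"
    by (rule tame_majorant[OF G' ab]) (rule that)
  have S0: "0 < s" if "s \<in> {t / 2<..<2 * t}" for s using that t by auto
  show ?thesis unfolding conv_def
  proof (rule has_vector_derivative_lebesgue_integral[where S = "{t / 2<..<2 * t}"])
    show "((\<lambda>t. f y * G (x - y) t) has_vector_derivative f y * G' (x - y) s) (at s)" if "s \<in> {t / 2<..<2 * t}" for s y
      by (rule has_vector_derivative_mult_right[OF deriv[OF S0[OF that]]])
    show "integrable lebesgue (\<lambda>y. f y * G (x - y) s)" if "s \<in> {t / 2<..<2 * t}" for s
      by (rule conv_integrable[OF G f S0[OF that]])
    show "(\<lambda>y. f y * G' (x - y) t) \<in> borel_measurable lebesgue" by (rule conv_measurable[OF G' f t])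
    show "norm (f y * G' (x - y) s) \<le> C * ((1 + \<bar>y\<bar>) powr l * norm (f y))" if "s \<in> {t / 2<..<2 * t}" for s y
      using that by (intro le) auto
    show "integrable lebesgue (\<lambda>y. C * ((1 + \<bar>y\<bar>) powr l * norm (f y)))"
      using f unfolding weighted_integrable_def by (intro integrable_mult_right) auto
  qed (use t in auto)
qed

section \<open>Fourier transforms of square integrable functions\<close>

lemma borel_measurable_cis [measurable (raw)]:
  assumes "f \<in> borel_measurable M"
  shows "(\<lambda>x. cis (f x)) \<in> borel_measurable M"
proof -
  have "cis \<in> borel_measurable borel"
    by (rule borel_measurable_continuous_onI) (intro continuous_intros)
  from measurable_compose[OF assms this] show ?thesis .
qed

lemma borel_measurable_cnj [measurable (raw)]:
  assumes "f \<in> borel_measurable M"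
  shows "(\<lambda>x. cnj (f x)) \<in> borel_measurable M"
proof -
  have "cnj \<in> borel_measurable borel"
    by (rule borel_measurable_continuous_onI) (intro continuous_intros)
  from measurable_compose[OF assms this] show ?thesis .
qed

text \<open>In the non-integrable case the Bochner integral is 0 by convention, so the bound
  persists.\<close>

lemma ennreal_norm_integral_le:
  fixes f :: "'a \<Rightarrow> complex"
  shows "ennreal (norm (integral\<^sup>L M f)) \<le> (\<integral>\<^sup>+x. ennreal (norm (f x)) \<partial>M)"
  by (cases "integrable M f") (simp_all add: integral_norm_bound_ennreal not_integrable_integral_eq)

section \<open>Bessel's inequality for the Fourier integral\<close>

lemma Fubini_bounded_kernel:
  fixes f g :: "real \<Rightarrow> complex"
  assumes f: "integrable lborel f" and g: "integrable lborel g"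
    and c [measurable]: "case_prod c \<in> borel_measurable (lborel \<Otimes>\<^sub>M lborel)"
    and c1: "\<And>x y. norm (c x y) \<le> 1"
  shows "(LINT y|lborel. g y * (LINT x|lborel. f x * c x y)) = (LINT x|lborel. f x * (LINT y|lborel. g y * c x y))"
proof -
  have [measurable]: "f \<in> borel_measurable borel" "g \<in> borel_measurable borel"
    using borel_measurable_integrable[OF f] borel_measurable_integrable[OF g] by auto
  have "integrable (lborel \<Otimes>\<^sub>M lborel) (\<lambda>(x, y). norm (f x) * norm (g y))"
  proof (rule lborel_pair.Fubini_integrable)
    have "(LINT y|lborel. norm (case (x, y) of (x, y) \<Rightarrow> norm (f x) * norm (g y))) = norm (f x) * (LINT y|lborel. norm (g y))" for x
      by (simp add: abs_mult)
    then show "integrable lborel (\<lambda>x. LINT y|lborel. norm (case (x, y) of (x, y) \<Rightarrow> norm (f x) * norm (g y)))"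
      using f by simp
    show "AE x in lborel. integrable lborel (\<lambda>y. case (x, y) of (x, y) \<Rightarrow> norm (f x) * norm (g y))"
      using g by simp
  qed measurable
  then have "integrable (lborel \<Otimes>\<^sub>M lborel) (\<lambda>(x, y). f x * (g y * c x y))"
  proof (rule Bochner_Integration.integrable_bound)
    show "AE z in lborel \<Otimes>\<^sub>M lborel. norm (case z of (x, y) \<Rightarrow> f x * (g y * c x y)) \<le> norm (case z of (x, y) \<Rightarrow> norm (f x) * norm (g y))"
    proof (rule AE_I2)
      fix z :: "real \<times> real"
      obtain x y where z: "z = (x, y)" by (cases z)
      have "norm (f x) * (norm (g y) * norm (c x y)) \<le> norm (f x) * (norm (g y) * 1)"
        using c1 by (intro mult_left_mono) auto
      then show "norm (case z of (x, y) \<Rightarrow> f x * (g y * c x y)) \<le> norm (case z of (x, y) \<Rightarrow> norm (f x) * norm (g y))"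
        by (simp add: z norm_mult)
    qed
  qed measurable
  then have "(LINT y|lborel. LINT x|lborel. f x * (g y * c x y)) = (LINT x|lborel. LINT y|lborel. f x * (g y * c x y))"
    by (rule lborel_pair.Fubini_integral)
  moreover have "(LINT x|lborel. f x * (g y * c x y)) = g y * (LINT x|lborel. f x * c x y)" for y
    by (simp add: integral_mult_right_zero[symmetric] mult_ac del: integral_mult_right_zero)
  moreover have "(LINT y|lborel. f x * (g y * c x y)) = f x * (LINT y|lborel. g y * c x y)" for x
    by (simp add: integral_mult_right_zero[symmetric] mult_ac del: integral_mult_right_zero)
  ultimately show ?thesis by simp
qed

text \<open>The characteristic function of the standard normal law, rescaled by
  \<open>\<delta>\<close>.\<close>

lemma std_normal_density_transform:
  assumes "0 < \<delta>"
  shows "(LINT k|lborel. of_real (std_normal_density (\<delta> * k)) * cis (a * k)) = complex_of_real (exp (- ((a / \<delta>)\<^sup>2) / 2) / \<delta>)"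
proof -
  have "(LINT x|lborel. of_real (std_normal_density x) * cis (a / \<delta> * x)) = char std_normal_distribution (a / \<delta>)"
    unfolding char_def by (subst integral_density) (auto simp: scaleR_conv_of_real cis_conv_exp)
  also have "\<dots> = of_real (exp (- ((a / \<delta>)\<^sup>2) / 2))" by (simp only: char_std_normal_distribution)
  finally have "of_real (exp (- ((a / \<delta>)\<^sup>2) / 2)) = \<bar>\<delta>\<bar> *\<^sub>R (LINT k|lborel. of_real (std_normal_density (0 + \<delta> * k)) * cis (a / \<delta> * (0 + \<delta> * k)))"
    using lborel_integral_real_affine[of \<delta> "\<lambda>x. of_real (std_normal_density x) * cis (a / \<delta> * x)" 0] assms by simp
  then show ?thesis using assms by (simp add: scaleR_conv_of_real field_simps)
qed

lemma nn_integral_std_normal_density: "(\<integral>\<^sup>+x. ennreal (std_normal_density x) \<partial>lborel) = 1"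
  using prob_space.emeasure_space_1[OF prob_space_normal_density[of 1 0]] by (simp add: emeasure_density)

lemma nn_integral_gauss_scaled:
  assumes "0 < \<delta>"
  shows "(\<integral>\<^sup>+z. ennreal (exp (- ((z / \<delta>)\<^sup>2) / 2) / \<delta>) \<partial>lborel) = ennreal (sqrt (2 * pi))"
proof -
  have "(\<integral>\<^sup>+z. ennreal (exp (- ((z / \<delta>)\<^sup>2) / 2) / \<delta>) \<partial>lborel)
      = ennreal \<bar>\<delta>\<bar> * (\<integral>\<^sup>+x. ennreal (exp (- (((0 + \<delta> * x) / \<delta>)\<^sup>2) / 2) / \<delta>) \<partial>lborel)"
    by (rule nn_integral_real_affine) (use assms in auto)
  also have "\<dots> = (\<integral>\<^sup>+x. ennreal \<bar>\<delta>\<bar> * ennreal (exp (- (((0 + \<delta> * x) / \<delta>)\<^sup>2) / 2) / \<delta>) \<partial>lborel)"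
    by (rule nn_integral_cmult[symmetric]) simp
  also have "\<dots> = (\<integral>\<^sup>+x. ennreal (sqrt (2 * pi)) * ennreal (std_normal_density x) \<partial>lborel)"
    using assms by (intro nn_integral_cong) (simp add: ennreal_mult[symmetric] std_normal_density_def)
  also have "\<dots> = ennreal (sqrt (2 * pi)) * (\<integral>\<^sup>+x. ennreal (std_normal_density x) \<partial>lborel)"
    by (rule nn_integral_cmult) simp
  finally show ?thesis by (simp add: nn_integral_std_normal_density)
qed

text \<open>The sign \<open>s\<close> covers the direct transform (\<open>s = - 1\<close>) and, up
  to normalization, the inverse one (\<open>s = 1\<close>).\<close>

definition ft :: "real \<Rightarrow> (real \<Rightarrow> complex) \<Rightarrow> real \<Rightarrow> complex" where
  "ft s f k = (LINT x|lborel. f x * cis (s * k * x))"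

lemma borel_measurable_ft [measurable]:
  assumes [measurable]: "f \<in> borel_measurable borel"
  shows "ft s f \<in> borel_measurable borel"
  unfolding ft_def[abs_def] by measurable

lemma integrable_mult_cis:
  assumes f: "integrable lborel f" and [measurable]: "g \<in> borel_measurable borel"
  shows "integrable lborel (\<lambda>x. f x * cis (g x))"
proof (rule Bochner_Integration.integrable_bound[OF f])
  have [measurable]: "f \<in> borel_measurable borel"
    using borel_measurable_integrable[OF f] by simp
  show "(\<lambda>x. f x * cis (g x)) \<in> borel_measurable lborel" by measurable
qed (simp add: norm_mult)

lemma norm_ft_le:
  assumes "integrable lborel f"
  shows "norm (ft s f k) \<le> (LINT x|lborel. norm (f x))"
proof -
  have "norm (ft s f k) \<le> (LINT x|lborel. norm (f x * cis (s * k * x)))"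
    unfolding ft_def by (rule integral_norm_bound)
  then show ?thesis by (simp add: norm_mult)
qed

lemma cnj_ft:
  "cnj (ft s f k) = (LINT x|lborel. cnj (f x) * cis (- s * k * x))"
proof -
  have "(LINT x|lborel. cnj (f x) * cis (- s * k * x)) = (LINT x|lborel. cnj (f x * cis (s * k * x)))"
    by (intro Bochner_Integration.integral_cong refl) (simp add: cis_cnj)
  then show ?thesis unfolding ft_def by (simp only: Bochner_Integration.integral_cnj)
qed

text \<open>By Fubini the left side is a double integral of \<open>f x * cnj (f y)\<close> against
  the Gaussian \<open>P (x - y)\<close>, the transform of the weight. As
  \<open>|f x| * |f y|\<close> is at most the mean of the two squares, it is bounded by the mass of
  \<open>P\<close>, which is \<open>sqrt (2 * pi)\<close> for every \<open>\<delta>\<close>, times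
  the square integral of \<open>f\<close>.\<close>

lemma Bessel_weighted:
  fixes f :: "real \<Rightarrow> complex"
  assumes f: "integrable lborel f" and s: "\<bar>s\<bar> = 1" and d: "0 < \<delta>"
  shows "(\<integral>\<^sup>+k. ennreal (std_normal_density (\<delta> * k) * (norm (ft s f k))\<^sup>2) \<partial>lborel)
     \<le> ennreal (sqrt (2 * pi)) * (\<integral>\<^sup>+x. ennreal ((norm (f x))\<^sup>2) \<partial>lborel)"
proof -
  have fm [measurable]: "f \<in> borel_measurable borel"
    using borel_measurable_integrable[OF f] by simp
  define h where "h k = complex_of_real (std_normal_density (\<delta> * k))" for k
  have hm [measurable]: "h \<in> borel_measurable borel" unfolding h_def[abs_def] by measurable
  \<comment> \<open>\<open>B\<close> bounds \<open>ft s f\<close>, so that multiplied by the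
    Gaussian weight it becomes integrable and Fubini applies.\<close>
  define B where "B = (LINT x|lborel. norm (f x))"
  define P where "P z = exp (- ((z / \<delta>)\<^sup>2) / 2) / \<delta>" for z
  have P0: "0 \<le> P z" for z using d by (simp add: P_def)
  have Pm [measurable]: "P \<in> borel_measurable borel" unfolding P_def[abs_def] by measurable
  have h: "integrable lborel h"
  proof -
    have "integrable lborel (\<lambda>k. std_normal_density (0 + \<delta> * k))"
      by (rule lborel_integrable_real_affine) (use d integrable_std_normal_moment[of 0] in auto)
    then show ?thesis by (simp add: h_def[abs_def])
  qed
  have hF: "integrable lborel (\<lambda>k. h k * cnj (ft s f k))"
  proof (rule Bochner_Integration.integrable_bound)
    show "integrable lborel (\<lambda>k. of_real B * h k)" by (intro integrable_mult_right h)
    show "AE k in lborel. norm (h k * cnj (ft s f k)) \<le> norm (of_real B * h k)"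
    proof (rule AE_I2)
      fix k
      have "norm (ft s f k) \<le> \<bar>B\<bar>" using norm_ft_le[OF f, of s k] unfolding B_def by linarith
      from mult_left_mono[OF this, of "norm (h k)"]
      show "norm (h k * cnj (ft s f k)) \<le> norm (of_real B * h k)"
        by (simp add: norm_mult mult.commute)
    qed
  qed measurable
  have inner: "(LINT k|lborel. (h k * cnj (ft s f k)) * cis (s * k * x)) = (LINT y|lborel. cnj (f y) * of_real (P (x - y)))" for x
  proof -
    have "(LINT k|lborel. (h k * cnj (ft s f k)) * cis (s * k * x))
       = (LINT k|lborel. (h k * cis (s * x * k)) * (LINT y|lborel. cnj (f y) * cis (- s * k * y)))"
      unfolding cnj_ft by (simp add: mult_ac)
    also have "\<dots> = (LINT y|lborel. cnj (f y) * (LINT k|lborel. (h k * cis (s * x * k)) * cis (- s * k * y)))"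
      by (rule Fubini_bounded_kernel[where c = "\<lambda>y k. cis (- s * k * y)"])
        (use f h in \<open>auto intro!: integrable_mult_cis\<close>)
    also have "\<dots> = (LINT y|lborel. cnj (f y) * of_real (P (x - y)))"
    proof (intro Bochner_Integration.integral_cong refl arg_cong2[where f = "(*)"])
      fix y
      have cis_eq: "cis (s * x * k) * cis (- s * k * y) = cis ((s * (x - y)) * k)" for k
        by (simp add: cis_mult algebra_simps)
      have "(LINT k|lborel. (h k * cis (s * x * k)) * cis (- s * k * y)) = (LINT k|lborel. of_real (std_normal_density (\<delta> * k)) * cis ((s * (x - y)) * k))"
        by (intro Bochner_Integration.integral_cong refl, subst mult.assoc, subst cis_eq) (simp only: h_def)
      also have "\<dots> = of_real (exp (- ((s * (x - y) / \<delta>)\<^sup>2) / 2) / \<delta>)"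
        by (rule std_normal_density_transform[OF d])
      also have "(s * (x - y) / \<delta>)\<^sup>2 = ((x - y) / \<delta>)\<^sup>2"
        using s by (simp add: power_divide power_mult_distrib abs_square_eq_1[symmetric])
      finally show "(LINT k|lborel. (h k * cis (s * x * k)) * cis (- s * k * y)) = of_real (P (x - y))"
        by (simp add: P_def)
    qed
    finally show ?thesis .
  qed
  have "(LINT k|lborel. h k * (ft s f k * cnj (ft s f k))) = (LINT k|lborel. (h k * cnj (ft s f k)) * (LINT x|lborel. f x * cis (s * k * x)))"
    unfolding ft_def[symmetric] by (simp only: mult_ac)
  also have "\<dots> = (LINT x|lborel. f x * (LINT k|lborel. (h k * cnj (ft s f k)) * cis (s * k * x)))"
    by (rule Fubini_bounded_kernel[where c = "\<lambda>x k. cis (s * k * x)"]) (use f hF in auto)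
  also have "\<dots> = (LINT x|lborel. f x * (LINT y|lborel. cnj (f y) * of_real (P (x - y))))"
    unfolding inner ..
  finally have I: "(LINT k|lborel. h k * (ft s f k * cnj (ft s f k))) = (LINT x|lborel. f x * (LINT y|lborel. cnj (f y) * of_real (P (x - y))))" .
  have J: "h k * (ft s f k * cnj (ft s f k)) = of_real (std_normal_density (\<delta> * k) * (norm (ft s f k))\<^sup>2)" for k
    unfolding h_def complex_norm_square[symmetric] by simp
  have intJ: "integrable lborel (\<lambda>k. std_normal_density (\<delta> * k) * (norm (ft s f k))\<^sup>2)"
  proof (rule Bochner_Integration.integrable_bound)
    show "integrable lborel (\<lambda>k. B * (h k * cnj (ft s f k)))" by (intro integrable_mult_right hF)
    show "AE k in lborel. norm (std_normal_density (\<delta> * k) * (norm (ft s f k))\<^sup>2) \<le> norm (B * (h k * cnj (ft s f k)))"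
    proof (rule AE_I2)
      fix k
      have "norm (ft s f k) \<le> \<bar>B\<bar>" using norm_ft_le[OF f, of s k] unfolding B_def by linarith
      then have "norm (ft s f k) * (norm (h k) * norm (ft s f k)) \<le> \<bar>B\<bar> * (norm (h k) * norm (ft s f k))"
        by (intro mult_right_mono) auto
      then show "norm (std_normal_density (\<delta> * k) * (norm (ft s f k))\<^sup>2) \<le> norm (B * (h k * cnj (ft s f k)))"
        by (simp add: norm_mult h_def power2_eq_square mult_ac)
    qed
  qed measurable
  define N where "N x = ennreal ((norm (f x))\<^sup>2)" for x
  have Nm [measurable]: "N \<in> borel_measurable borel" unfolding N_def[abs_def] by measurable
  have shift1: "(\<integral>\<^sup>+y. ennreal (P (x - y)) \<partial>lborel) = ennreal (sqrt (2 * pi))" for x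
  proof -
    have "(\<integral>\<^sup>+z. ennreal (P z) \<partial>lborel) = ennreal \<bar>-1\<bar> * (\<integral>\<^sup>+y. ennreal (P (x + (-1) * y)) \<partial>lborel)"
      by (rule nn_integral_real_affine) auto
    then show ?thesis using nn_integral_gauss_scaled[OF d] by (simp add: P_def)
  qed
  have shift2: "(\<integral>\<^sup>+x. ennreal (P (x - y)) \<partial>lborel) = ennreal (sqrt (2 * pi))" for y
  proof -
    have "(\<integral>\<^sup>+z. ennreal (P z) \<partial>lborel) = ennreal \<bar>1\<bar> * (\<integral>\<^sup>+x. ennreal (P (- y + 1 * x)) \<partial>lborel)"
      by (rule nn_integral_real_affine) auto
    then show ?thesis using nn_integral_gauss_scaled[OF d] by (simp add: P_def)
  qed
  have "(\<integral>\<^sup>+k. ennreal (std_normal_density (\<delta> * k) * (norm (ft s f k))\<^sup>2) \<partial>lborel)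
     = ennreal (LINT k|lborel. std_normal_density (\<delta> * k) * (norm (ft s f k))\<^sup>2)"
    by (rule nn_integral_eq_integral[OF intJ]) auto
  also have "\<dots> \<le> ennreal (norm (LINT k|lborel. h k * (ft s f k * cnj (ft s f k))))"
    unfolding J by (intro ennreal_leI) (simp del: of_real_mult of_real_power)
  also have "\<dots> \<le> (\<integral>\<^sup>+x. ennreal (norm (f x * (LINT y|lborel. cnj (f y) * of_real (P (x - y))))) \<partial>lborel)"
    unfolding I by (rule ennreal_norm_integral_le)
  also have "\<dots> \<le> (\<integral>\<^sup>+x. (\<integral>\<^sup>+y. ennreal (1 / 2) * (N x * ennreal (P (x - y))) + ennreal (1 / 2) * (N y * ennreal (P (x - y))) \<partial>lborel) \<partial>lborel)"
  proof (rule nn_integral_mono)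
    fix x
    have "ennreal (norm (f x * (LINT y|lborel. cnj (f y) * of_real (P (x - y)))))
       = ennreal (norm (LINT y|lborel. f x * (cnj (f y) * of_real (P (x - y)))))"
      by (simp only: integral_mult_right_zero)
    also have "\<dots> \<le> (\<integral>\<^sup>+y. ennreal (norm (f x * (cnj (f y) * of_real (P (x - y))))) \<partial>lborel)"
      by (rule ennreal_norm_integral_le)
    also have "\<dots> \<le> (\<integral>\<^sup>+y. ennreal (1 / 2) * (N x * ennreal (P (x - y))) + ennreal (1 / 2) * (N y * ennreal (P (x - y))) \<partial>lborel)"
    proof (rule nn_integral_mono)
      fix y
      have "norm (f x) * norm (f y) \<le> 1 / 2 * (norm (f x))\<^sup>2 + 1 / 2 * (norm (f y))\<^sup>2"
        using zero_le_power2[of "norm (f x) - norm (f y)"] by (simp add: power2_diff)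
      then have "norm (f x) * norm (f y) * P (x - y) \<le> (1 / 2 * (norm (f x))\<^sup>2 + 1 / 2 * (norm (f y))\<^sup>2) * P (x - y)"
        by (intro mult_right_mono P0)
      then have "ennreal (norm (f x * (cnj (f y) * of_real (P (x - y))))) \<le> ennreal (1 / 2 * ((norm (f x))\<^sup>2 * P (x - y)) + 1 / 2 * ((norm (f y))\<^sup>2 * P (x - y)))"
        using P0[of "x - y"] by (intro ennreal_leI) (simp add: norm_mult distrib_right mult.assoc)
      also have "\<dots> = ennreal (1 / 2) * (N x * ennreal (P (x - y))) + ennreal (1 / 2) * (N y * ennreal (P (x - y)))"
        unfolding N_def using P0[of "x - y"] by (simp only: ennreal_mult ennreal_plus mult_nonneg_nonneg zero_le_power2 zero_le_divide_1_iff zero_le_numeral)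
      finally show "ennreal (norm (f x * (cnj (f y) * of_real (P (x - y))))) \<le> ennreal (1 / 2) * (N x * ennreal (P (x - y))) + ennreal (1 / 2) * (N y * ennreal (P (x - y)))" .
    qed
    finally show "ennreal (norm (f x * (LINT y|lborel. cnj (f y) * of_real (P (x - y)))))
       \<le> (\<integral>\<^sup>+y. ennreal (1 / 2) * (N x * ennreal (P (x - y))) + ennreal (1 / 2) * (N y * ennreal (P (x - y))) \<partial>lborel)" .
  qed
  \<comment> \<open>The mass of \<open>P\<close> is split off by integrating over \<open>y\<close>
    in the first half and, after exchanging the integrals, over \<open>x\<close> in the second; both
    halves are equal.\<close>
  also have "\<dots> = (\<integral>\<^sup>+x. (\<integral>\<^sup>+y. ennreal (1 / 2) * (N x * ennreal (P (x - y))) \<partial>lborel) \<partial>lborel)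
     + (\<integral>\<^sup>+x. (\<integral>\<^sup>+y. ennreal (1 / 2) * (N y * ennreal (P (x - y))) \<partial>lborel) \<partial>lborel)"
    by (subst nn_integral_add[symmetric]) (auto intro!: nn_integral_cong nn_integral_add)
  also have "(\<integral>\<^sup>+x. (\<integral>\<^sup>+y. ennreal (1 / 2) * (N x * ennreal (P (x - y))) \<partial>lborel) \<partial>lborel)
     = ennreal (1 / 2) * (ennreal (sqrt (2 * pi)) * (\<integral>\<^sup>+x. N x \<partial>lborel))"
    by (simp add: nn_integral_cmult nn_integral_multc shift1 mult.commute)
  also have "(\<integral>\<^sup>+x. (\<integral>\<^sup>+y. ennreal (1 / 2) * (N y * ennreal (P (x - y))) \<partial>lborel) \<partial>lborel)
     = (\<integral>\<^sup>+y. (\<integral>\<^sup>+x. ennreal (1 / 2) * (N y * ennreal (P (x - y))) \<partial>lborel) \<partial>lborel)"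
    by (rule lborel_pair.Fubini') measurable
  also have "\<dots> = ennreal (1 / 2) * (ennreal (sqrt (2 * pi)) * (\<integral>\<^sup>+x. N x \<partial>lborel))"
    by (simp add: nn_integral_cmult nn_integral_multc shift2 mult.commute)
  also have "ennreal (1 / 2) * (ennreal (sqrt (2 * pi)) * (\<integral>\<^sup>+x. N x \<partial>lborel)) + ennreal (1 / 2) * (ennreal (sqrt (2 * pi)) * (\<integral>\<^sup>+x. N x \<partial>lborel))
     = (ennreal (1 / 2) + ennreal (1 / 2)) * (ennreal (sqrt (2 * pi)) * (\<integral>\<^sup>+x. N x \<partial>lborel))"
    by (rule distrib_right[symmetric])
  also have "ennreal (1 / 2) + ennreal (1 / 2) = 1" by (subst ennreal_plus[symmetric]) auto
  finally show ?thesis by (simp add: N_def)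
qed

text \<open>As \<open>\<delta>\<close> tends to 0 the weight tends to its value
  \<open>1 / sqrt (2 * pi)\<close> at the origin, and Fatou's lemma keeps the bound. Dividing by
  this value turns \<open>sqrt (2 * pi)\<close> into \<open>2 * pi\<close>.\<close>

lemma Bessel:
  fixes f :: "real \<Rightarrow> complex"
  assumes f: "integrable lborel f" and s: "\<bar>s\<bar> = 1"
  shows "(\<integral>\<^sup>+k. ennreal ((norm (ft s f k))\<^sup>2) \<partial>lborel) \<le> ennreal (2 * pi) * (\<integral>\<^sup>+x. ennreal ((norm (f x))\<^sup>2) \<partial>lborel)"
proof -
  have fm [measurable]: "f \<in> borel_measurable borel"
    using borel_measurable_integrable[OF f] by simp
  define I where "I = (\<integral>\<^sup>+x. ennreal ((norm (f x))\<^sup>2) \<partial>lborel)"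
  let ?d = "\<lambda>N. inverse (real (Suc N))"
  have lim: "(\<lambda>N. ennreal (std_normal_density (?d N * k) * (norm (ft s f k))\<^sup>2)) \<longlonglongrightarrow> ennreal (1 / sqrt (2 * pi) * (norm (ft s f k))\<^sup>2)" for k
  proof -
    have "(\<lambda>N. 1 / sqrt (2 * pi) * exp (- (?d N * k)\<^sup>2 / 2) * (norm (ft s f k))\<^sup>2) \<longlonglongrightarrow> 1 / sqrt (2 * pi) * exp (- (0 * k)\<^sup>2 / 2) * (norm (ft s f k))\<^sup>2"
      by (intro tendsto_intros LIMSEQ_inverse_real_of_nat) auto
    then show ?thesis by (intro tendsto_ennrealI) (simp add: std_normal_density_def)
  qed
  have "(\<integral>\<^sup>+k. ennreal (1 / sqrt (2 * pi) * (norm (ft s f k))\<^sup>2) \<partial>lborel)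
     = (\<integral>\<^sup>+k. liminf (\<lambda>N. ennreal (std_normal_density (?d N * k) * (norm (ft s f k))\<^sup>2)) \<partial>lborel)"
    by (intro nn_integral_cong lim_imp_Liminf[symmetric] lim) auto
  also have "\<dots> \<le> liminf (\<lambda>N. \<integral>\<^sup>+k. ennreal (std_normal_density (?d N * k) * (norm (ft s f k))\<^sup>2) \<partial>lborel)"
    by (rule nn_integral_liminf) measurable
  also have "\<dots> \<le> ennreal (sqrt (2 * pi)) * I"
  proof -
    have "(\<integral>\<^sup>+k. ennreal (std_normal_density (?d N * k) * (norm (ft s f k))\<^sup>2) \<partial>lborel) \<le> ennreal (sqrt (2 * pi)) * I" for N
      unfolding I_def by (rule Bessel_weighted[OF f s]) simp
    then show ?thesis by (intro Liminf_le) auto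
  qed
  finally have 1: "(\<integral>\<^sup>+k. ennreal (1 / sqrt (2 * pi) * (norm (ft s f k))\<^sup>2) \<partial>lborel) \<le> ennreal (sqrt (2 * pi)) * I" .
  have "(\<integral>\<^sup>+k. ennreal ((norm (ft s f k))\<^sup>2) \<partial>lborel) = (\<integral>\<^sup>+k. ennreal (sqrt (2 * pi)) * ennreal (1 / sqrt (2 * pi) * (norm (ft s f k))\<^sup>2) \<partial>lborel)"
    by (intro nn_integral_cong) (simp add: ennreal_mult[symmetric])
  also have "\<dots> = ennreal (sqrt (2 * pi)) * (\<integral>\<^sup>+k. ennreal (1 / sqrt (2 * pi) * (norm (ft s f k))\<^sup>2) \<partial>lborel)"
    by (rule nn_integral_cmult) measurable
  also have "\<dots> \<le> ennreal (sqrt (2 * pi)) * (ennreal (sqrt (2 * pi)) * I)"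
    by (rule mult_left_mono[OF 1]) simp
  also have "\<dots> = ennreal (2 * pi) * I"
    by (simp add: mult.assoc[symmetric] ennreal_mult[symmetric])
  finally show ?thesis unfolding I_def .
qed

section \<open>Existence of the mean-square transforms\<close>

definition trunc :: "real \<Rightarrow> (real \<Rightarrow> complex) \<Rightarrow> real \<Rightarrow> complex" where
  "trunc R f x = indicator {- R..R} x *\<^sub>R f x"

lemma borel_measurable_trunc [measurable]:
  assumes [measurable]: "f \<in> borel_measurable borel"
  shows "trunc R f \<in> borel_measurable borel"
  unfolding trunc_def[abs_def] by measurable

text \<open>On the bounded interval \<open>norm (f x) <= 1 + (norm (f x))^2\<close> gives an
  integrable majorant.\<close>

lemma integrable_trunc:
  assumes [measurable]: "f \<in> borel_measurable borel" and f2: "integrable lborel (\<lambda>x. (norm (f x))\<^sup>2)"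
  shows "integrable lborel (trunc R f)"
proof (rule Bochner_Integration.integrable_bound)
  show "integrable lborel (\<lambda>x. indicator {- R..R} x + (norm (f x))\<^sup>2)"
    using f2 by (intro Bochner_Integration.integrable_add) (auto intro!: integrable_real_indicator simp: emeasure_lborel_Icc_eq)
  show "AE x in lborel. norm (trunc R f x) \<le> norm (indicator {- R..R} x + (norm (f x))\<^sup>2 :: real)"
  proof (rule AE_I2)
    fix x
    have "norm (f x) \<le> 1 + (norm (f x))\<^sup>2"
    proof -
      have "2 * norm (f x) \<le> (norm (f x))\<^sup>2 + 1" using zero_le_power2[of "norm (f x) - 1"] by (simp add: power2_diff)
      then show ?thesis using norm_ge_zero[of "f x"] by linarith
    qed
    then show "norm (trunc R f x) \<le> norm (indicator {- R..R} x + (norm (f x))\<^sup>2 :: real)"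
      by (auto simp: trunc_def indicator_def)
  qed
qed measurable

lemma ft_diff:
  assumes "integrable lborel f" "integrable lborel g"
  shows "ft s (\<lambda>x. f x - g x) k = ft s f k - ft s g k"
  unfolding ft_def left_diff_distrib
  by (rule Bochner_Integration.integral_diff) (use assms in \<open>auto intro: integrable_mult_cis\<close>)

definition l2_tail :: "(real \<Rightarrow> complex) \<Rightarrow> real \<Rightarrow> ennreal" where
  "l2_tail f R = (\<integral>\<^sup>+x. indicator (- {- R..R}) x * ennreal ((norm (f x))\<^sup>2) \<partial>lborel)"

lemma l2_tail_antimono: "R \<le> S \<Longrightarrow> l2_tail f S \<le> l2_tail f R"
  unfolding l2_tail_def by (intro nn_integral_mono mult_right_mono) (auto simp: indicator_def)

lemma l2_tail_tendsto_0:
  assumes [measurable]: "f \<in> borel_measurable borel" and f2: "integrable lborel (\<lambda>x. (norm (f x))\<^sup>2)"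
  shows "(\<lambda>N. l2_tail f (real N)) \<longlonglongrightarrow> 0"
proof -
  have "(\<lambda>N. l2_tail f (real N)) \<longlonglongrightarrow> (\<integral>\<^sup>+x. 0 \<partial>(lborel :: real measure))"
    unfolding l2_tail_def
  proof (rule nn_integral_dominated_convergence[where w = "\<lambda>x. ennreal ((norm (f x))\<^sup>2)"])
    show "(\<integral>\<^sup>+x. ennreal ((norm (f x))\<^sup>2) \<partial>lborel) < \<infinity>"
      using f2 by (simp add: integrable_iff_bounded)
    show "AE x in lborel. (\<lambda>N. indicator (- {- real N..real N}) x * ennreal ((norm (f x))\<^sup>2)) \<longlonglongrightarrow> 0"
    proof (rule AE_I2, rule tendsto_eventually)
      fix x :: real
      obtain N0 :: nat where "\<bar>x\<bar> \<le> real N0" using real_arch_simple by blast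
      then show "\<forall>\<^sub>F N in sequentially. indicator (- {- real N..real N}) x * ennreal ((norm (f x))\<^sup>2) = 0"
        unfolding eventually_sequentially by (intro exI[of _ N0]) (auto simp: indicator_def)
    qed
    show "AE x in lborel. indicator (- {- real N..real N}) x * ennreal ((norm (f x))\<^sup>2) \<le> ennreal ((norm (f x))\<^sup>2)" for N
      by (auto simp: indicator_def)
  qed measurable
  then show ?thesis by simp
qed

text \<open>The two truncations differ only outside \<open>{- N..N}\<close>, and by at most
  \<open>f\<close> in norm; with Bessel's inequality the truncated transforms are Cauchy in mean
  square.\<close>

lemma ft_trunc_diff_le:
  assumes [measurable]: "f \<in> borel_measurable borel" and f2: "integrable lborel (\<lambda>x. (norm (f x))\<^sup>2)"
    and s: "\<bar>s\<bar> = 1" and RS: "N \<le> R" "N \<le> S"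
  shows "(\<integral>\<^sup>+k. ennreal ((norm (ft s (trunc R f) k - ft s (trunc S f) k))\<^sup>2) \<partial>lborel) \<le> ennreal (2 * pi) * l2_tail f N"
proof -
  note int = integrable_trunc[OF assms(1) f2]
  have "(\<integral>\<^sup>+k. ennreal ((norm (ft s (trunc R f) k - ft s (trunc S f) k))\<^sup>2) \<partial>lborel)
     = (\<integral>\<^sup>+k. ennreal ((norm (ft s (\<lambda>x. trunc R f x - trunc S f x) k))\<^sup>2) \<partial>lborel)"
    by (simp only: ft_diff[OF int int])
  also have "\<dots> \<le> ennreal (2 * pi) * (\<integral>\<^sup>+x. ennreal ((norm (trunc R f x - trunc S f x))\<^sup>2) \<partial>lborel)"
    by (intro Bessel s Bochner_Integration.integrable_diff int)
  also have "(\<integral>\<^sup>+x. ennreal ((norm (trunc R f x - trunc S f x))\<^sup>2) \<partial>lborel) \<le> l2_tail f N"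
    unfolding l2_tail_def using RS by (intro nn_integral_mono) (auto simp: trunc_def indicator_def)
  finally show ?thesis by (simp add: mult_left_mono)
qed

text \<open>Each increment is at most a constant times \<open>(1 / sqrt 2) ^ j\<close>, hence the
  increments are absolutely summable. The weight \<open>2 ^ j\<close> lets sums of squares stand in
  for the triangle inequality in L2.\<close>

lemma convergent_of_summable_weighted_squares:
  fixes G :: "nat \<Rightarrow> complex"
  assumes "(\<Sum>j. ennreal (2 ^ j * (norm (G (Suc j) - G j))\<^sup>2)) \<noteq> \<infinity>"
  shows "convergent G"
proof -
  define d where "d j = G (Suc j) - G j" for j
  define Z where "Z = (\<Sum>j. ennreal (2 ^ j * (norm (d j))\<^sup>2))"
  have "Z \<noteq> \<infinity>" using assms unfolding Z_def d_def .
  then obtain B where Z: "Z = ennreal B" "0 \<le> B" by (cases Z) auto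
  note B = Z[unfolded Z_def]
  have le: "norm (d j) \<le> sqrt B * (sqrt (1 / 2)) ^ j" for j
  proof -
    have "ennreal (2 ^ j * (norm (d j))\<^sup>2) = (\<Sum>i\<in>{j}. ennreal (2 ^ i * (norm (d i))\<^sup>2))" by simp
    also have "\<dots> \<le> ennreal B" unfolding B(1)[symmetric] by (intro sum_le_suminf) auto
    finally have "2 ^ j * (norm (d j))\<^sup>2 \<le> B" using B(2) by simp
    then have "(norm (d j))\<^sup>2 \<le> B * (1 / 2) ^ j" by (simp add: field_simps)
    then have "norm (d j) \<le> sqrt (B * (1 / 2) ^ j)" by (rule real_le_rsqrt)
    then show ?thesis by (simp only: real_sqrt_mult real_sqrt_power)
  qed
  have "summable (\<lambda>j. sqrt B * (sqrt (1 / 2)) ^ j)"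
    by (intro summable_mult summable_geometric) (simp add: real_sqrt_divide)
  then have "summable d" by (rule summable_comparison_test'[where N = 0]) (use le in auto)
  then have "(\<lambda>j. \<Sum>i<j. d i) \<longlonglongrightarrow> suminf d" by (rule summable_LIMSEQ)
  then have "(\<lambda>j. G j - G 0) \<longlonglongrightarrow> suminf d" unfolding d_def by (simp only: sum_lessThan_telescope)
  from tendsto_add[OF this tendsto_const[of "G 0"]] show ?thesis by (auto simp: convergent_def)
qed

text \<open>The completeness argument for L2: along a fast sequence of radii the transforms converge
  almost everywhere, and Fatou's lemma compares every truncation with that limit.\<close>

lemma L2_ft_exists:
  assumes fm [measurable]: "f \<in> borel_measurable borel" and f2: "integrable lborel (\<lambda>x. (norm (f x))\<^sup>2)"
    and s: "\<bar>s\<bar> = 1"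
  obtains g where "g \<in> borel_measurable borel" "integrable lborel (\<lambda>k. (norm (g k))\<^sup>2)"
    "((\<lambda>R. \<integral>\<^sup>+k. ennreal ((norm (ft s (trunc R f) k - g k))\<^sup>2) \<partial>lborel) \<longlongrightarrow> 0) at_top"
proof -
  define \<tau> where "\<tau> N = ennreal (2 * pi) * l2_tail f (real N)" for N
  have tau: "\<tau> \<longlonglongrightarrow> 0"
    using ennreal_tendsto_cmult[OF _ l2_tail_tendsto_0[OF fm f2], of "ennreal (2 * pi)"] by (simp add: \<tau>_def[abs_def])
  have tau_anti: "\<tau> M \<le> \<tau> N" if "N \<le> M" for M N
    unfolding \<tau>_def using that by (intro mult_left_mono l2_tail_antimono) auto
  have "\<exists>N. \<tau> N \<le> ennreal ((1 / 4) ^ j)" for j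
  proof -
    have "\<forall>\<^sub>F N in sequentially. \<tau> N < ennreal ((1 / 4) ^ j)"
      by (rule order_tendstoD(2)[OF tau]) simp
    then show ?thesis by (auto simp: eventually_sequentially intro: less_imp_le)
  qed
  then obtain r0 where r0: "\<And>j. \<tau> (r0 j) \<le> ennreal ((1 / 4) ^ j)" by metis
  \<comment> \<open>The sum makes the radii increasing and at least \<open>r0 j\<close>; the summand
    \<open>j\<close> sends them to infinity.\<close>
  define r where "r j = (\<Sum>i\<le>j. r0 i) + j" for j
  have r_ge: "r0 j \<le> r j" "j \<le> r j" "r j \<le> r (Suc j)" for j
    using member_le_sum[of j "{..j}" r0] by (auto simp: r_def)
  define G where "G j = ft s (trunc (real (r j)) f)" for j
  have Gm [measurable]: "G j \<in> borel_measurable borel" for j unfolding G_def by measurable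
  have step: "(\<integral>\<^sup>+k. ennreal ((norm (G (Suc j) k - G j k))\<^sup>2) \<partial>lborel) \<le> ennreal ((1 / 4) ^ j)" for j
  proof -
    have "(\<integral>\<^sup>+k. ennreal ((norm (G (Suc j) k - G j k))\<^sup>2) \<partial>lborel) \<le> \<tau> (r0 j)"
      unfolding G_def \<tau>_def using r_ge[of j] by (intro ft_trunc_diff_le fm f2 s) auto
    then show ?thesis using r0[of j] by (rule order_trans)
  qed
  have "(\<integral>\<^sup>+k. (\<Sum>j. ennreal (2 ^ j * (norm (G (Suc j) k - G j k))\<^sup>2)) \<partial>lborel)
     = (\<Sum>j. \<integral>\<^sup>+k. ennreal (2 ^ j * (norm (G (Suc j) k - G j k))\<^sup>2) \<partial>lborel)"
    by (rule nn_integral_suminf) measurable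
  \<comment> \<open>The increments were chosen of size \<open>(1 / 4) ^ j\<close>, so the weight
    \<open>2 ^ j\<close> still leaves a geometric series.\<close>
  also have "\<dots> \<le> (\<Sum>j. ennreal ((1 / 2) ^ j))"
  proof (rule suminf_le)
    fix j
    have "(\<integral>\<^sup>+k. ennreal (2 ^ j * (norm (G (Suc j) k - G j k))\<^sup>2) \<partial>lborel)
       = (\<integral>\<^sup>+k. ennreal (2 ^ j) * ennreal ((norm (G (Suc j) k - G j k))\<^sup>2) \<partial>lborel)"
      by (intro nn_integral_cong) (simp only: ennreal_mult zero_le_power zero_le_numeral zero_le_power2)
    also have "\<dots> = ennreal (2 ^ j) * (\<integral>\<^sup>+k. ennreal ((norm (G (Suc j) k - G j k))\<^sup>2) \<partial>lborel)"
      by (rule nn_integral_cmult) measurable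
    also have "\<dots> \<le> ennreal (2 ^ j) * ennreal ((1 / 4) ^ j)"
      by (rule mult_left_mono[OF step]) simp
    also have "\<dots> = ennreal (2 ^ j * (1 / 4) ^ j)" by (rule ennreal_mult[symmetric]) auto
    also have "(2::real) ^ j * (1 / 4) ^ j = (1 / 2) ^ j" by (simp add: power_mult_distrib[symmetric])
    finally show "(\<integral>\<^sup>+k. ennreal (2 ^ j * (norm (G (Suc j) k - G j k))\<^sup>2) \<partial>lborel) \<le> ennreal ((1 / 2) ^ j)" .
  qed auto
  also have "\<dots> = ennreal (\<Sum>j. (1 / 2) ^ j)" by (rule suminf_ennreal2) (auto intro: summable_geometric)
  also have "\<dots> < \<infinity>" by simp
  finally have fin: "(\<integral>\<^sup>+k. (\<Sum>j. ennreal (2 ^ j * (norm (G (Suc j) k - G j k))\<^sup>2)) \<partial>lborel) < \<infinity>" .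
  have "(\<lambda>k. \<Sum>j. ennreal (2 ^ j * (norm (G (Suc j) k - G j k))\<^sup>2)) \<in> borel_measurable lborel"
    by measurable
  from nn_integral_PInf_AE[OF this less_imp_neq[OF fin]]
  have conv: "AE k in lborel. convergent (\<lambda>j. G j k)"
    by (rule eventually_mono) (rule convergent_of_summable_weighted_squares)
  define g where "g k = lim (\<lambda>j. G j k)" for k
  have gm [measurable]: "g \<in> borel_measurable borel" unfolding g_def[abs_def] by measurable
  have main: "(\<integral>\<^sup>+k. ennreal ((norm (ft s (trunc R f) k - g k))\<^sup>2) \<partial>lborel) \<le> \<tau> N" if R: "real N \<le> R" for R N
  proof -
    have "(\<integral>\<^sup>+k. ennreal ((norm (ft s (trunc R f) k - g k))\<^sup>2) \<partial>lborel)
       = (\<integral>\<^sup>+k. liminf (\<lambda>j. ennreal ((norm (ft s (trunc R f) k - G j k))\<^sup>2)) \<partial>lborel)"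
    proof (rule nn_integral_cong_AE, rule AE_mp[OF conv], intro AE_I2 impI)
      fix k assume "convergent (\<lambda>j. G j k)"
      then have "(\<lambda>j. G j k) \<longlonglongrightarrow> g k" unfolding g_def by (simp add: convergent_LIMSEQ_iff)
      then have "(\<lambda>j. ennreal ((norm (ft s (trunc R f) k - G j k))\<^sup>2)) \<longlonglongrightarrow> ennreal ((norm (ft s (trunc R f) k - g k))\<^sup>2)"
        by (intro tendsto_ennrealI tendsto_intros)
      then show "ennreal ((norm (ft s (trunc R f) k - g k))\<^sup>2) = liminf (\<lambda>j. ennreal ((norm (ft s (trunc R f) k - G j k))\<^sup>2))"
        by (intro lim_imp_Liminf[symmetric]) auto
    qed
    also have "\<dots> \<le> liminf (\<lambda>j. \<integral>\<^sup>+k. ennreal ((norm (ft s (trunc R f) k - G j k))\<^sup>2) \<partial>lborel)"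
      by (rule nn_integral_liminf) measurable
    also have "\<dots> \<le> \<tau> N"
    proof (rule Liminf_le)
      show "\<forall>\<^sub>F j in sequentially. (\<integral>\<^sup>+k. ennreal ((norm (ft s (trunc R f) k - G j k))\<^sup>2) \<partial>lborel) \<le> \<tau> N"
        using eventually_ge_at_top[of N]
      proof eventually_elim
        fix j assume "N \<le> j"
        then have "N \<le> r j" using r_ge(2)[of j] by linarith
        then show "(\<integral>\<^sup>+k. ennreal ((norm (ft s (trunc R f) k - G j k))\<^sup>2) \<partial>lborel) \<le> \<tau> N"
          unfolding G_def \<tau>_def using R by (intro ft_trunc_diff_le fm f2 s) auto
      qed
    qed simp
    finally show ?thesis .
  qed
  have "integrable lborel (\<lambda>k. (norm (g k))\<^sup>2)"
  proof (rule integrableI_bounded)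
    \<comment> \<open>At radius 0 the truncation vanishes off a single point, so the main estimate
      becomes a bound for \<open>g\<close> itself.\<close>
    have "ft s (trunc 0 f) k = 0" for k
      unfolding ft_def
    proof (rule integral_eq_zero_AE)
      show "AE x in lborel. trunc 0 f x * cis (s * k * x) = 0"
        using AE_lborel_singleton[of "0::real"] by eventually_elim (simp add: trunc_def indicator_def)
    qed
    then have "(\<integral>\<^sup>+k. ennreal (norm ((norm (g k))\<^sup>2)) \<partial>lborel) \<le> \<tau> 0"
      using main[of 0 0] by simp
    also have "\<tau> 0 < \<infinity>"
    proof -
      have "l2_tail f 0 \<le> (\<integral>\<^sup>+x. ennreal ((norm (f x))\<^sup>2) \<partial>lborel)"
        unfolding l2_tail_def by (intro nn_integral_mono) (auto simp: indicator_def)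
      also have "\<dots> < \<infinity>" using f2 by (simp add: integrable_iff_bounded)
      finally show ?thesis unfolding \<tau>_def by (simp add: ennreal_mult_less_top)
    qed
    finally show "(\<integral>\<^sup>+k. ennreal (norm ((norm (g k))\<^sup>2)) \<partial>lborel) < \<infinity>" .
  qed measurable
  moreover have "((\<lambda>R. \<integral>\<^sup>+k. ennreal ((norm (ft s (trunc R f) k - g k))\<^sup>2) \<partial>lborel) \<longlongrightarrow> 0) at_top"
  proof (rule order_tendstoI)
    fix a :: ennreal assume "0 < a"
    then have "\<forall>\<^sub>F N in sequentially. \<tau> N < a" by (rule order_tendstoD(2)[OF tau])
    then obtain N where N: "\<tau> N < a" by (auto simp: eventually_sequentially)
    show "\<forall>\<^sub>F R in at_top. (\<integral>\<^sup>+k. ennreal ((norm (ft s (trunc R f) k - g k))\<^sup>2) \<partial>lborel) < a"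
      using eventually_ge_at_top[of "real N"] by eventually_elim (rule le_less_trans[OF main N])
  qed auto
  ultimately show ?thesis by (rule that[OF gm])
qed

section \<open>Identification of the solution\<close>

definition trunc_kern :: "nat \<Rightarrow> (nat \<Rightarrow> real) \<Rightarrow> real \<Rightarrow> real \<Rightarrow> real \<Rightarrow> complex" where
  "trunc_kern n w R x t = integral {- R..R} (osc n w 0 0 x t)"

lemma tame_trunc_kern:
  assumes n: "2 \<le> n" and wn: "w n \<noteq> 0" and l: "growth_exponent n 0 \<le> l" and R: "0 \<le> R"
  shows "tame l (trunc_kern n w R)"
  unfolding tame_def
proof (intro conjI allI impI)
  have "continuous_on (UNIV \<times> {0<..}) (\<lambda>z. LINT k|lborel. indicator {- R..R} k *\<^sub>R osc n w 0 0 (fst z) (snd z) k)"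
  proof (rule continuous_on_lebesgue_integral[where g = "indicator {- R..R}"])
    show "continuous_on (UNIV \<times> {0<..}) (\<lambda>z. indicator {- R..R} k *\<^sub>R osc n w 0 0 (fst z) (snd z) k)" for k
      unfolding osc_def by (intro continuous_intros)
    show "integrable lborel (indicator {- R..R} :: real \<Rightarrow> real)"
      by (intro integrable_real_indicator) (auto simp: emeasure_lborel_Icc_eq)
    show "norm (indicator {- R..R} k *\<^sub>R osc n w 0 0 (fst z) (snd z) k) \<le> indicator {- R..R} k" for z k
      by (simp add: norm_osc)
  qed measurable
  then show "continuous_on (UNIV \<times> {0<..}) (\<lambda>z. trunc_kern n w R (fst z) (snd z))"
    unfolding trunc_kern_def integral_osc_eq_lborel .
  fix a b :: real assume ab: "0 < a" "a \<le> b"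
  obtain C where C: "0 \<le> C" and le: "\<And>x t R. a \<le> t \<Longrightarrow> t \<le> b \<Longrightarrow> 0 \<le> R \<Longrightarrow>
     norm (integral {- R..R} (osc n w 0 0 x t)) \<le> C * (1 + \<bar>x\<bar>) powr growth_exponent n 0"
    by (rule osc_growth[of n w a b 0, OF n wn ab]) (use n in auto)
  have "norm (trunc_kern n w R x t) \<le> C * (1 + \<bar>x\<bar>) powr l" if "a \<le> t" "t \<le> b" for x t
  proof -
    have "C * (1 + \<bar>x\<bar>) powr growth_exponent n 0 \<le> C * (1 + \<bar>x\<bar>) powr l"
      using C l by (intro mult_left_mono powr_mono) auto
    then show ?thesis using le[OF that R, of x] unfolding trunc_kern_def by linarith
  qed
  with C show "\<exists>C\<ge>0. \<forall>x t. a \<le> t \<longrightarrow> t \<le> b \<longrightarrow> norm (trunc_kern n w R x t) \<le> C * (1 + \<bar>x\<bar>) powr l"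
    by blast
qed

text \<open>The majorant must not depend on \<open>N\<close>. It is therefore built from
  \<open>osc_growth\<close>, whose constant is uniform in the truncation; the constant in
  \<open>tame\<close> may depend on the radius.\<close>

lemma conv_trunc_kern_tendsto:
  assumes n: "2 \<le> n" and wn: "w n \<noteq> 0" and l: "growth_exponent n 0 \<le> l"
    and f: "weighted_integrable l f" and t: "0 < t"
  shows "(\<lambda>N. conv f (trunc_kern n w (real N)) x t) \<longlonglongrightarrow> conv f (kern n w 0) x t"
proof -
  obtain C where C: "0 \<le> C" and "\<And>x s R. t \<le> s \<Longrightarrow> s \<le> t \<Longrightarrow> 0 \<le> R \<Longrightarrow>
     norm (integral {- R..R} (osc n w 0 0 x s)) \<le> C * (1 + \<bar>x\<bar>) powr growth_exponent n 0"
    by (rule osc_growth[of n w t t 0, OF n wn t order_refl]) (use n in auto)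
  then have le: "norm (trunc_kern n w (real N) z t) \<le> C * (1 + \<bar>z\<bar>) powr growth_exponent n 0" for N z
    unfolding trunc_kern_def by auto
  define D where "D = C * (1 + \<bar>x\<bar>) powr \<bar>l\<bar>"
  have bound: "norm (f y * trunc_kern n w (real N) (x - y) t) \<le> D * ((1 + \<bar>y\<bar>) powr l * norm (f y))" for N y
  proof -
    note le[of N "x - y"]
    also have "C * (1 + \<bar>x - y\<bar>) powr growth_exponent n 0 \<le> C * (1 + \<bar>x - y\<bar>) powr l"
      using C l by (intro mult_left_mono powr_mono) auto
    also have "\<dots> \<le> C * ((1 + \<bar>x\<bar>) powr \<bar>l\<bar> * (1 + \<bar>y\<bar>) powr l)"
      using C by (intro mult_left_mono one_plus_abs_diff_powr_le)
    finally have "norm (f y) * norm (trunc_kern n w (real N) (x - y) t) \<le> norm (f y) * (C * ((1 + \<bar>x\<bar>) powr \<bar>l\<bar> * (1 + \<bar>y\<bar>) powr l))"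
      by (intro mult_left_mono) auto
    then show ?thesis by (simp add: D_def norm_mult mult_ac)
  qed
  show ?thesis unfolding conv_def
  proof (rule integral_dominated_convergence[where w = "\<lambda>y. D * ((1 + \<bar>y\<bar>) powr l * norm (f y))"])
    show "(\<lambda>y. f y * kern n w 0 (x - y) t) \<in> borel_measurable lebesgue"
      by (rule conv_measurable[OF tame_kern[of n w 0 l, OF n wn l] f t])
    show "(\<lambda>y. f y * trunc_kern n w (real N) (x - y) t) \<in> borel_measurable lebesgue" for N
      by (rule conv_measurable[OF tame_trunc_kern[of n w l "real N", OF n wn l] f t]) simp
    show "integrable lebesgue (\<lambda>y. D * ((1 + \<bar>y\<bar>) powr l * norm (f y)))"
      using f unfolding weighted_integrable_def by (intro integrable_mult_right) auto
    show "AE y in lebesgue. (\<lambda>N. f y * trunc_kern n w (real N) (x - y) t) \<longlonglongrightarrow> f y * kern n w 0 (x - y) t"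
      unfolding trunc_kern_def
      by (intro AE_I2 tendsto_mult tendsto_const trunc_tendsto_kern[of n w t 0, OF n wn t]) (use n in auto)
    show "AE y in lebesgue. norm (f y * trunc_kern n w (real N) (x - y) t) \<le> D * ((1 + \<bar>y\<bar>) powr l * norm (f y))" for N
      by (intro AE_I2 bound)
  qed
qed

section \<open>Borel representatives and well-definedness of the transforms\<close>

text \<open>Fubini is applied on products of Borel measures, whereas data and transforms are only
  Lebesgue measurable.\<close>

lemma lebesgue_borel_representative:
  fixes f :: "real \<Rightarrow> complex"
  assumes "f \<in> borel_measurable lebesgue"
  obtains g where "g \<in> borel_measurable borel" "AE x in lborel. f x = g x"
proof -
  have "(\<lambda>x. Re (f x)) \<in> borel_measurable lebesgue" "(\<lambda>x. Im (f x)) \<in> borel_measurable lebesgue"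
    using assms by (auto intro: measurable_compose[OF _ borel_measurable_Re] measurable_compose[OF _ borel_measurable_Im])
  then obtain u v where [measurable]: "u \<in> borel_measurable borel" "v \<in> borel_measurable borel"
    and uv: "AE x in lborel. Re (f x) = u x" "AE x in lborel. Im (f x) = v x"
    using completion_ex_borel_measurable_real[of "\<lambda>x. Re (f x)" lborel] completion_ex_borel_measurable_real[of "\<lambda>x. Im (f x)" lborel] by auto
  show ?thesis
  proof (rule that)
    show "(\<lambda>x. of_real (u x) + \<i> * of_real (v x)) \<in> borel_measurable borel" by measurable
    show "AE x in lborel. f x = of_real (u x) + \<i> * of_real (v x)"
      using uv by eventually_elim (simp add: complex_eq_iff)
  qed
qed

lemma set_integral_lebesgue_cong_AE:
  fixes f g :: "real \<Rightarrow> complex"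
  assumes f: "f \<in> borel_measurable lebesgue" and g: "g \<in> borel_measurable borel" and fg: "AE x in lborel. f x = g x"
    and h: "h \<in> borel_measurable borel"
  shows "(LINT x:{a..b}|lebesgue. h x * f x) = (LINT x|lborel. indicator {a..b} x *\<^sub>R (h x * g x))"
proof -
  have hl: "h \<in> borel_measurable lebesgue" by (intro measurable_completion) (simp add: h)
  have gl: "g \<in> borel_measurable lebesgue" by (intro measurable_completion) (simp add: g)
  have "(LINT x:{a..b}|lebesgue. h x * f x) = (LINT x|lebesgue. indicator {a..b} x *\<^sub>R (h x * g x))"
    unfolding set_lebesgue_integral_def
  proof (rule Bochner_Integration.integral_cong_AE)
    show "AE x in lebesgue. indicator {a..b} x *\<^sub>R (h x * f x) = indicator {a..b} x *\<^sub>R (h x * g x)"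
      using AE_completion[OF fg] by eventually_elim simp
  qed (intro borel_measurable_scaleR borel_measurable_indicator borel_measurable_times f gl hl; simp)+
  also have "\<dots> = (LINT x|lborel. indicator {a..b} x *\<^sub>R (h x * g x))"
    by (rule integral_completion)
      (use g h in \<open>auto intro!: borel_measurable_scaleR borel_measurable_indicator borel_measurable_times\<close>)
  finally show ?thesis .
qed

lemma set_integral_cis_eq_ft:
  assumes "f \<in> borel_measurable lebesgue" "g \<in> borel_measurable borel" "AE x in lborel. f x = g x"
  shows "(LINT x:{- R..R}|lebesgue. cis (s * k * x) * f x) = ft s (trunc R g) k"
  by (subst set_integral_lebesgue_cong_AE[OF assms]) (auto simp: ft_def trunc_def mult_ac)

lemma exp_minus_eq_cis: "exp (- \<i> * complex_of_real k * complex_of_real x) = cis ((- 1) * k * x)"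
  by (simp add: cis_conv_exp mult.assoc)

lemma exp_plus_eq_cis: "exp (\<i> * complex_of_real k * complex_of_real x) = cis (1 * k * x)"
  by (simp add: cis_conv_exp mult.assoc)

lemma square_integrable_representative:
  assumes "square_integrable f"
  obtains g where "g \<in> borel_measurable borel" "AE x in lborel. f x = g x" "integrable lborel (\<lambda>x. (norm (g x))\<^sup>2)"
proof -
  have f: "f \<in> borel_measurable lebesgue" "integrable lebesgue (\<lambda>x. (norm (f x))\<^sup>2)"
    using assms by (auto simp: square_integrable_def)
  obtain g where g: "g \<in> borel_measurable borel" "AE x in lborel. f x = g x"
    by (rule lebesgue_borel_representative[OF f(1)])
  have gm: "(\<lambda>x. (norm (g x))\<^sup>2) \<in> borel_measurable borel" using g(1) by measurable
  have "integrable lebesgue (\<lambda>x. (norm (g x))\<^sup>2)"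
  proof (rule integrable_cong_AE_imp[OF f(2)])
    show "(\<lambda>x. (norm (g x))\<^sup>2) \<in> borel_measurable lebesgue" by (intro measurable_completion) (simp add: gm)
    show "AE x in lebesgue. (norm (f x))\<^sup>2 = (norm (g x))\<^sup>2"
      using AE_completion[OF g(2)] by eventually_elim simp
  qed
  then have "integrable lborel (\<lambda>x. (norm (g x))\<^sup>2)" using gm by (simp add: integrable_completion)
  with g show ?thesis by (rule that)
qed

text \<open>This gives the witness that the choice operators in the definitions of both transforms
  rely on.\<close>

lemma L2_transform_exists:
  assumes f: "square_integrable f" and s: "\<bar>s\<bar> = 1"
  shows "\<exists>g. square_integrable g \<and> L2_tendsto (\<lambda>R k. LINT x:{- R..R}|lebesgue. cis (s * k * x) * f x) g"
proof -
  have fm: "f \<in> borel_measurable lebesgue" using f by (simp add: square_integrable_def)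
  obtain h where h: "h \<in> borel_measurable borel" "AE x in lborel. f x = h x" "integrable lborel (\<lambda>x. (norm (h x))\<^sup>2)"
    by (rule square_integrable_representative[OF f])
  obtain g where g: "g \<in> borel_measurable borel" "integrable lborel (\<lambda>k. (norm (g k))\<^sup>2)"
    "((\<lambda>R. \<integral>\<^sup>+k. ennreal ((norm (ft s (trunc R h) k - g k))\<^sup>2) \<partial>lborel) \<longlongrightarrow> 0) at_top"
    by (rule L2_ft_exists[OF h(1,3) s])
  have "(\<lambda>k. (norm (g k))\<^sup>2) \<in> borel_measurable borel" using g(1) by measurable
  then have "square_integrable g"
    unfolding square_integrable_def using g(1,2) by (auto simp: integrable_completion intro: measurable_completion)
  moreover have "L2_tendsto (\<lambda>R k. LINT x:{- R..R}|lebesgue. cis (s * k * x) * f x) g"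
    unfolding L2_tendsto_def set_integral_cis_eq_ft[OF fm h(1,2)] nn_integral_completion by (rule g(3))
  ultimately show ?thesis by blast
qed

lemma is_L2_fourier_L2_fourier:
  assumes "square_integrable f"
  shows "is_L2_fourier f (L2_fourier f)"
proof -
  have "\<exists>g. is_L2_fourier f g"
    unfolding is_L2_fourier_def exp_minus_eq_cis using L2_transform_exists[OF assms, of "- 1"] by simp
  then show ?thesis unfolding L2_fourier_def by (rule someI_ex)
qed

lemma square_integrable_bounded_mult:
  assumes f: "square_integrable f" and c: "c \<in> borel_measurable borel" "\<And>x. norm (c x) \<le> B"
  shows "square_integrable (\<lambda>x. c x * f x)"
  unfolding square_integrable_def
proof
  have fm: "f \<in> borel_measurable lebesgue" and f2: "integrable lebesgue (\<lambda>x. (norm (f x))\<^sup>2)"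
    using f by (auto simp: square_integrable_def)
  have cl: "c \<in> borel_measurable lebesgue" by (intro measurable_completion) (simp add: c)
  show m: "(\<lambda>x. c x * f x) \<in> borel_measurable lebesgue" by (rule borel_measurable_times[OF cl fm])
  show "integrable lebesgue (\<lambda>x. (norm (c x * f x))\<^sup>2)"
  proof (rule Bochner_Integration.integrable_bound)
    show "integrable lebesgue (\<lambda>x. B\<^sup>2 * (norm (f x))\<^sup>2)" by (intro integrable_mult_right f2)
    show "(\<lambda>x. (norm (c x * f x))\<^sup>2) \<in> borel_measurable lebesgue"
      using m by (intro borel_measurable_power measurable_compose[OF _ borel_measurable_norm])
    show "AE x in lebesgue. norm ((norm (c x * f x))\<^sup>2) \<le> norm (B\<^sup>2 * (norm (f x))\<^sup>2)"
    proof (rule AE_I2)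
      fix x
      have "(norm (c x))\<^sup>2 \<le> B\<^sup>2" using c(2)[of x] by (intro power_mono) auto
      then show "norm ((norm (c x * f x))\<^sup>2) \<le> norm (B\<^sup>2 * (norm (f x))\<^sup>2)"
        by (simp add: norm_mult power_mult_distrib mult_right_mono)
    qed
  qed
qed

lemma is_L2_inverse_fourier_L2_inverse_fourier:
  assumes "square_integrable g"
  shows "is_L2_inverse_fourier g (L2_inverse_fourier g)"
proof -
  let ?c = "1 / (2 * complex_of_real pi)"
  \<comment> \<open>The normalizing factor is absorbed into the function, so that existence for the
    sign 1 applies directly.\<close>
  have "square_integrable (\<lambda>k. ?c * g k)"
    by (rule square_integrable_bounded_mult[OF assms, where B = "norm ?c"]) auto
  from L2_transform_exists[OF this, of 1]
  have "\<exists>f. square_integrable f \<and> L2_tendsto (\<lambda>R x. LINT k:{- R..R}|lebesgue. cis (1 * x * k) * (?c * g k)) f" by simp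
  moreover have "(LINT k:{- R..R}|lebesgue. cis (1 * x * k) * (?c * g k)) = ?c * (LINT k:{- R..R}|lebesgue. cis (1 * k * x) * g k)" for R x
    unfolding set_lebesgue_integral_def integral_mult_right_zero[symmetric]
    by (intro Bochner_Integration.integral_cong refl) (simp add: mult_ac scaleR_conv_of_real)
  ultimately have "\<exists>f. is_L2_inverse_fourier g f"
    unfolding is_L2_inverse_fourier_def exp_plus_eq_cis by simp
  then show ?thesis unfolding L2_inverse_fourier_def by (rule someI_ex)
qed

text \<open>The cut-off makes the inversion integral a pairing of the transform with a bounded
  function of compact support. The transform is replaced by Fourier integrals of truncated data, for
  which Fubini produces the kernel; then the truncation of the data is removed on both
  sides.\<close>

lemma truncated_solution:
  assumes n: "2 \<le> n" and wn: "w n \<noteq> 0" and l: "growth_exponent n 0 \<le> l" and t: "0 < t" and R: "0 \<le> R"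
    and q2: "square_integrable q0" and ql: "weighted_integrable l q0" and Q: "is_L2_fourier q0 Q"
  shows "(LINT k:{- R..R}|lebesgue. exp (\<i> * complex_of_real k * complex_of_real x) *
       (exp (- \<i> * complex_of_real (dispersion n w k) * complex_of_real t) * Q k)) = conv q0 (trunc_kern n w R) x t"
proof -
  have q0m: "q0 \<in> borel_measurable lebesgue" using q2 by (simp add: square_integrable_def)
  obtain f where f [measurable]: "f \<in> borel_measurable borel" and qf: "AE x in lborel. q0 x = f x"
    and f2: "integrable lborel (\<lambda>x. (norm (f x))\<^sup>2)"
    by (rule square_integrable_representative[OF q2])
  have Q2: "square_integrable Q" and Q_lim: "L2_tendsto (\<lambda>R k. LINT x:{- R..R}|lebesgue. cis ((- 1) * k * x) * q0 x) Q"
    using Q unfolding is_L2_fourier_def exp_minus_eq_cis by auto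
  have Qm: "Q \<in> borel_measurable lebesgue" using Q2 by (simp add: square_integrable_def)
  obtain Q' where Q' [measurable]: "Q' \<in> borel_measurable borel" and QQ': "AE k in lborel. Q k = Q' k"
    and Q'2: "integrable lborel (\<lambda>k. (norm (Q' k))\<^sup>2)"
    by (rule square_integrable_representative[OF Q2])
  define T where "T N = ft (- 1) (trunc (real N) f)" for N
  have Tm [measurable]: "T N \<in> borel_measurable borel" for N unfolding T_def by measurable
  have inttr: "integrable lborel (trunc R f)" for R by (rule integrable_trunc[OF f f2])
  have T_lim: "(\<lambda>N. \<integral>\<^sup>+k. ennreal ((norm (T N k - Q' k))\<^sup>2) \<partial>lborel) \<longlonglongrightarrow> 0"
  proof -
    have "((\<lambda>R. \<integral>\<^sup>+k. ennreal ((norm (ft (- 1) (trunc R f) k - Q k))\<^sup>2) \<partial>lborel) \<longlongrightarrow> 0) at_top"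
      using Q_lim unfolding L2_tendsto_def set_integral_cis_eq_ft[OF q0m f qf] nn_integral_completion .
    from filterlim_compose[OF this filterlim_real_sequentially]
    have "(\<lambda>N. \<integral>\<^sup>+k. ennreal ((norm (T N k - Q k))\<^sup>2) \<partial>lborel) \<longlonglongrightarrow> 0" unfolding T_def .
    moreover have "(\<integral>\<^sup>+k. ennreal ((norm (T N k - Q k))\<^sup>2) \<partial>lborel) = (\<integral>\<^sup>+k. ennreal ((norm (T N k - Q' k))\<^sup>2) \<partial>lborel)" for N
      by (rule nn_integral_cong_AE) (use QQ' in \<open>eventually_elim, simp\<close>)
    ultimately show ?thesis by simp
  qed
  define c where "c k = indicator {- R..R} k *\<^sub>R cis (k * x - dispersion n w k * t)" for k
  have dm [measurable]: "dispersion n w \<in> borel_measurable borel"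
    by (rule borel_measurable_continuous_onI[OF continuous_on_dispersion])
  have cm [measurable]: "c \<in> borel_measurable borel" unfolding c_def[abs_def] by measurable
  have norm_c: "norm (c k) = indicator {- R..R} k" for k by (simp add: c_def)
  have intc: "integrable lborel c"
  proof (rule Bochner_Integration.integrable_bound)
    show "integrable lborel (indicator {- R..R} :: real \<Rightarrow> real)"
      by (intro integrable_real_indicator) (auto simp: emeasure_lborel_Icc_eq)
  qed (auto simp: norm_c)
  have intcQ: "integrable lborel (\<lambda>k. c k * Q' k)"
  proof (rule Bochner_Integration.integrable_bound[OF integrable_trunc[OF Q' Q'2, of R]])
    show "AE k in lborel. norm (c k * Q' k) \<le> norm (trunc R Q' k)"
      by (intro AE_I2) (simp add: norm_mult norm_c trunc_def)
  qed measurable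
  have intcT: "integrable lborel (\<lambda>k. c k * T N k)" for N
  proof (rule Bochner_Integration.integrable_bound)
    show "integrable lborel (\<lambda>k. of_real (LINT x|lborel. norm (trunc (real N) f x)) * c k)"
      by (intro integrable_mult_right intc)
    show "AE k in lborel. norm (c k * T N k) \<le> norm (of_real (LINT x|lborel. norm (trunc (real N) f x)) * c k)"
    proof (rule AE_I2)
      fix k
      have "norm (T N k) \<le> \<bar>LINT x|lborel. norm (trunc (real N) f x)\<bar>"
        using norm_ft_le[OF inttr, of "- 1" "real N" k] unfolding T_def by linarith
      from mult_left_mono[OF this, of "norm (c k)"]
      show "norm (c k * T N k) \<le> norm (of_real (LINT x|lborel. norm (trunc (real N) f x)) * c k)"
        by (simp add: norm_mult mult.commute)
    qed
  qed measurable
  have A_lim: "(\<lambda>N. LINT k|lborel. c k * T N k) \<longlonglongrightarrow> (LINT k|lborel. c k * Q' k)"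
  proof (rule LIM_zero_cancel, rule tendsto_norm_zero_cancel)
    define e where "e N = norm ((LINT k|lborel. c k * T N k) - (LINT k|lborel. c k * Q' k))" for N
    \<comment> \<open>Cauchy-Schwarz on \<open>{- R..R}\<close>, whose length is
      \<open>2 * R\<close>, turns mean-square convergence of the transforms into convergence of the
      pairings.\<close>
    have le: "ennreal ((e N)\<^sup>2) \<le> ennreal (2 * R) * (\<integral>\<^sup>+k. ennreal ((norm (T N k - Q' k))\<^sup>2) \<partial>lborel)" for N
    proof -
      have "ennreal (e N) = ennreal (norm (LINT k|lborel. c k * (T N k - Q' k)))"
        unfolding e_def using Bochner_Integration.integral_diff[OF intcT intcQ, of N] by (simp add: right_diff_distrib)
      also have "\<dots> \<le> (\<integral>\<^sup>+k. ennreal (norm (c k * (T N k - Q' k))) \<partial>lborel)" by (rule ennreal_norm_integral_le)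
      also have "\<dots> = (\<integral>\<^sup>+k. indicator {- R..R} k * ennreal (norm (T N k - Q' k)) \<partial>lborel)"
        by (intro nn_integral_cong) (auto simp: norm_mult norm_c indicator_def)
      finally have "ennreal ((e N)\<^sup>2) \<le> (\<integral>\<^sup>+k. indicator {- R..R} k * ennreal (norm (T N k - Q' k)) \<partial>lborel)\<^sup>2"
        using power_mono[of "ennreal (e N)" _ 2] by (simp add: ennreal_power e_def)
      also have "\<dots> \<le> (\<integral>\<^sup>+k. (indicator {- R..R} k)\<^sup>2 \<partial>lborel) * (\<integral>\<^sup>+k. (ennreal (norm (T N k - Q' k)))\<^sup>2 \<partial>lborel)"
        by (rule Cauchy_Schwarz_nn_integral) measurable
      also have "(\<integral>\<^sup>+k. (indicator {- R..R} k)\<^sup>2 \<partial>lborel) = (\<integral>\<^sup>+k. indicator {- R..R} k \<partial>lborel)"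
        by (intro nn_integral_cong) (auto simp: indicator_def)
      also have "\<dots> = ennreal (2 * R)" using R by (simp add: emeasure_lborel_Icc_eq)
      finally show ?thesis by (simp add: ennreal_power)
    qed
    have lim: "(\<lambda>N. ennreal (2 * R) * (\<integral>\<^sup>+k. ennreal ((norm (T N k - Q' k))\<^sup>2) \<partial>lborel)) \<longlonglongrightarrow> 0"
      using ennreal_tendsto_cmult[OF _ T_lim, of "ennreal (2 * R)"] by simp
    have "(\<lambda>N. ennreal ((e N)\<^sup>2)) \<longlonglongrightarrow> ennreal 0"
      unfolding ennreal_0
      by (rule tendsto_sandwich[OF always_eventually always_eventually tendsto_const lim]) (use le in auto)
    then have "(\<lambda>N. (e N)\<^sup>2) \<longlonglongrightarrow> 0" by (rule tendsto_ennrealD) auto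
    then have "(\<lambda>N. sqrt ((e N)\<^sup>2)) \<longlonglongrightarrow> sqrt 0" by (rule tendsto_real_sqrt)
    then show "(\<lambda>N. norm ((LINT k|lborel. c k * T N k) - (LINT k|lborel. c k * Q' k))) \<longlonglongrightarrow> 0"
      by (simp add: e_def)
  qed
  define K where "K y = trunc_kern n w R (x - y) t" for y
  note tame = tame_trunc_kern[of n w l R, OF n wn l R]
  have Km [measurable]: "K \<in> borel_measurable borel"
    unfolding K_def[abs_def] by (rule tame_borel_measurable[OF tame t])
  have A_eq: "(LINT k|lborel. c k * T N k) = (LINT y|lborel. trunc (real N) f y * K y)" for N
  proof -
    have "(LINT k|lborel. c k * T N k) = (LINT k|lborel. c k * (LINT y|lborel. trunc (real N) f y * cis (- 1 * k * y)))"
      by (simp only: T_def ft_def)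
    also have "\<dots> = (LINT y|lborel. trunc (real N) f y * (LINT k|lborel. c k * cis (- 1 * k * y)))"
      by (rule Fubini_bounded_kernel[where c = "\<lambda>y k. cis (- 1 * k * y)"]) (use inttr intc in auto)
    also have "\<dots> = (LINT y|lborel. trunc (real N) f y * K y)"
    proof (intro Bochner_Integration.integral_cong refl arg_cong2[where f = "(*)"])
      fix y
      have "c k * cis (- 1 * k * y) = indicator {- R..R} k *\<^sub>R osc n w 0 0 (x - y) t k" for k
        unfolding c_def osc_def by (simp add: cis_mult algebra_simps)
      then show "(LINT k|lborel. c k * cis (- 1 * k * y)) = K y"
        unfolding K_def trunc_kern_def integral_osc_eq_lborel by (simp only:)
    qed
    finally show ?thesis .
  qed
  \<comment> \<open>Integrability rests on the weight: the truncated kernel grows at most like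
    \<open>(1 + \<bar>x\<bar>) powr l\<close>, and \<open>q0\<close> has the matching weighted
    norm.\<close>
  have fK: "integrable lborel (\<lambda>y. f y * K y)" and conv_eq: "conv q0 (trunc_kern n w R) x t = (LINT y|lborel. f y * K y)"
  proof -
    have ae: "AE y in lebesgue. q0 y * trunc_kern n w R (x - y) t = f y * K y"
      using AE_completion[OF qf] by eventually_elim (simp add: K_def)
    have m: "(\<lambda>y. f y * K y) \<in> borel_measurable lborel" by measurable
    have ml: "(\<lambda>y. f y * K y) \<in> borel_measurable lebesgue" by (rule measurable_completion[OF m])
    have "integrable lebesgue (\<lambda>y. f y * K y)"
      by (rule integrable_cong_AE_imp[OF conv_integrable[OF tame ql t] ml ae])
    then show "integrable lborel (\<lambda>y. f y * K y)" using integrable_completion[OF m] by simp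
    have "conv q0 (trunc_kern n w R) x t = (LINT y|lebesgue. f y * K y)"
      unfolding conv_def by (rule Bochner_Integration.integral_cong_AE[OF conv_measurable[OF tame ql t] ml ae])
    also have "\<dots> = (LINT y|lborel. f y * K y)" by (rule integral_completion[OF m])
    finally show "conv q0 (trunc_kern n w R) x t = (LINT y|lborel. f y * K y)" .
  qed
  have "(\<lambda>N. LINT y|lborel. trunc (real N) f y * K y) \<longlonglongrightarrow> (LINT y|lborel. f y * K y)"
  proof (rule integral_dominated_convergence[where w = "\<lambda>y. norm (f y * K y)"])
    show "AE y in lborel. (\<lambda>N. trunc (real N) f y * K y) \<longlonglongrightarrow> f y * K y"
    proof (rule AE_I2, rule tendsto_eventually)
      fix y :: real
      obtain N0 :: nat where "\<bar>y\<bar> \<le> real N0" using real_arch_simple by blast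
      then show "\<forall>\<^sub>F N in sequentially. trunc (real N) f y * K y = f y * K y"
        unfolding eventually_sequentially by (intro exI[of _ N0]) (auto simp: trunc_def indicator_def)
    qed
    show "AE y in lborel. norm (trunc (real N) f y * K y) \<le> norm (f y * K y)" for N
      by (intro AE_I2) (auto simp: trunc_def indicator_def)
    show "integrable lborel (\<lambda>y. norm (f y * K y))" using fK by (rule Bochner_Integration.integrable_norm)
  qed measurable
  then have "(LINT k|lborel. c k * Q' k) = (LINT y|lborel. f y * K y)"
    using A_lim unfolding A_eq by (rule LIMSEQ_unique[rotated])
  moreover have "(LINT k:{- R..R}|lebesgue. exp (\<i> * complex_of_real k * complex_of_real x) *
       (exp (- \<i> * complex_of_real (dispersion n w k) * complex_of_real t) * Q k)) = (LINT k|lborel. c k * Q' k)"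
  proof -
    have e: "exp (\<i> * complex_of_real k * complex_of_real x) * (exp (- \<i> * complex_of_real (dispersion n w k) * complex_of_real t) * Q k)
      = cis (k * x - dispersion n w k * t) * Q k" for k
    proof -
      have "exp (\<i> * complex_of_real k * complex_of_real x) * exp (- \<i> * complex_of_real (dispersion n w k) * complex_of_real t)
        = cis (k * x - dispersion n w k * t)"
        by (simp add: cis_conv_exp exp_add[symmetric] algebra_simps)
      then show ?thesis by (simp only: mult.assoc[symmetric])
    qed
    have "(LINT k:{- R..R}|lebesgue. cis (k * x - dispersion n w k * t) * Q k)
      = (LINT k|lborel. indicator {- R..R} k *\<^sub>R (cis (k * x - dispersion n w k * t) * Q' k))"
      by (rule set_integral_lebesgue_cong_AE[OF Qm Q' QQ']) measurable
    then show ?thesis unfolding e c_def by simp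
  qed
  ultimately show ?thesis unfolding conv_eq by simp
qed

lemma dispersive_solution_AE_eq_conv:
  assumes n: "2 \<le> n" and wn: "w n \<noteq> 0" and l: "growth_exponent n 0 \<le> l" and t: "0 < t"
    and q2: "square_integrable q0" and ql: "weighted_integrable l q0"
  shows "AE x in lebesgue. 1 / (2 * complex_of_real pi) * conv q0 (kern n w 0) x t = dispersive_solution (dispersion n w) q0 x t"
proof -
  define Q where "Q = L2_fourier q0"
  have Q: "is_L2_fourier q0 Q" unfolding Q_def by (rule is_L2_fourier_L2_fourier[OF q2])
  define g where "g k = exp (- \<i> * complex_of_real (dispersion n w k) * complex_of_real t) * Q k" for k
  define q where "q x = dispersive_solution (dispersion n w) q0 x t" for x
  have q_eq: "q = L2_inverse_fourier g"
    unfolding q_def[abs_def] dispersive_solution_def g_def[abs_def] Q_def by simp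
  have "square_integrable g"
    unfolding g_def[abs_def]
  proof (rule square_integrable_bounded_mult)
    show "square_integrable Q" using Q by (simp add: is_L2_fourier_def)
    show "(\<lambda>k. exp (- \<i> * complex_of_real (dispersion n w k) * complex_of_real t)) \<in> borel_measurable borel"
      by (intro borel_measurable_continuous_onI continuous_intros continuous_on_dispersion)
    show "norm (exp (- \<i> * complex_of_real (dispersion n w k) * complex_of_real t)) \<le> 1" for k
      by (simp add: norm_exp_eq_Re)
  qed
  from is_L2_inverse_fourier_L2_inverse_fourier[OF this]
  have qm: "q \<in> borel_measurable lebesgue" and q_lim: "L2_tendsto (\<lambda>R x. 1 / (2 * complex_of_real pi) *
                   (LINT k:{-R..R}|lebesgue. exp (\<i> * complex_of_real k * complex_of_real x) * g k)) q"
    unfolding q_eq[symmetric] is_L2_inverse_fourier_def square_integrable_def by auto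
  define u where "u x = 1 / (2 * complex_of_real pi) * conv q0 (kern n w 0) x t" for x
  define V where "V N x = 1 / (2 * complex_of_real pi) * conv q0 (trunc_kern n w (real N)) x t" for N x
  have V_lim: "(\<lambda>N. V N x) \<longlonglongrightarrow> u x" for x
    unfolding V_def u_def
    by (intro tendsto_mult tendsto_const conv_trunc_kern_tendsto[of n w l q0 t, OF n wn l ql t])
  \<comment> \<open>Convolutions with tame kernels are continuous in \<open>x\<close>, which gives
    the measurability needed for Fatou's lemma.\<close>
  have meas: "(\<lambda>x. 1 / (2 * complex_of_real pi) * conv q0 G x t) \<in> borel_measurable borel" if G: "tame l G" for G
  proof (rule borel_measurable_continuous_onI, rule continuous_on_mult_left)
    have "continuous_on UNIV (\<lambda>x. (x, t))" by (intro continuous_intros)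
    moreover have "range (\<lambda>x. (x, t)) \<subseteq> UNIV \<times> {0<..}" using t by auto
    ultimately have "continuous_on UNIV (\<lambda>x. conv q0 G (fst (x, t)) (snd (x, t)))"
      by (rule continuous_on_compose2[OF continuous_on_conv[OF G ql]])
    then show "continuous_on UNIV (\<lambda>x. conv q0 G x t)" by (simp only: fst_conv snd_conv)
  qed
  have um: "u \<in> borel_measurable lebesgue"
    unfolding u_def[abs_def] by (rule measurable_completion) (use meas[OF tame_kern[of n w 0 l, OF n wn l]] in \<open>simp only: measurable_lborel2\<close>)
  have Vm: "V N \<in> borel_measurable lebesgue" for N
    unfolding V_def[abs_def] by (rule measurable_completion) (use meas[OF tame_trunc_kern[of n w l "real N", OF n wn l]] in \<open>simp only: measurable_lborel2 of_nat_0_le_iff\<close>)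
  have sqm: "(\<lambda>x. ennreal ((norm (F x - q x))\<^sup>2)) \<in> borel_measurable lebesgue" if "F \<in> borel_measurable lebesgue" for F
  proof -
    note that [measurable] qm [measurable]
    show ?thesis by measurable
  qed
  \<comment> \<open>The functions \<open>V N\<close> are the truncated inversion integrals whose
    mean-square limit defines \<open>q\<close>, taken along integer radii.\<close>
  have "(\<lambda>N. \<integral>\<^sup>+x. ennreal ((norm (V N x - q x))\<^sup>2) \<partial>lebesgue) \<longlonglongrightarrow> 0"
  proof -
    have "V N x = 1 / (2 * complex_of_real pi) * (LINT k:{- real N..real N}|lebesgue. exp (\<i> * complex_of_real k * complex_of_real x) * g k)" for N x
      unfolding V_def g_def using truncated_solution[of n w l t "real N" q0 Q x, OF n wn l t _ q2 ql Q] by simp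
    then show ?thesis
      using filterlim_compose[OF q_lim[unfolded L2_tendsto_def] filterlim_real_sequentially] by simp
  qed
  then have lim0: "liminf (\<lambda>N. \<integral>\<^sup>+x. ennreal ((norm (V N x - q x))\<^sup>2) \<partial>lebesgue) = 0"
    by (intro lim_imp_Liminf) auto
  have "(\<integral>\<^sup>+x. ennreal ((norm (u x - q x))\<^sup>2) \<partial>lebesgue) = (\<integral>\<^sup>+x. liminf (\<lambda>N. ennreal ((norm (V N x - q x))\<^sup>2)) \<partial>lebesgue)"
    by (intro nn_integral_cong lim_imp_Liminf[symmetric] tendsto_ennrealI tendsto_intros V_lim) auto
  also have "\<dots> \<le> liminf (\<lambda>N. \<integral>\<^sup>+x. ennreal ((norm (V N x - q x))\<^sup>2) \<partial>lebesgue)"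
    by (rule nn_integral_liminf[OF sqm[OF Vm]])
  finally have "(\<integral>\<^sup>+x. ennreal ((norm (u x - q x))\<^sup>2) \<partial>lebesgue) = 0" unfolding lim0 by simp
  then have "AE x in lebesgue. ennreal ((norm (u x - q x))\<^sup>2) = 0"
    using nn_integral_0_iff_AE[OF sqm[OF um]] by simp
  then show ?thesis unfolding u_def[symmetric] q_def[symmetric] by eventually_elim simp
qed

section \<open>Iterated derivatives and the regularity statement\<close>

text \<open>Openness of \<open>S\<close> lets an identity on \<open>S\<close> pass to two-sided
  derivatives at its points. In the time variable \<open>S\<close> is the half-line of positive
  times, the only region where \<open>u\<close> is the convolution.\<close>

lemma nth_vderiv_eq:
  assumes S: "open S" and F: "\<And>i x. i < m \<Longrightarrow> x \<in> S \<Longrightarrow> (F i has_vector_derivative F (Suc i) x) (at x)"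
    and f: "\<And>x. x \<in> S \<Longrightarrow> f x = F 0 x"
  shows "i \<le> m \<Longrightarrow> x \<in> S \<Longrightarrow> nth_vderiv i f x = F i x"
proof (induction i arbitrary: x)
  case 0
  then show ?case by (simp add: nth_vderiv_def f)
next
  case (Suc i)
  have "(F i has_vector_derivative F (Suc i) x) (at x)" using F Suc.prems by simp
  then have "(nth_vderiv i f has_vector_derivative F (Suc i) x) (at x)"
    by (rule has_vector_derivative_transform_within_open[OF _ S Suc.prems(2)]) (use Suc in auto)
  then show ?case by (simp add: nth_vderiv_def vector_derivative_at)
qed

lemma times_differentiable_onI:
  assumes S: "open S" and F: "\<And>i x. i < m \<Longrightarrow> x \<in> S \<Longrightarrow> (F i has_vector_derivative F (Suc i) x) (at x)"
    and f: "\<And>x. x \<in> S \<Longrightarrow> f x = F 0 x"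
  shows "times_differentiable_on m f S"
  unfolding times_differentiable_on_def
proof (intro allI impI ballI)
  fix i x assume i: "i < m" and x: "x \<in> S"
  have "(nth_vderiv i f has_vector_derivative F (Suc i) x) (at x)"
    by (rule has_vector_derivative_transform_within_open[OF F[OF i x] S x])
      (use nth_vderiv_eq[OF S F f, of m i] i in auto)
  then show "nth_vderiv i f differentiable (at x)" by (rule differentiableI_vector)
qed

text \<open>A single modification \<open>u\<close> must serve all orders in \<open>x\<close> and in
  \<open>t\<close>; the convolution does, since its definition involves no order of
  differentiation.\<close>

theorem mainTheorem1:
  fixes n :: nat and w :: "nat \<Rightarrow> real" and l :: real and q0 :: "real \<Rightarrow> complex"
    and q :: "real \<Rightarrow> real \<Rightarrow> complex"
  assumes "n \<ge> 2"
    and "w n \<noteq> 0"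
    and "square_integrable q0"
    and "weighted_integrable l q0"
    and q_def: "q = dispersive_solution (dispersion n w) q0"
  shows "\<exists>u :: real \<Rightarrow> real \<Rightarrow> complex.
     (\<forall>t. AE x in lebesgue. u x t = q x t) \<and>
     (\<forall>m::nat. l \<ge> (2 * real m - real n + 2) / (2 * (real n - 1)) \<longrightarrow>
        (\<forall>t>0. times_differentiable_on m (\<lambda>x. u x t) UNIV) \<and>
        continuous_on (UNIV \<times> {0<..}) (\<lambda>(x, t). nth_vderiv m (\<lambda>y. u y t) x)) \<and>
     (\<forall>j::nat. l \<ge> (2 * real j * real n - real n + 2) / (2 * (real n - 1)) \<longrightarrow>
        (\<forall>x. times_differentiable_on j (\<lambda>t. u x t) {0<..}) \<and>
        continuous_on (UNIV \<times> {0<..}) (\<lambda>(x, t). nth_vderiv j (\<lambda>s. u x s) t))"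
proof -
  note n = assms(1) and wn = assms(2) and q2 = assms(3) and ql = assms(4)
  define c where "c = 1 / (2 * complex_of_real pi)"
  \<comment> \<open>Taking \<open>q\<close> itself in the other cases makes the almost everywhere
    equality hold for all \<open>t\<close>. If \<open>growth_exponent n 0 > l\<close>, then by
    monotonicity no \<open>m\<close> and no \<open>j\<close> satisfies the condition on
    \<open>l\<close>, and no regularity is claimed.\<close>
  define u where "u x t = (if 0 < t \<and> growth_exponent n 0 \<le> l then c * conv q0 (kern n w 0) x t else q x t)" for x t
  have ae: "AE x in lebesgue. u x t = q x t" for t
    using dispersive_solution_AE_eq_conv[of n w l t q0, OF n wn _ _ q2 ql]
    by (cases "0 < t \<and> growth_exponent n 0 \<le> l") (auto simp: u_def c_def q_def)
  have x_part: "(\<forall>t>0. times_differentiable_on m (\<lambda>x. u x t) UNIV) \<and>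
        continuous_on (UNIV \<times> {0<..}) (\<lambda>(x, t). nth_vderiv m (\<lambda>y. u y t) x)"
    if "growth_exponent n m \<le> l" for m
  proof -
    have gi: "growth_exponent n i \<le> l" if "i \<le> m" for i
      using growth_exponent_mono[OF n that] \<open>growth_exponent n m \<le> l\<close> by linarith
    have tame: "tame l (kern n w i)" if "i \<le> m" for i by (rule tame_kern[of n w i l, OF n wn gi[OF that]])
    \<comment> \<open>Each space derivative of \<open>kern\<close> produces a factor
      \<open>\<i>\<close> and raises the order by one, whence \<open>\<i> ^ i\<close>.\<close>
    define F where "F t i x = c * \<i> ^ i * conv q0 (kern n w i) x t" for t i x
    have F: "(F t i has_vector_derivative F t (Suc i) x) (at x)" if "0 < t" "i < m" for t i x
    proof -
      have D: "((\<lambda>x. conv q0 (kern n w i) x t) has_vector_derivative conv q0 (\<lambda>x t. \<i> * kern n w (i + 1) x t) x t) (at x)"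
      proof (rule conv_has_vector_derivative_x[OF _ _ ql \<open>0 < t\<close>])
        show "tame l (kern n w i)" "tame l (\<lambda>x t. \<i> * kern n w (i + 1) x t)"
          using that by (auto intro!: tame tame_cmult)
        show "((\<lambda>x. kern n w i x t) has_vector_derivative \<i> * kern n w (i + 1) x t) (at x)" for x
          by (rule kern_has_vector_derivative_x[of n w t i x, OF n wn \<open>0 < t\<close>])
      qed
      have eq: "conv q0 (\<lambda>x t. \<i> * kern n w (i + 1) x t) x t = \<i> * conv q0 (kern n w (i + 1)) x t"
        unfolding conv_def integral_mult_right_zero[symmetric] by (simp only: mult.left_commute)
      from has_vector_derivative_mult_right[OF D, of "c * \<i> ^ i"]
      show ?thesis unfolding F_def[abs_def] eq by (simp add: mult_ac)
    qed
    have uF: "u x t = F t 0 x" if "0 < t" for x t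
      using that gi[of 0] by (simp add: u_def F_def)
    have "times_differentiable_on m (\<lambda>x. u x t) UNIV" if "0 < t" for t
      by (rule times_differentiable_onI[where F = "F t"]) (use F uF that in auto)
    moreover have "continuous_on (UNIV \<times> {0<..}) (\<lambda>(x, t). nth_vderiv m (\<lambda>y. u y t) x)"
    proof -
      have "continuous_on (UNIV \<times> {0<..}) (\<lambda>z. c * \<i> ^ m * conv q0 (kern n w m) (fst z) (snd z))"
        by (intro continuous_on_mult_left continuous_on_conv[OF tame ql]) simp
      moreover have "nth_vderiv m (\<lambda>y. u y t) x = c * \<i> ^ m * conv q0 (kern n w m) x t" if "0 < t" for x t
        using nth_vderiv_eq[of UNIV m "F t" "\<lambda>y. u y t" m x] F uF that by (simp add: F_def)
      ultimately show ?thesis by (subst continuous_on_cong[OF refl]) auto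
    qed
    ultimately show ?thesis by blast
  qed
  have t_part: "(\<forall>x. times_differentiable_on j (\<lambda>t. u x t) {0<..}) \<and>
        continuous_on (UNIV \<times> {0<..}) (\<lambda>(x, t). nth_vderiv j (\<lambda>s. u x s) t)"
    if "growth_exponent n (n * j) \<le> l" for j
  proof -
    have tame: "tame l (tkern n w i 0)" if "i \<le> j" for i
    proof (rule tame_tkern[of n w 0 i l, OF n wn])
      have "growth_exponent n (0 + n * i) \<le> growth_exponent n (n * j)"
        using that by (intro growth_exponent_mono n) simp
      then show "growth_exponent n (0 + n * i) \<le> l" using \<open>growth_exponent n (n * j) \<le> l\<close> by linarith
    qed
    have g0: "growth_exponent n 0 \<le> l"
      using growth_exponent_mono[OF n, of 0 "n * j"] that by linarith
    define F where "F x i t = c * conv q0 (tkern n w i 0) x t" for x i t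
    have F: "(F x i has_vector_derivative F x (Suc i) t) (at t)" if "0 < t" "i < j" for t i x
    proof -
      have "((\<lambda>t. conv q0 (tkern n w i 0) x t) has_vector_derivative conv q0 (tkern n w (Suc i) 0) x t) (at t)"
      proof (rule conv_has_vector_derivative_t[OF _ _ ql \<open>0 < t\<close>])
        show "tame l (tkern n w i 0)" "tame l (tkern n w (Suc i) 0)" using that by (auto intro!: tame simp del: tkern.simps)
        show "((\<lambda>t. tkern n w i 0 x t) has_vector_derivative tkern n w (Suc i) 0 x t) (at t)" if "0 < t" for x t
          by (rule tkern_has_vector_derivative_t[of n w t i 0 x, OF n wn that])
      qed
      then show ?thesis unfolding F_def[abs_def] by (rule has_vector_derivative_mult_right)
    qed
    have uF: "u x t = F x 0 t" if "0 < t" for x t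
      using that g0 by (simp add: u_def F_def)
    have "times_differentiable_on j (\<lambda>t. u x t) {0<..}" for x
      by (rule times_differentiable_onI[where F = "F x"]) (use F uF in auto)
    moreover have "continuous_on (UNIV \<times> {0<..}) (\<lambda>(x, t). nth_vderiv j (\<lambda>s. u x s) t)"
    proof -
      have "continuous_on (UNIV \<times> {0<..}) (\<lambda>z. c * conv q0 (tkern n w j 0) (fst z) (snd z))"
        by (intro continuous_on_mult_left continuous_on_conv[OF tame ql]) simp
      moreover have "nth_vderiv j (\<lambda>s. u x s) t = c * conv q0 (tkern n w j 0) x t" if "0 < t" for x t
        using nth_vderiv_eq[of "{0<..}" j "F x" "\<lambda>s. u x s" j t] F uF that by (simp add: F_def)
      ultimately show ?thesis by (subst continuous_on_cong[OF refl]) auto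
    qed
    ultimately show ?thesis by blast
  qed
  \<comment> \<open>One time derivative counts as \<open>n\<close> space derivatives: the condition
    in (ii) is that of (i) at order \<open>n * j\<close>.\<close>
  have gj: "growth_exponent n (n * j) = (2 * real j * real n - real n + 2) / (2 * (real n - 1))" for j
    by (simp add: growth_exponent_def mult_ac)
  show ?thesis
    using ae x_part[unfolded growth_exponent_def] t_part[unfolded gj] by (intro exI[of _ u]) blast
qed

end
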